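(* Let $q,c\in L^2(0,T;L^2(\Omega))$. Then the state equation $$\partial_t u-{}^R\partial_t^{1-\alpha(t)}\Delta u=q+c\text{ in }\Omega\times(0,T],\quad u(\cdot,0)=0\text{ in }\Omega,\quad u=0\text{ on }\partial\Omega\times[0,T]$$ has a unique solution $u\in H^1(0,T;L^2(\Omega))\cap L^2(0,T;\check H^2(\Omega))$, and $$\|u\|_{H^1(L^2)}+\|u\|_{L^2(\check H^2)}\le Q\|q+c\|_{L^2(L^2)}.$$
   Context: $T>0$; $\Omega\subset\mathbb R^d$, $1\le d\le 3$, is a simply-connected bounded domain with piecewise smooth boundary with convex corners. $\alpha:[0,T]\to\mathbb R$ satisfies $0<\alpha(t)<1$, $|\alpha'(t)|\le Q_*$. $L^p(\mathcal Y)=L^p(0,T;\mathcal Y)$, $H^m(\mathcal Y)=H^m(0,T;\mathcal Y)$. $\check H^s(\Omega)=\{v\in L^2:\sum_i\lambda_i^s(v,\phi_i)^2<\infty\}$, with $\{\lambda_i,\phi_i\}$ Dirichlet eigenpairs of $-\Delta$ on $\Omega$. With $k(t)=t^{\alpha(t)-1}/\Gamma(\alpha(t))$, ${}^R\partial_t^{1-\alpha(t)}u=\partial_t\int_0^t k(t-s)u(s)ds$. $Q$ is a positive constant independent of $q,c$. *)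

theory Defs
  imports "HOL-Analysis.Analysis"
begin

definition L2_on :: "'a::euclidean_space set \<Rightarrow> ('a \<Rightarrow> real) \<Rightarrow> bool" where
  "L2_on S f \<longleftrightarrow> f \<in> borel_measurable (lebesgue_on S)
      \<and> integrable (lebesgue_on S) (\<lambda>x. (f x)^2)"

definition ip_on :: "'a::euclidean_space set \<Rightarrow> ('a \<Rightarrow> real) \<Rightarrow> ('a \<Rightarrow> real) \<Rightarrow> real" where
  "ip_on S f g = integral\<^sup>L (lebesgue_on S) (\<lambda>x. f x * g x)"

definition Cc1_on :: "'a::euclidean_space set \<Rightarrow> ('a \<Rightarrow> real) \<Rightarrow> ('a \<Rightarrow> 'a) \<Rightarrow> bool" where
  "Cc1_on S psi Gpsi \<longleftrightarrow> (\<forall>x. (psi has_derivative (\<lambda>h. Gpsi x \<bullet> h)) (at x))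
      \<and> continuous_on UNIV Gpsi
      \<and> (\<exists>K. compact K \<and> K \<subseteq> S \<and> (\<forall>x. x \<notin> K \<longrightarrow> psi x = 0))"

definition H10_with_grad :: "'a::euclidean_space set \<Rightarrow> ('a \<Rightarrow> real) \<Rightarrow> ('a \<Rightarrow> 'a) \<Rightarrow> bool" where
  "H10_with_grad S f G \<longleftrightarrow> L2_on S f
      \<and> G \<in> borel_measurable (lebesgue_on S)
      \<and> integrable (lebesgue_on S) (\<lambda>x. (norm (G x))^2)
      \<and> (\<exists>psi Gpsi. (\<forall>n. Cc1_on S (psi n) (Gpsi n))
          \<and> (\<lambda>n. integral\<^sup>L (lebesgue_on S) (\<lambda>x. (psi n x - f x)^2)) \<longlonglongrightarrow> 0
          \<and> (\<lambda>n. integral\<^sup>L (lebesgue_on S) (\<lambda>x. (norm (Gpsi n x - G x))^2)) \<longlonglongrightarrow> 0)"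

definition dirichlet_eigensystem :: "'a::euclidean_space set \<Rightarrow> (nat \<Rightarrow> real) \<Rightarrow> (nat \<Rightarrow> 'a \<Rightarrow> real) \<Rightarrow> bool" where
  "dirichlet_eigensystem S lam phi \<longleftrightarrow>
     (\<forall>i. \<exists>G. H10_with_grad S (phi i) G
          \<and> (\<forall>psi Gpsi. Cc1_on S psi Gpsi \<longrightarrow>
               integral\<^sup>L (lebesgue_on S) (\<lambda>x. G x \<bullet> Gpsi x) = lam i * ip_on S (phi i) psi))
   \<and> (\<forall>i j. ip_on S (phi i) (phi j) = (if i = j then 1 else 0))
   \<and> (\<forall>f. L2_on S f \<longrightarrow> (\<forall>i. ip_on S f (phi i) = 0) \<longrightarrow> (AE x in lebesgue_on S. f x = 0))"

definition in_checkH :: "'a::euclidean_space set \<Rightarrow> (nat \<Rightarrow> real) \<Rightarrow> (nat \<Rightarrow> 'a \<Rightarrow> real) \<Rightarrow> real \<Rightarrow> ('a \<Rightarrow> real) \<Rightarrow> bool" where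
  "in_checkH S lam phi s f \<longleftrightarrow> L2_on S f \<and> summable (\<lambda>i. lam i powr s * (ip_on S f (phi i))^2)"

definition checkH_norm :: "'a::euclidean_space set \<Rightarrow> (nat \<Rightarrow> real) \<Rightarrow> (nat \<Rightarrow> 'a \<Rightarrow> real) \<Rightarrow> real \<Rightarrow> ('a \<Rightarrow> real) \<Rightarrow> real" where
  "checkH_norm S lam phi s f = sqrt (\<Sum>i. lam i powr s * (ip_on S f (phi i))^2)"

definition L2L2 :: "real \<Rightarrow> 'a::euclidean_space set \<Rightarrow> (real \<Rightarrow> 'a \<Rightarrow> real) \<Rightarrow> bool" where
  "L2L2 T S u \<longleftrightarrow> L2_on ({0..T} \<times> S) (\<lambda>z. u (fst z) (snd z))"

definition L2L2_norm :: "real \<Rightarrow> 'a::euclidean_space set \<Rightarrow> (real \<Rightarrow> 'a \<Rightarrow> real) \<Rightarrow> real" where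
  "L2L2_norm T S u = sqrt (integral\<^sup>L (lebesgue_on ({0..T} \<times> S)) (\<lambda>z. (u (fst z) (snd z))^2))"

text \<open>u \<in> H^1(0,T;L^2(S)) with time derivative ut (absolutely continuous representative).\<close>
definition has_time_deriv_L2L2 :: "real \<Rightarrow> 'a::euclidean_space set \<Rightarrow> (real \<Rightarrow> 'a \<Rightarrow> real) \<Rightarrow> (real \<Rightarrow> 'a \<Rightarrow> real) \<Rightarrow> bool" where
  "has_time_deriv_L2L2 T S u ut \<longleftrightarrow> L2L2 T S u \<and> L2L2 T S ut
     \<and> (AE x in lebesgue_on S. \<forall>t\<in>{0..T}.
           integrable (lebesgue_on {0..t}) (\<lambda>s. ut s x)
         \<and> u t x = u 0 x + integral\<^sup>L (lebesgue_on {0..t}) (\<lambda>s. ut s x))"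

definition H1L2_norm :: "real \<Rightarrow> 'a::euclidean_space set \<Rightarrow> (real \<Rightarrow> 'a \<Rightarrow> real) \<Rightarrow> (real \<Rightarrow> 'a \<Rightarrow> real) \<Rightarrow> real" where
  "H1L2_norm T S u ut = sqrt ((L2L2_norm T S u)^2 + (L2L2_norm T S ut)^2)"

definition L2checkH2 :: "real \<Rightarrow> 'a::euclidean_space set \<Rightarrow> (nat \<Rightarrow> real) \<Rightarrow> (nat \<Rightarrow> 'a \<Rightarrow> real) \<Rightarrow> (real \<Rightarrow> 'a \<Rightarrow> real) \<Rightarrow> bool" where
  "L2checkH2 T S lam phi u \<longleftrightarrow>
     (AE t in lebesgue_on {0..T}. in_checkH S lam phi 2 (u t))
   \<and> integrable (lebesgue_on {0..T}) (\<lambda>t. (checkH_norm S lam phi 2 (u t))^2)"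

definition L2checkH2_norm :: "real \<Rightarrow> 'a::euclidean_space set \<Rightarrow> (nat \<Rightarrow> real) \<Rightarrow> (nat \<Rightarrow> 'a \<Rightarrow> real) \<Rightarrow> (real \<Rightarrow> 'a \<Rightarrow> real) \<Rightarrow> real" where
  "L2checkH2_norm T S lam phi u =
     sqrt (integral\<^sup>L (lebesgue_on {0..T}) (\<lambda>t. (checkH_norm S lam phi 2 (u t))^2))"

definition vo_kernel :: "(real \<Rightarrow> real) \<Rightarrow> real \<Rightarrow> real" where
  "vo_kernel \<alpha> t = t powr (\<alpha> t - 1) / Gamma (\<alpha> t)"

text \<open>u (with time derivative ut) solves
  u_t - {}^R\<partial>_t^{1-\<alpha>(t)} \<Delta>u = f in S x (0,T], u(.,0)=0, u = 0 on the boundary,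
  where \<Delta> is the (spectrally defined) Dirichlet Laplacian: Lu(t) = \<Delta>u(t),
  and D is the time derivative of t \<mapsto> \<integral>_0^t k(t-s) Lu(s) ds.\<close>
definition state_solution ::
  "'a::euclidean_space set \<Rightarrow> (nat \<Rightarrow> real) \<Rightarrow> (nat \<Rightarrow> 'a \<Rightarrow> real) \<Rightarrow> (real \<Rightarrow> real) \<Rightarrow> real
     \<Rightarrow> (real \<Rightarrow> 'a \<Rightarrow> real) \<Rightarrow> (real \<Rightarrow> 'a \<Rightarrow> real) \<Rightarrow> (real \<Rightarrow> 'a \<Rightarrow> real) \<Rightarrow> bool" where
  "state_solution S lam phi \<alpha> T f u ut \<longleftrightarrow>
     has_time_deriv_L2L2 T S u ut
   \<and> L2checkH2 T S lam phi u
   \<and> (AE x in lebesgue_on S. u 0 x = 0)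
   \<and> (\<exists>Lu D. L2L2 T S Lu
        \<and> (AE t in lebesgue_on {0..T}. L2_on S (Lu t) \<and>
             (\<forall>i. ip_on S (Lu t) (phi i) = - lam i * ip_on S (u t) (phi i)))
        \<and> has_time_deriv_L2L2 T S
            (\<lambda>t x. integral\<^sup>L (lebesgue_on {0..t}) (\<lambda>s. vo_kernel \<alpha> (t - s) * Lu s x)) D
        \<and> (AE z in lebesgue_on ({0..T} \<times> S).
             ut (fst z) (snd z) - D (fst z) (snd z) = f (fst z) (snd z)))"

end

theory Submission
  imports Defs
begin

text \<open>Expanding in the eigenfunctions turns the state equation into the scalar Volterra equations
  \<open>w + \<mu> k * w = f\<close> for \<open>w = u'\<close>, with \<open>\<mu> = lam i \<ge> 0\<close>, and the point is a bound which is uniform in \<open>\<mu>\<close>.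
  Let \<open>a = \<alpha> 0\<close> and let \<open>\<beta>\<close> and \<open>\<beta>'\<close> be the Abel kernels of orders \<open>a\<close> and \<open>1 - a\<close>, so that
  \<open>\<beta>' * \<beta> = 1\<close>. Since \<open>\<alpha>\<close> is Lipschitz, \<open>k - \<beta>\<close> has an integrable derivative \<open>p\<close>, and
  \<open>k * \<beta>' = 1 + 1 * m\<close> with \<open>m = p * \<beta>'\<close> integrable. With \<open>z = \<mu> \<beta> * w\<close> the equation reads
  \<open>w + z + m * z = f\<close>. In the norm weighted by \<open>exp (- \<sigma> t)\<close> the Abel kernel is positive semidefinite, which gives
  \<open>\<parallel>w\<parallel>\<^sup>2 + \<parallel>z\<parallel>\<^sup>2 \<le> \<parallel>f - m * z\<parallel>\<^sup>2\<close>, and for large \<open>\<sigma>\<close> the last term is absorbed. The bounds sum up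
  to functions \<open>W\<close> and \<open>Z\<close> on space-time, and \<open>u = 1 * W\<close>, \<open>\<Delta>u = - \<beta>' * Z\<close>. Uniqueness holds mode by mode
  because a Volterra operator with integrable kernel is a contraction in a weighted norm.\<close>

section \<open>Square-integrable functions\<close>

text \<open>The obstacle is the factor \<open>\<mu>\<close>. With a variable order the kernel k is
  not known to be positive, so the energy estimate has to come from an Abel kernel of frozen order,
  and a remainder \<open>\<mu> (k - \<beta>) * w\<close> estimated as it stands would grow with
  \<open>\<mu>\<close>. Since \<open>\<beta>' * \<beta> = 1\<close>, the remainder
  \<open>\<mu> (1 * p) * w\<close> is the convolution of \<open>p * \<beta>'\<close> with
  \<open>\<mu> \<beta> * w\<close>: the eigenvalue disappears into z, which the energy estimate
  controls as well as w. The same identity gives \<open>\<mu> 1 * w = \<beta>' * z\<close>, hence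
  the bound on the Laplacian. The order is frozen at 0 because k depends on the elapsed time and is
  singular only where that time is 0. Positivity survives the exponential weight because the Abel
  kernel is a Laplace superposition of decaying exponentials, and the weight merely shifts the decay
  rates. Uniqueness asks for no uniformity in \<open>\<mu>\<close>, so there the equation can be
  used directly for u and k.\<close>

definition l2 :: "'a measure \<Rightarrow> ('a \<Rightarrow> real) \<Rightarrow> bool" where
  "l2 M f \<longleftrightarrow> f \<in> borel_measurable M \<and> integrable M (\<lambda>x. (f x)\<^sup>2)"

definition n2 :: "'a measure \<Rightarrow> ('a \<Rightarrow> real) \<Rightarrow> real" where
  "n2 M f = sqrt (LINT x|M. (f x)\<^sup>2)"

lemma l2_measurable [measurable_dest]: "l2 M f \<Longrightarrow> f \<in> borel_measurable M"
  by (simp add: l2_def)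

lemma l2_integrable: "l2 M f \<Longrightarrow> integrable M (\<lambda>x. (f x)\<^sup>2)"
  by (simp add: l2_def)

lemma l2_mult_integrable:
  assumes "l2 M f" "l2 M g" shows "integrable M (\<lambda>x. f x * g x)"
proof (rule Bochner_Integration.integrable_bound)
  show "integrable M (\<lambda>x. (f x)\<^sup>2 + (g x)\<^sup>2)" using assms by (auto simp: l2_def)
  have "\<bar>a * b\<bar> \<le> \<bar>a\<^sup>2 + b\<^sup>2\<bar>" for a b :: real
  proof -
    have "2 * (\<bar>a\<bar> * \<bar>b\<bar>) \<le> a\<^sup>2 + b\<^sup>2" using sum_squares_bound[of "\<bar>a\<bar>" "\<bar>b\<bar>"] by simp
    moreover have "0 \<le> \<bar>a\<bar> * \<bar>b\<bar>" by simp
    ultimately show ?thesis unfolding abs_mult abs_of_nonneg[OF add_nonneg_nonneg[OF zero_le_power2 zero_le_power2]] by linarith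
  qed
  then show "AE x in M. norm (f x * g x) \<le> norm ((f x)\<^sup>2 + (g x)\<^sup>2)" by auto
qed (use assms in \<open>auto simp: l2_def\<close>)

lemma l2_lincomb:
  assumes "l2 M f" "l2 M g" shows "l2 M (\<lambda>x. c * f x + d * g x)"
proof -
  have [measurable]: "f \<in> borel_measurable M" "g \<in> borel_measurable M" using assms by (auto simp: l2_def)
  have "integrable M (\<lambda>x. c\<^sup>2 * (f x)\<^sup>2 + (2*c*d) * (f x * g x) + d\<^sup>2 * (g x)\<^sup>2)"
    using assms l2_mult_integrable[OF assms] by (auto simp: l2_def)
  also have "(\<lambda>x. c\<^sup>2 * (f x)\<^sup>2 + (2*c*d) * (f x * g x) + d\<^sup>2 * (g x)\<^sup>2) = (\<lambda>x. (c * f x + d * g x)\<^sup>2)"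
    by (auto simp: power2_eq_square algebra_simps)
  finally show ?thesis by (simp add: l2_def)
qed

lemma l2_zero [simp]: "l2 M (\<lambda>x. 0)" by (simp add: l2_def)
lemma l2_add: "l2 M f \<Longrightarrow> l2 M g \<Longrightarrow> l2 M (\<lambda>x. f x + g x)" using l2_lincomb[of M f g 1 1] by simp
lemma l2_diff: "l2 M f \<Longrightarrow> l2 M g \<Longrightarrow> l2 M (\<lambda>x. f x - g x)" using l2_lincomb[of M f g 1 "-1"] by simp
lemma l2_cmult: "l2 M f \<Longrightarrow> l2 M (\<lambda>x. c * f x)" using l2_lincomb[of M f "\<lambda>x. 0" c 0] by simp
lemma l2_minus: "l2 M f \<Longrightarrow> l2 M (\<lambda>x. - f x)" using l2_cmult[of M f "-1"] by simp
lemma l2_sum: "(\<And>i. i \<in> I \<Longrightarrow> l2 M (f i)) \<Longrightarrow> l2 M (\<lambda>x. \<Sum>i\<in>I. f i x)"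
  by (induction I rule: infinite_finite_induct) (auto intro: l2_add)

lemma n2_cong_AE:
  assumes "AE x in M. f x = g x" "f \<in> borel_measurable M" "g \<in> borel_measurable M"
  shows "n2 M f = n2 M g"
  unfolding n2_def by (rule arg_cong[where f = sqrt], rule integral_cong_AE) (use assms in auto)

lemma n2_nonneg [simp]: "0 \<le> n2 M f" by (simp add: n2_def)

lemma n2_sq: "(n2 M f)\<^sup>2 = (LINT x|M. (f x)\<^sup>2)" by (simp add: n2_def)

lemma nn_integral_l2: "l2 M f \<Longrightarrow> (\<integral>\<^sup>+x. ennreal ((f x)\<^sup>2) \<partial>M) = ennreal ((n2 M f)\<^sup>2)"
  by (simp add: n2_sq l2_def nn_integral_eq_integral)

text \<open>A nonnegative integral can be estimated before integrability is known; membership in L2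
  and the norm bound then arrive together.\<close>

lemma l2I_nn:
  assumes "f \<in> borel_measurable M" "(\<integral>\<^sup>+x. ennreal ((f x)\<^sup>2) \<partial>M) \<le> ennreal (B\<^sup>2)" "0 \<le> B"
  shows "l2 M f" "n2 M f \<le> B"
proof -
  have "(\<integral>\<^sup>+x. ennreal ((f x)\<^sup>2) \<partial>M) < \<infinity>" using assms(2) by (rule le_less_trans) simp
  then show l: "l2 M f" using assms(1) unfolding l2_def
    by (auto intro!: integrableI_nonneg)
  have "(n2 M f)\<^sup>2 \<le> B\<^sup>2" using assms(2) nn_integral_l2[OF l] by simp
  then show "n2 M f \<le> B" using assms(3) by (rule power2_le_imp_le)
qed

lemma l2_Cauchy_Schwarz:
  assumes "l2 M f" "l2 M g" shows "\<bar>LINT x|M. f x * g x\<bar> \<le> n2 M f * n2 M g"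
proof -
  have [measurable]: "f \<in> borel_measurable M" "g \<in> borel_measurable M" using assms by (auto simp: l2_def)
  have i: "integrable M (\<lambda>x. f x * g x)" by (rule l2_mult_integrable[OF assms])
  then have i': "integrable M (\<lambda>x. \<bar>f x * g x\<bar>)" by simp
  have "(LINT x|M. f x * g x)\<^sup>2 \<le> (LINT x|M. \<bar>f x * g x\<bar>)\<^sup>2"
    using integral_norm_bound[of M "\<lambda>x. f x * g x"] by (intro abs_le_square_iff[THEN iffD1]) simp
  also have "ennreal \<dots> = (\<integral>\<^sup>+x. ennreal \<bar>f x\<bar> * ennreal \<bar>g x\<bar> \<partial>M)\<^sup>2"
    using nn_integral_eq_integral[OF i'] by (simp add: abs_mult ennreal_mult ennreal_power integral_nonneg_AE)
  also have "\<dots> \<le> (\<integral>\<^sup>+x. (ennreal \<bar>f x\<bar>)\<^sup>2 \<partial>M) * (\<integral>\<^sup>+x. (ennreal \<bar>g x\<bar>)\<^sup>2 \<partial>M)"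
    by (rule Cauchy_Schwarz_nn_integral) auto
  also have "\<dots> = ennreal ((n2 M f * n2 M g)\<^sup>2)"
    using nn_integral_l2[OF assms(1)] nn_integral_l2[OF assms(2)]
    by (simp add: ennreal_power ennreal_mult power_mult_distrib)
  finally have "(LINT x|M. f x * g x)\<^sup>2 \<le> (n2 M f * n2 M g)\<^sup>2" by (simp add: ennreal_leI)
  then show ?thesis by (meson abs_le_square_iff abs_of_nonneg mult_nonneg_nonneg n2_nonneg power2_le_iff_abs_le)
qed

lemma n2_triangle:
  assumes "l2 M f" "l2 M g" shows "n2 M (\<lambda>x. f x + g x) \<le> n2 M f + n2 M g"
proof (rule power2_le_imp_le)
  have "(n2 M (\<lambda>x. f x + g x))\<^sup>2 = (LINT x|M. (f x)\<^sup>2 + 2 * (f x * g x) + (g x)\<^sup>2)"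
    unfolding n2_sq by (simp add: power2_eq_square algebra_simps)
  also have "\<dots> = (n2 M f)\<^sup>2 + 2 * (LINT x|M. f x * g x) + (n2 M g)\<^sup>2"
    using assms l2_mult_integrable[OF assms] by (simp add: n2_sq l2_def)
  also have "\<dots> \<le> (n2 M f + n2 M g)\<^sup>2"
    using l2_Cauchy_Schwarz[OF assms] by (auto simp: power2_eq_square algebra_simps)
  finally show "(n2 M (\<lambda>x. f x + g x))\<^sup>2 \<le> (n2 M f + n2 M g)\<^sup>2" .
qed simp

lemma n2_minus: "n2 M (\<lambda>x. - f x) = n2 M f" by (simp add: n2_def)

lemma n2_diff_commute: "n2 M (\<lambda>x. f x - g x) = n2 M (\<lambda>x. g x - f x)"
  by (simp add: n2_def power2_commute)

lemma n2_triangle_diff: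
  assumes "l2 M f" "l2 M g" "l2 M h"
  shows "n2 M (\<lambda>x. f x - h x) \<le> n2 M (\<lambda>x. f x - g x) + n2 M (\<lambda>x. g x - h x)"
  using n2_triangle[OF l2_diff[OF assms(1,2)] l2_diff[OF assms(2,3)]] by simp

lemma n2_eq_0:
  assumes "l2 M f" "n2 M f = 0" shows "AE x in M. f x = 0"
proof -
  have "(LINT x|M. (f x)\<^sup>2) = 0" using assms by (simp add: n2_def)
  then have "AE x in M. (f x)\<^sup>2 = 0"
    using integral_nonneg_eq_0_iff_AE[of M "\<lambda>x. (f x)\<^sup>2"] assms(1) by (auto simp: l2_def)
  then show ?thesis by auto
qed

section \<open>Completeness of L2 and the contraction principle\<close>

text \<open>Riesz-Fischer on an arbitrary measure space. Members are functions rather than classes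
  and \<open>n2\<close> is only a seminorm on them, so the limit is determined up to a null
  set.\<close>

lemma l2_complete:
  assumes f: "\<And>n. l2 M (f n)"
    and cau: "\<And>e. e > 0 \<Longrightarrow> \<exists>N. \<forall>m\<ge>N. \<forall>n\<ge>N. n2 M (\<lambda>x. f m x - f n x) < e"
  obtains g where "l2 M g" "(\<lambda>n. n2 M (\<lambda>x. f n x - g x)) \<longlonglongrightarrow> 0"
proof -
  have [measurable]: "f n \<in> borel_measurable M" for n using f by (auto simp: l2_def)
  have "\<exists>N. \<forall>k. (\<forall>m\<ge>N k. n2 M (\<lambda>x. f m x - f (N k) x) < (1/2)^k) \<and> N k < N (Suc k)"
  proof (rule dependent_nat_choice)
    show "\<exists>N. \<forall>m\<ge>N. n2 M (\<lambda>x. f m x - f N x) < (1/2)^0"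
      using cau[of 1] by auto
    fix N k assume "\<forall>m\<ge>N. n2 M (\<lambda>x. f m x - f N x) < (1 / 2) ^ k"
    obtain N' where N': "\<forall>m\<ge>N'. \<forall>n\<ge>N'. n2 M (\<lambda>x. f m x - f n x) < (1/2)^(Suc k)"
      using cau[of "(1/2)^(Suc k)"] by auto
    then show "\<exists>N'. (\<forall>m\<ge>N'. n2 M (\<lambda>x. f m x - f N' x) < (1 / 2) ^ Suc k) \<and> N < N'"
      by (intro exI[of _ "max N' (Suc N)"]) auto
  qed
  then obtain N where N: "\<And>k m. m \<ge> N k \<Longrightarrow> n2 M (\<lambda>x. f m x - f (N k) x) < (1/2)^k"
    and Nlt: "\<And>k. N k < N (Suc k)" by blast
  have sm: "strict_mono N" using Nlt by (simp add: strict_mono_Suc_iff)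
  define d where "d k x = f (N (Suc k)) x - f (N k) x" for k x
  have dl: "l2 M (d k)" for k unfolding d_def[abs_def] by (intro l2_diff f)
  have [measurable]: "d k \<in> borel_measurable M" for k using dl by (auto simp: l2_def)
  \<comment> \<open>The squared gaps of the subsequence have integral at most
    \<open>(1/4)^k\<close>, so the weight \<open>2^k\<close> still leaves a geometric series.
    Squares are used because on a space of infinite measure the gaps need not be integrable;
    \<open>(1/2)^k + 2^k * (d k x)\<^sup>2\<close> dominates \<open>\<bar>d k x\<bar>\<close> and
    turns this into absolute convergence almost everywhere.\<close>
  have "(\<integral>\<^sup>+x. (\<Sum>k. ennreal (2^k * (d k x)\<^sup>2)) \<partial>M) = (\<Sum>k. \<integral>\<^sup>+x. ennreal (2^k * (d k x)\<^sup>2) \<partial>M)"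
    by (rule nn_integral_suminf) measurable
  also have "\<dots> \<le> (\<Sum>k. ennreal ((1/2)^k))"
  proof (rule suminf_le)
    fix k
    have "(\<integral>\<^sup>+x. ennreal (2^k * (d k x)\<^sup>2) \<partial>M) = ennreal (2^k * (n2 M (d k))\<^sup>2)"
      using nn_integral_l2[OF dl[of k]] by (simp add: ennreal_mult nn_integral_cmult)
    also have "\<dots> \<le> ennreal (2^k * ((1/2)^k)\<^sup>2)"
    proof (intro ennreal_leI mult_left_mono power_mono)
      show "n2 M (d k) \<le> (1/2)^k" using N[of k "N (Suc k)"] Nlt[of k] unfolding d_def by simp
    qed auto
    also have "2^k * ((1/2::real)^k)\<^sup>2 = (1/2)^k" by (simp add: power2_eq_square power_mult_distrib[symmetric] flip: mult.assoc)
    finally show "(\<integral>\<^sup>+x. ennreal (2^k * (d k x)\<^sup>2) \<partial>M) \<le> ennreal ((1/2)^k)" .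
  qed auto
  also have "\<dots> = ennreal (\<Sum>k. (1/2)^k)" by (rule suminf_ennreal2) auto
  also have "\<dots> < \<infinity>" by simp
  finally have fin: "(\<integral>\<^sup>+x. (\<Sum>k. ennreal (2^k * (d k x)\<^sup>2)) \<partial>M) \<noteq> \<infinity>" by simp
  have "AE x in M. (\<Sum>k. ennreal (2^k * (d k x)\<^sup>2)) \<noteq> \<infinity>"
    by (rule nn_integral_PInf_AE[OF _ fin]) measurable
  then have conv: "AE x in M. convergent (\<lambda>k. f (N k) x)"
  proof eventually_elim
    case (elim x)
    have s1: "summable (\<lambda>k. 2^k * (d k x)\<^sup>2)"
      by (rule summable_suminf_not_top) (use elim in auto)
    have "summable (\<lambda>k. (1/2)^k + 2^k * (d k x)\<^sup>2)" by (intro summable_add s1) auto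
    moreover have "norm (d k x) \<le> (1/2)^k + 2^k * (d k x)\<^sup>2" for k
    proof -
      define a :: real where "a = 2^k"
      have a: "a > 0" "(1/2::real)^k = 1/a" by (auto simp: a_def power_one_over)
      have "0 \<le> (a * \<bar>d k x\<bar> - 1)\<^sup>2 + a * \<bar>d k x\<bar>" using a by simp
      also have "\<dots> = a * (a * (d k x)\<^sup>2 + 1/a - \<bar>d k x\<bar>)" using a
        by (simp add: power2_eq_square algebra_simps)
      finally have "0 \<le> a * (d k x)\<^sup>2 + 1/a - \<bar>d k x\<bar>" using a(1) by (simp add: zero_le_mult_iff)
      then show ?thesis using a by (simp add: a_def)
    qed
    ultimately have "summable (\<lambda>k. d k x)" by (rule summable_comparison_test'[of _ 0])
    then have "convergent (\<lambda>n. \<Sum>k<n. d k x)" by (simp add: summable_iff_convergent)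
    moreover have "(\<Sum>k<n. d k x) = f (N n) x - f (N 0) x" for n
      unfolding d_def by (rule sum_lessThan_telescope)
    ultimately have "convergent (\<lambda>n. f (N n) x - f (N 0) x)" by simp
    then show ?case using convergent_add[OF _ convergent_const[of "f (N 0) x"]] by fastforce
  qed
  define g where "g x = lim (\<lambda>k. f (N k) x)" for x
  have [measurable]: "g \<in> borel_measurable M" unfolding g_def[abs_def] by measurable
  have key: "\<exists>K. \<forall>n\<ge>K. l2 M (\<lambda>x. f n x - g x) \<and> n2 M (\<lambda>x. f n x - g x) \<le> e" if "e > 0" for e
  proof -
    obtain K where K: "\<And>m n. m \<ge> K \<Longrightarrow> n \<ge> K \<Longrightarrow> n2 M (\<lambda>x. f m x - f n x) < e" using cau[OF \<open>e > 0\<close>] by blast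
    have "l2 M (\<lambda>x. f n x - g x) \<and> n2 M (\<lambda>x. f n x - g x) \<le> e" if n: "n \<ge> K" for n
    proof -
      \<comment> \<open>Fatou's lemma along the subsequence carries the Cauchy bound for
        \<open>f n - f (N k)\<close> over to \<open>f n - g\<close>.\<close>
      have "(\<integral>\<^sup>+x. ennreal ((f n x - g x)\<^sup>2) \<partial>M) = (\<integral>\<^sup>+x. liminf (\<lambda>k. ennreal ((f n x - f (N k) x)\<^sup>2)) \<partial>M)"
      proof (rule nn_integral_cong_AE)
        show "AE x in M. ennreal ((f n x - g x)\<^sup>2) = liminf (\<lambda>k. ennreal ((f n x - f (N k) x)\<^sup>2))"
          using conv
        proof eventually_elim
          case (elim x)
          then have "(\<lambda>k. f (N k) x) \<longlonglongrightarrow> g x" by (simp add: g_def convergent_LIMSEQ_iff)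
          then have "(\<lambda>k. ennreal ((f n x - f (N k) x)\<^sup>2)) \<longlonglongrightarrow> ennreal ((f n x - g x)\<^sup>2)"
            by (intro tendsto_intros)
          then show ?case by (intro lim_imp_Liminf[symmetric]) auto
        qed
      qed
      also have "\<dots> \<le> liminf (\<lambda>k. \<integral>\<^sup>+x. ennreal ((f n x - f (N k) x)\<^sup>2) \<partial>M)"
        by (rule nn_integral_liminf) measurable
      also have "\<dots> \<le> ennreal (e\<^sup>2)"
      proof (rule Liminf_le)
        show "eventually (\<lambda>k. (\<integral>\<^sup>+x. ennreal ((f n x - f (N k) x)\<^sup>2) \<partial>M) \<le> ennreal (e\<^sup>2)) sequentially"
          using eventually_ge_at_top[of K]
        proof eventually_elim
          case (elim k)
          have "N k \<ge> K" using elim seq_suble[OF sm, of k] by simp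
          then have "n2 M (\<lambda>x. f n x - f (N k) x) < e" using K n by blast
          moreover have "l2 M (\<lambda>x. f n x - f (N k) x)" by (intro l2_diff f)
          ultimately show ?case using nn_integral_l2[of M "\<lambda>x. f n x - f (N k) x"]
            by (auto intro!: ennreal_leI power_mono)
        qed
      qed simp
      finally show ?thesis using l2I_nn[of "\<lambda>x. f n x - g x" M e] \<open>e > 0\<close> by simp
    qed
    then show ?thesis by blast
  qed
  obtain n where "l2 M (\<lambda>x. f n x - g x)" using key[of 1] by auto
  from l2_diff[OF f[of n] this] have g: "l2 M g" by simp
  have "(\<lambda>n. n2 M (\<lambda>x. f n x - g x)) \<longlonglongrightarrow> 0"
  proof (rule LIMSEQ_I)
    fix r :: real assume "r > 0"
    then obtain K where "\<forall>n\<ge>K. n2 M (\<lambda>x. f n x - g x) \<le> r/2" using key[of "r/2"] by auto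
    then show "\<exists>no. \<forall>n\<ge>no. norm (n2 M (\<lambda>x. f n x - g x) - 0) < r" using \<open>r > 0\<close>
      by (intro exI[of _ K]) (auto intro: le_less_trans[of _ "r/2"])
  qed
  with g that show thesis by blast
qed

text \<open>Banach's fixed point theorem for the seminorm \<open>n2\<close>, by Picard iteration of
  \<open>g \<mapsto> f + A g\<close>; since the limit is determined only up to null sets, so is the
  fixed point equation.\<close>

lemma l2_contraction:
  assumes f: "l2 M f" and A: "\<And>g. l2 M g \<Longrightarrow> l2 M (A g)" and \<theta>: "0 \<le> \<theta>" "\<theta> < 1"
    and con: "\<And>g h. l2 M g \<Longrightarrow> l2 M h \<Longrightarrow> n2 M (\<lambda>x. A g x - A h x) \<le> \<theta> * n2 M (\<lambda>x. g x - h x)"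
  obtains w where "l2 M w" "AE x in M. w x = f x + A w x"
proof -
  define W where "W n = ((\<lambda>g x. f x + A g x) ^^ n) f" for n
  have W0: "W 0 = f" and WS: "W (Suc n) = (\<lambda>x. f x + A (W n) x)" for n by (auto simp: W_def)
  have Wl: "l2 M (W n)" for n by (induction n) (auto simp: W0 WS intro!: l2_add f A)
  define c where "c = n2 M (\<lambda>x. W 1 x - W 0 x)"
  have c0: "0 \<le> c" by (simp add: c_def)
  have step: "n2 M (\<lambda>x. W (Suc n) x - W n x) \<le> \<theta>^n * c" for n
  proof (induction n)
    case 0 then show ?case by (simp add: c_def)
  next
    case (Suc n)
    have "n2 M (\<lambda>x. W (Suc (Suc n)) x - W (Suc n) x) \<le> \<theta> * n2 M (\<lambda>x. W (Suc n) x - W n x)"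
      using con[OF Wl[of "Suc n"] Wl[of n]] by (simp add: WS[of "Suc n"] WS[of n])
    also have "\<dots> \<le> \<theta> * (\<theta>^n * c)" by (intro mult_left_mono Suc \<theta>)
    finally show ?case by simp
  qed
  have far: "n2 M (\<lambda>x. W (n + k) x - W n x) \<le> \<theta>^n * c / (1 - \<theta>)" for n k
  proof -
    have "n2 M (\<lambda>x. W (n + k) x - W n x) \<le> (\<Sum>j<k. \<theta>^(n+j) * c)"
    proof (induction k)
      case 0 then show ?case by (simp add: n2_def)
    next
      case (Suc k)
      have "n2 M (\<lambda>x. W (n + Suc k) x - W n x) \<le> n2 M (\<lambda>x. W (n + Suc k) x - W (n + k) x) + n2 M (\<lambda>x. W (n + k) x - W n x)"
        by (rule n2_triangle_diff) (rule Wl)+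
      also have "\<dots> \<le> \<theta>^(n+k) * c + (\<Sum>j<k. \<theta>^(n+j) * c)" using step[of "n+k"] Suc by simp
      finally show ?case by simp
    qed
    also have "\<dots> = \<theta>^n * c * (\<Sum>j<k. \<theta>^j)" by (simp add: power_add sum_distrib_left mult_ac)
    also have "\<dots> = \<theta>^n * c * ((1 - \<theta>^k) / (1 - \<theta>))" using \<theta> by (simp add: sum_gp_strict)
    also have "\<dots> \<le> \<theta>^n * c * (1 / (1 - \<theta>))"
      by (intro mult_left_mono divide_right_mono) (use \<theta> c0 in auto)
    finally show ?thesis by simp
  qed
  have lim0: "(\<lambda>n. 2 * (\<theta>^n * c / (1 - \<theta>))) \<longlonglongrightarrow> 2 * (0 * c / (1-\<theta>))"
    using \<theta> by (intro tendsto_intros LIMSEQ_power_zero) auto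
  have cau: "\<exists>N. \<forall>m\<ge>N. \<forall>n\<ge>N. n2 M (\<lambda>x. W m x - W n x) < e" if "e > 0" for e
  proof -
    have "eventually (\<lambda>n. 2 * (\<theta>^n * c / (1 - \<theta>)) < e) sequentially"
      by (rule order_tendstoD(2)[OF lim0]) (use that in simp)
    then obtain N where N: "2 * (\<theta>^N * c / (1 - \<theta>)) < e" by (auto simp: eventually_sequentially)
    have "n2 M (\<lambda>x. W m x - W n x) < e" if "m \<ge> N" "n \<ge> N" for m n
    proof -
      have "n2 M (\<lambda>x. W m x - W n x) \<le> n2 M (\<lambda>x. W m x - W N x) + n2 M (\<lambda>x. W N x - W n x)"
        by (rule n2_triangle_diff) (rule Wl)+
      then show ?thesis using far[of N "m - N"] far[of N "n - N"] N that n2_diff_commute[of M "W N" "W n"] by simp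
    qed
    then show ?thesis by blast
  qed
  obtain w where w: "l2 M w" "(\<lambda>n. n2 M (\<lambda>x. W n x - w x)) \<longlonglongrightarrow> 0"
    by (rule l2_complete[of M W]) (use Wl cau in auto)
  \<comment> \<open>The residual of the limit is compared with the step from \<open>W n\<close> to
    \<open>W (Suc n)\<close>; its norm is bounded by two terms that tend to 0.\<close>
  let ?r = "\<lambda>x. w x - (f x + A w x)"
  have rl: "l2 M ?r" by (intro l2_diff l2_add w f A)
  have le: "n2 M ?r \<le> n2 M (\<lambda>x. W (Suc n) x - w x) + \<theta> * n2 M (\<lambda>x. W n x - w x)" for n
  proof -
    have "n2 M ?r \<le> n2 M (\<lambda>x. w x - W (Suc n) x) + n2 M (\<lambda>x. W (Suc n) x - (f x + A w x))"
      by (rule n2_triangle_diff) (auto intro!: Wl w l2_add f A)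
    moreover have "n2 M (\<lambda>x. W (Suc n) x - (f x + A w x)) \<le> \<theta> * n2 M (\<lambda>x. W n x - w x)"
      using con[OF Wl[of n] w(1)] by (simp add: WS)
    ultimately show ?thesis using n2_diff_commute[of M w "W (Suc n)"] by simp
  qed
  have "(\<lambda>n. n2 M (\<lambda>x. W (Suc n) x - w x) + \<theta> * n2 M (\<lambda>x. W n x - w x)) \<longlonglongrightarrow> 0 + \<theta> * 0"
    by (intro tendsto_intros w(2) LIMSEQ_Suc[OF w(2)])
  then have "n2 M ?r \<le> 0 + \<theta> * 0" by (rule LIMSEQ_le_const) (use le in blast)
  then have "n2 M ?r = 0" using n2_nonneg[of M ?r] by simp
  from n2_eq_0[OF rl this] have "AE x in M. w x = f x + A w x" by auto
  with w that show thesis by blast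
qed

section \<open>Convolution on the half-line\<close>

text \<open>Unlike \<^term>\<open>lebesgue_on S\<close>, this measure lives on the Borel sets of the whole type, so that
  products, sections and Fubini are directly available.\<close>
definition lbon :: "'a::euclidean_space set \<Rightarrow> 'a measure" where
  "lbon S = density lborel (\<lambda>x. ennreal (indicator S x))"

lemma sets_lbon [measurable_cong, simp]: "sets (lbon S) = sets borel" by (simp add: lbon_def)
lemma space_lbon [simp]: "space (lbon S) = UNIV" by (simp add: lbon_def)

lemma AE_lbon: "S \<in> sets borel \<Longrightarrow> (AE x in lbon S. P x) \<longleftrightarrow> (AE x in lborel. x \<in> S \<longrightarrow> P x)"
  unfolding lbon_def by (subst AE_density) (auto simp: indicator_def)

lemma nn_integral_lbon:
  "S \<in> sets borel \<Longrightarrow> f \<in> borel_measurable borel \<Longrightarrow> (\<integral>\<^sup>+x. f x \<partial>lbon S) = (\<integral>\<^sup>+x. indicator S x * f x \<partial>lborel)"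
  unfolding lbon_def by (subst nn_integral_density) (auto simp: ennreal_indicator)

lemma integrable_lbon:
  fixes f :: "_ \<Rightarrow> real"
  shows "S \<in> sets borel \<Longrightarrow> f \<in> borel_measurable borel \<Longrightarrow>
    integrable (lbon S) f \<longleftrightarrow> integrable lborel (\<lambda>x. indicator S x * f x)"
  unfolding lbon_def by (subst integrable_density) auto

lemma integral_lbon:
  fixes f :: "_ \<Rightarrow> real"
  shows "S \<in> sets borel \<Longrightarrow> f \<in> borel_measurable borel \<Longrightarrow>
    integral\<^sup>L (lbon S) f = (LINT x|lborel. indicator S x * f x)"
  unfolding lbon_def by (subst integral_density) auto

lemma sigma_finite_lbon: "S \<in> sets borel \<Longrightarrow> sigma_finite_measure (lbon S)"
  unfolding lbon_def by (subst sigma_finite_measure.sigma_finite_iff_density_finite[OF lborel.sigma_finite_measure_axioms]) auto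

lemma finite_measure_lbon: "S \<in> sets borel \<Longrightarrow> bounded S \<Longrightarrow> finite_measure (lbon S)"
  by (rule finite_measureI)
     (use emeasure_bounded_finite[of S] in \<open>auto simp: lbon_def emeasure_density ennreal_indicator\<close>)

lemma lbon_pair:
  assumes [measurable]: "A \<in> sets borel" "B \<in> sets borel"
  shows "lbon A \<Otimes>\<^sub>M lbon B = lbon (A \<times> B)"
proof -
  have "lbon A \<Otimes>\<^sub>M lbon B = density (lborel \<Otimes>\<^sub>M lborel) (\<lambda>(x,y). ennreal (indicator A x) * ennreal (indicator B y))"
    unfolding lbon_def
    by (rule pair_measure_density) (use sigma_finite_lbon[OF assms(2)] in \<open>auto simp: lbon_def lborel.sigma_finite_measure_axioms\<close>)
  also have "\<dots> = lbon (A \<times> B)"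
    unfolding lbon_def lborel_prod by (rule arg_cong[where f="density lborel"]) (auto simp: indicator_def)
  finally show ?thesis .
qed

section \<open>Lebesgue measurable functions and their Borel representatives\<close>

lemma AE_lebesgue_on: "S \<in> sets borel \<Longrightarrow> (AE x in lebesgue_on S. P x) \<longleftrightarrow> (AE x in lbon S. P x)"
  by (subst AE_restrict_space_iff) (auto simp: AE_lbon AE_completion_iff)

text \<open>The functions of the theorem are measurable only for the completed measure, where a
  section of a function on a product may fail to be measurable. A Borel representative restores all
  sections at the cost of a null set.\<close>

lemma lebesgue_on_borel_rep:
  fixes f :: "'a::euclidean_space \<Rightarrow> real"
  assumes S: "S \<in> sets borel" and f: "f \<in> borel_measurable (lebesgue_on S)"
  obtains g where "g \<in> borel_measurable borel" "AE x in lbon S. f x = g x"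
proof -
  have "(\<lambda>x. if x \<in> S then f x else 0) \<in> borel_measurable (completion lborel)"
    using f S by (subst borel_measurable_if) auto
  from completion_ex_borel_measurable_real[OF this]
  obtain g where g: "g \<in> borel_measurable lborel" "AE x in lborel. (if x \<in> S then f x else 0) = g x" by blast
  from g(2) have "AE x in lborel. x \<in> S \<longrightarrow> f x = g x" by eventually_elim auto
  with g(1) S that[of g] show thesis by (auto simp: AE_lbon)
qed

lemma borel_measurable_lebesgue_onI:
  fixes f g :: "'a::euclidean_space \<Rightarrow> real"
  assumes S: "S \<in> sets borel" and g: "g \<in> borel_measurable borel" and ae: "AE x in lbon S. f x = g x"
  shows "f \<in> borel_measurable (lebesgue_on S)"
proof (rule borel_measurable_if_D, rule borel_measurable_AE)
  have "(\<lambda>x. if x \<in> S then g x else 0) \<in> borel_measurable borel" using g S by measurable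
  then show "(\<lambda>x. if x \<in> S then g x else 0) \<in> borel_measurable lebesgue" by (intro measurable_completion) simp
  show "AE x in lebesgue. (if x \<in> S then g x else 0) = (if x \<in> S then f x else 0)"
    using ae unfolding AE_lbon[OF S] AE_completion_iff by eventually_elim auto
qed

lemma integral_lebesgue_on_borel:
  fixes g :: "'a::euclidean_space \<Rightarrow> real"
  assumes S: "S \<in> sets borel" and g: "g \<in> borel_measurable borel"
  shows "integral\<^sup>L (lebesgue_on S) g = integral\<^sup>L (lbon S) g"
    and "integrable (lebesgue_on S) g \<longleftrightarrow> integrable (lbon S) g"
proof -
  have m: "(\<lambda>x. indicator S x * g x) \<in> borel_measurable lborel" using S g by measurable
  show "integral\<^sup>L (lebesgue_on S) g = integral\<^sup>L (lbon S) g"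
    using S g m by (subst integral_restrict_space) (auto simp: integral_completion integral_lbon)
  show "integrable (lebesgue_on S) g \<longleftrightarrow> integrable (lbon S) g"
    using S g m by (subst integrable_restrict_space) (auto simp: integrable_completion integrable_lbon)
qed

lemma integral_lebesgue_on_cong:
  fixes f g :: "'a::euclidean_space \<Rightarrow> real"
  assumes S: "S \<in> sets borel" and g: "g \<in> borel_measurable borel" and ae: "AE x in lbon S. f x = g x"
  shows "integral\<^sup>L (lebesgue_on S) f = integral\<^sup>L (lbon S) g"
    and "integrable (lebesgue_on S) f \<longleftrightarrow> integrable (lbon S) g"
proof -
  have f: "f \<in> borel_measurable (lebesgue_on S)" by (rule borel_measurable_lebesgue_onI[OF S g ae])
  have g': "g \<in> borel_measurable (lebesgue_on S)" using g by (intro measurable_restrict_space1 measurable_completion) auto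
  have ae': "AE x in lebesgue_on S. f x = g x" using ae AE_lebesgue_on[OF S] by blast
  show "integral\<^sup>L (lebesgue_on S) f = integral\<^sup>L (lbon S) g"
    using integral_cong_AE[OF f g' ae'] integral_lebesgue_on_borel(1)[OF S g] by simp
  show "integrable (lebesgue_on S) f \<longleftrightarrow> integrable (lbon S) g"
    using integrable_cong_AE[OF f g' ae'] integral_lebesgue_on_borel(2)[OF S g] by simp
qed

text \<open>The value is 0 where the integral does not converge absolutely.\<close>
definition cv :: "(real \<Rightarrow> real) \<Rightarrow> (real \<Rightarrow> real) \<Rightarrow> real \<Rightarrow> real" where
  "cv a b t = (LINT s|lborel. (if 0 \<le> s \<and> s \<le> t then a (t - s) * b s else 0))"

text \<open>The version with values in the extended half-line: it always exists, Tonelli applies to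
  it freely, and its finiteness at \<open>t\<close> for the absolute values is exactly absolute
  convergence of \<open>cv\<close> at \<open>t\<close>.\<close>

definition cvn :: "(real \<Rightarrow> ennreal) \<Rightarrow> (real \<Rightarrow> ennreal) \<Rightarrow> real \<Rightarrow> ennreal" where
  "cvn a b t = (\<integral>\<^sup>+s. (if 0 \<le> s \<and> s \<le> t then a (t - s) * b s else 0) \<partial>lborel)"

lemma borel_measurable_cv [measurable]:
  assumes [measurable]: "a \<in> borel_measurable borel" "b \<in> borel_measurable borel"
  shows "cv a b \<in> borel_measurable borel"
  unfolding cv_def[abs_def] by measurable

lemma borel_measurable_cvn [measurable]:
  assumes [measurable]: "a \<in> borel_measurable borel" "b \<in> borel_measurable borel"
  shows "cvn a b \<in> borel_measurable borel"
  unfolding cvn_def[abs_def] by measurable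

lemma borel_measurable_cv_pair:
  assumes [measurable]: "a \<in> borel_measurable borel" "Z \<in> borel_measurable (borel \<Otimes>\<^sub>M N)"
  shows "(\<lambda>z. cv a (\<lambda>s. Z (s, snd z)) (fst z)) \<in> borel_measurable (borel \<Otimes>\<^sub>M N)"
  unfolding cv_def[abs_def] by measurable

text \<open>The reflection \<open>s \<mapsto> t - s\<close> preserves the integral as well as its
  failure to converge, so the identity holds at every \<open>t\<close>, default value
  included.\<close>

lemma cv_commute: "cv a b t = cv b a t"
proof -
  have "cv a b t = (LINT s|lborel. (if 0 \<le> t + (-1) * s \<and> t + (-1) * s \<le> t then a (t - (t + (-1) * s)) * b (t + (-1) * s) else 0))"
    unfolding cv_def by (subst lborel_integral_real_affine[where c="-1" and t=t]) auto
  also have "\<dots> = cv b a t" unfolding cv_def by (intro Bochner_Integration.integral_cong) auto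
  finally show ?thesis .
qed

lemma cvn_commute:
  assumes [measurable]: "a \<in> borel_measurable borel" "b \<in> borel_measurable borel"
  shows "cvn a b t = cvn b a t"
proof -
  have "cvn a b t = (\<integral>\<^sup>+s. (if 0 \<le> t + (-1) * s \<and> t + (-1) * s \<le> t then a (t - (t + (-1) * s)) * b (t + (-1) * s) else 0) \<partial>lborel)"
    unfolding cvn_def by (subst nn_integral_real_affine[where c="-1" and t=t]) auto
  also have "\<dots> = cvn b a t" unfolding cvn_def by (intro nn_integral_cong) (auto simp: mult.commute)
  finally show ?thesis .
qed

lemma cvn_assoc:
  assumes [measurable]: "a \<in> borel_measurable borel" "b \<in> borel_measurable borel" "c \<in> borel_measurable borel"
  shows "cvn a (cvn b c) t = cvn (cvn a b) c t"
proof -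
  let ?F = "\<lambda>s r. if 0 \<le> s \<and> s \<le> t \<and> 0 \<le> r \<and> r \<le> s then a (t - s) * (b (s - r) * c r) else 0"
  have "cvn a (cvn b c) t = (\<integral>\<^sup>+s. \<integral>\<^sup>+r. ?F s r \<partial>lborel \<partial>lborel)"
    unfolding cvn_def
  proof (intro nn_integral_cong)
    fix s
    show "(if 0 \<le> s \<and> s \<le> t then a (t - s) * (\<integral>\<^sup>+ sa. (if 0 \<le> sa \<and> sa \<le> s then b (s - sa) * c sa else 0) \<partial>lborel) else 0)
      = (\<integral>\<^sup>+r. ?F s r \<partial>lborel)"
      by (auto simp: nn_integral_cmult[symmetric] intro!: nn_integral_cong)
  qed
  also have "\<dots> = (\<integral>\<^sup>+r. \<integral>\<^sup>+s. ?F s r \<partial>lborel \<partial>lborel)"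
    by (rule lborel_pair.Fubini') measurable
  also have "\<dots> = cvn (cvn a b) c t"
    unfolding cvn_def
  proof (intro nn_integral_cong)
    fix r
    have "(\<integral>\<^sup>+s. ?F s r \<partial>lborel) = (\<integral>\<^sup>+s. ?F (r + 1 * s) r \<partial>lborel)"
      by (subst nn_integral_real_affine[where c=1 and t=r]) auto
    also have "\<dots> = (\<integral>\<^sup>+s. (if 0 \<le> r \<and> r \<le> t then (if 0 \<le> s \<and> s \<le> t - r then a (t - r - s) * b s else 0) * c r else 0) \<partial>lborel)"
      by (intro nn_integral_cong) (auto simp: algebra_simps)
    also have "\<dots> = (if 0 \<le> r \<and> r \<le> t then (\<integral>\<^sup>+ s. (if 0 \<le> s \<and> s \<le> t - r then a (t - r - s) * b s else 0) \<partial>lborel) * c r else 0)"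
      by (auto simp: nn_integral_multc)
    finally show "(\<integral>\<^sup>+s. ?F s r \<partial>lborel) = \<dots>" .
  qed
  finally show ?thesis .
qed

text \<open>Fubini on the triangle \<open>0 \<le> r \<le> s \<le> t\<close>, then the shift of
  \<open>s\<close> by \<open>r\<close>. The finiteness condition says that the integrand is
  absolutely integrable on this triangle.\<close>

lemma cv_assoc:
  assumes [measurable]: "a \<in> borel_measurable borel" "b \<in> borel_measurable borel" "c \<in> borel_measurable borel"
  assumes fin: "cvn (\<lambda>t. ennreal \<bar>a t\<bar>) (cvn (\<lambda>t. ennreal \<bar>b t\<bar>) (\<lambda>t. ennreal \<bar>c t\<bar>)) t < \<infinity>"
  shows "cv a (cv b c) t = cv (cv a b) c t"
proof -
  let ?F = "\<lambda>s r. if 0 \<le> s \<and> s \<le> t \<and> 0 \<le> r \<and> r \<le> s then a (t - s) * (b (s - r) * c r) else 0"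
  have int: "integrable (lborel \<Otimes>\<^sub>M lborel) (\<lambda>(s, r). ?F s r)"
  proof (rule integrableI_bounded)
    have "(\<integral>\<^sup>+z. ennreal (norm ((\<lambda>(s, r). ?F s r) z)) \<partial>(lborel \<Otimes>\<^sub>M lborel)) = (\<integral>\<^sup>+s. \<integral>\<^sup>+r. ennreal \<bar>?F s r\<bar> \<partial>lborel \<partial>lborel)"
      by (subst lborel.nn_integral_fst[symmetric]) auto
    also have "\<dots> = cvn (\<lambda>t. ennreal \<bar>a t\<bar>) (cvn (\<lambda>t. ennreal \<bar>b t\<bar>) (\<lambda>t. ennreal \<bar>c t\<bar>)) t"
      unfolding cvn_def
    proof (intro nn_integral_cong)
      fix s
      show "(\<integral>\<^sup>+r. ennreal \<bar>?F s r\<bar> \<partial>lborel) = (if 0 \<le> s \<and> s \<le> t then ennreal \<bar>a (t - s)\<bar> *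
        (\<integral>\<^sup>+ sa. (if 0 \<le> sa \<and> sa \<le> s then ennreal \<bar>b (s - sa)\<bar> * ennreal \<bar>c sa\<bar> else 0) \<partial>lborel) else 0)"
        by (auto simp: nn_integral_cmult[symmetric] abs_mult ennreal_mult intro!: nn_integral_cong)
    qed
    finally show "(\<integral>\<^sup>+z. ennreal (norm ((\<lambda>(s, r). ?F s r) z)) \<partial>(lborel \<Otimes>\<^sub>M lborel)) < \<infinity>" using fin by simp
  qed measurable
  have "cv a (cv b c) t = (LINT s|lborel. LINT r|lborel. ?F s r)"
    unfolding cv_def
  proof (intro Bochner_Integration.integral_cong refl)
    fix s
    show "(if 0 \<le> s \<and> s \<le> t then a (t - s) * (LINT sa|lborel. (if 0 \<le> sa \<and> sa \<le> s then b (s - sa) * c sa else 0)) else 0)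
      = (LINT r|lborel. ?F s r)"
      by (auto simp: integral_mult_right_zero[symmetric] simp del: integral_mult_right_zero intro!: Bochner_Integration.integral_cong)
  qed
  also have "\<dots> = (LINT r|lborel. LINT s|lborel. ?F s r)"
    by (rule lborel_pair.Fubini_integral[symmetric]) (rule int)
  also have "\<dots> = cv (cv a b) c t"
    unfolding cv_def
  proof (intro Bochner_Integration.integral_cong refl)
    fix r
    have "(LINT s|lborel. ?F s r) = (LINT s|lborel. ?F (r + 1 * s) r)"
      by (subst lborel_integral_real_affine[where c=1 and t=r]) auto
    also have "\<dots> = (LINT s|lborel. (if 0 \<le> r \<and> r \<le> t then (if 0 \<le> s \<and> s \<le> t - r then a (t - r - s) * b s else 0) * c r else 0))"
      by (intro Bochner_Integration.integral_cong) (auto simp: algebra_simps)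
    also have "\<dots> = (if 0 \<le> r \<and> r \<le> t then (LINT s|lborel. (if 0 \<le> s \<and> s \<le> t - r then a (t - r - s) * b s else 0)) * c r else 0)"
      by auto
    finally show "(LINT s|lborel. ?F s r) = \<dots>" .
  qed
  finally show ?thesis .
qed

lemma cv_le_cvn: "ennreal \<bar>cv a b t\<bar> \<le> cvn (\<lambda>t. ennreal \<bar>a t\<bar>) (\<lambda>t. ennreal \<bar>b t\<bar>) t"
proof (cases "integrable lborel (\<lambda>s. if 0 \<le> s \<and> s \<le> t then a (t - s) * b s else 0)")
  case True
  have "ennreal \<bar>cv a b t\<bar> \<le> (\<integral>\<^sup>+s. ennreal (norm (if 0 \<le> s \<and> s \<le> t then a (t - s) * b s else 0)) \<partial>lborel)"
    using integral_norm_bound_ennreal[OF True] unfolding cv_def by simp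
  also have "\<dots> = cvn (\<lambda>t. ennreal \<bar>a t\<bar>) (\<lambda>t. ennreal \<bar>b t\<bar>) t"
    unfolding cvn_def by (intro nn_integral_cong) (auto simp: abs_mult ennreal_mult)
  finally show ?thesis .
qed (simp add: cv_def not_integrable_integral_eq)

lemma cv_integrable_iff:
  assumes [measurable]: "a \<in> borel_measurable borel" "b \<in> borel_measurable borel"
  shows "integrable lborel (\<lambda>s. if 0 \<le> s \<and> s \<le> t then a (t - s) * b s else 0) \<longleftrightarrow>
    cvn (\<lambda>t. ennreal \<bar>a t\<bar>) (\<lambda>t. ennreal \<bar>b t\<bar>) t < \<infinity>"
proof -
  have "(\<integral>\<^sup>+s. ennreal (norm (if 0 \<le> s \<and> s \<le> t then a (t - s) * b s else 0)) \<partial>lborel) =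
    cvn (\<lambda>t. ennreal \<bar>a t\<bar>) (\<lambda>t. ennreal \<bar>b t\<bar>) t"
    unfolding cvn_def by (intro nn_integral_cong) (auto simp: abs_mult ennreal_mult)
  then show ?thesis unfolding integrable_iff_bounded by simp
qed

section \<open>Young's inequalities\<close>

text \<open>Tonelli and the shift of \<open>t\<close> by \<open>s\<close>. Both factors may be cut
  off at \<open>T\<close>, because \<open>0 \<le> s \<le> t \<le> T\<close> keeps
  \<open>t - s\<close> in \<open>{0..T}\<close> too.\<close>

lemma nn_integral_cvn_le:
  assumes [measurable]: "a \<in> borel_measurable borel" "b \<in> borel_measurable borel"
  shows "(\<integral>\<^sup>+t. cvn a b t \<partial>lbon {0..T}) \<le> (\<integral>\<^sup>+t. a t \<partial>lbon {0..T}) * (\<integral>\<^sup>+t. b t \<partial>lbon {0..T})"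
proof -
  have "(\<integral>\<^sup>+t. cvn a b t \<partial>lbon {0..T}) = (\<integral>\<^sup>+t. \<integral>\<^sup>+s. (if 0 \<le> s \<and> s \<le> t \<and> t \<le> T then a (t - s) * b s else 0) \<partial>lborel \<partial>lborel)"
    by (subst nn_integral_lbon) (auto simp: cvn_def nn_integral_cmult[symmetric] indicator_def intro!: nn_integral_cong)
  also have "\<dots> = (\<integral>\<^sup>+s. \<integral>\<^sup>+t. (if 0 \<le> s \<and> s \<le> t \<and> t \<le> T then a (t - s) * b s else 0) \<partial>lborel \<partial>lborel)"
    by (rule lborel_pair.Fubini') measurable
  also have "\<dots> \<le> (\<integral>\<^sup>+s. (\<integral>\<^sup>+t. a t \<partial>lbon {0..T}) * (indicator {0..T} s * b s) \<partial>lborel)"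
  proof (intro nn_integral_mono)
    fix s :: real
    have "(\<integral>\<^sup>+t. (if 0 \<le> s \<and> s \<le> t \<and> t \<le> T then a (t - s) * b s else 0) \<partial>lborel) =
       (\<integral>\<^sup>+t. (if 0 \<le> s \<and> s \<le> s + 1 * t \<and> s + 1 * t \<le> T then a (s + 1 * t - s) * b s else 0) \<partial>lborel)"
      by (subst nn_integral_real_affine[where c=1 and t=s]) auto
    also have "\<dots> \<le> (\<integral>\<^sup>+t. (indicator {0..T} t * a t) * (indicator {0..T} s * b s) \<partial>lborel)"
      by (intro nn_integral_mono) (auto simp: indicator_def)
    also have "\<dots> = (\<integral>\<^sup>+t. a t \<partial>lbon {0..T}) * (indicator {0..T} s * b s)"
      by (subst nn_integral_lbon) (auto simp: nn_integral_multc)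
    finally show "(\<integral>\<^sup>+t. (if 0 \<le> s \<and> s \<le> t \<and> t \<le> T then a (t - s) * b s else 0) \<partial>lborel) \<le> \<dots>" .
  qed
  also have "\<dots> = (\<integral>\<^sup>+t. a t \<partial>lbon {0..T}) * (\<integral>\<^sup>+t. b t \<partial>lbon {0..T})"
    by (subst (3) nn_integral_lbon) (auto simp: nn_integral_cmult)
  finally show ?thesis .
qed

text \<open>Cauchy-Schwarz for the measure with density \<open>a (t - s)\<close>, applied to the
  functions \<open>1\<close> and \<open>b\<close>. Integration over \<open>t\<close> then reduces
  the L2 estimate to the L1 estimate.\<close>

lemma cvn_sq_le:
  assumes [measurable]: "a \<in> borel_measurable borel" "b \<in> borel_measurable borel" and t: "t \<in> {0..T}"
  shows "(cvn a b t)\<^sup>2 \<le> (\<integral>\<^sup>+t. a t \<partial>lbon {0..T}) * cvn a (\<lambda>t. (b t)\<^sup>2) t"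
proof -
  let ?w = "\<lambda>s. if 0 \<le> s \<and> s \<le> t then a (t - s) else 0"
  let ?D = "density lborel ?w"
  have 1: "cvn a b t = (\<integral>\<^sup>+s. 1 * b s \<partial>?D)"
    unfolding cvn_def by (subst nn_integral_density) (auto intro!: nn_integral_cong)
  have 2: "cvn a (\<lambda>t. (b t)\<^sup>2) t = (\<integral>\<^sup>+s. (b s)\<^sup>2 \<partial>?D)"
    unfolding cvn_def by (subst nn_integral_density) (auto intro!: nn_integral_cong)
  have "(\<integral>\<^sup>+s. 1\<^sup>2 \<partial>?D) = (\<integral>\<^sup>+s. ?w s \<partial>lborel)" by (subst nn_integral_density) auto
  also have "\<dots> = (\<integral>\<^sup>+s. ?w (t + (-1) * s) \<partial>lborel)" by (subst nn_integral_real_affine[where c="-1" and t=t]) auto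
  also have "\<dots> \<le> (\<integral>\<^sup>+s. indicator {0..T} s * a s \<partial>lborel)"
    by (intro nn_integral_mono) (use t in \<open>auto simp: indicator_def\<close>)
  also have "\<dots> = (\<integral>\<^sup>+t. a t \<partial>lbon {0..T})" by (subst nn_integral_lbon) auto
  finally have 3: "(\<integral>\<^sup>+s. 1\<^sup>2 \<partial>?D) \<le> (\<integral>\<^sup>+t. a t \<partial>lbon {0..T})" .
  have "(cvn a b t)\<^sup>2 \<le> (\<integral>\<^sup>+s. 1\<^sup>2 \<partial>?D) * (\<integral>\<^sup>+s. (b s)\<^sup>2 \<partial>?D)"
    unfolding 1 by (rule Cauchy_Schwarz_nn_integral) auto
  also have "\<dots> \<le> (\<integral>\<^sup>+t. a t \<partial>lbon {0..T}) * (\<integral>\<^sup>+s. (b s)\<^sup>2 \<partial>?D)" by (intro mult_right_mono 3) auto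
  finally show ?thesis unfolding 2 .
qed

lemma nn_integral_cvn_sq_le:
  assumes [measurable]: "a \<in> borel_measurable borel" "b \<in> borel_measurable borel"
  shows "(\<integral>\<^sup>+t. (cvn a b t)\<^sup>2 \<partial>lbon {0..T}) \<le> (\<integral>\<^sup>+t. a t \<partial>lbon {0..T})\<^sup>2 * (\<integral>\<^sup>+t. (b t)\<^sup>2 \<partial>lbon {0..T})"
proof -
  let ?A = "\<integral>\<^sup>+t. a t \<partial>lbon {0..T}"
  have "(\<integral>\<^sup>+t. (cvn a b t)\<^sup>2 \<partial>lbon {0..T}) \<le> (\<integral>\<^sup>+t. ?A * cvn a (\<lambda>t. (b t)\<^sup>2) t \<partial>lbon {0..T})"
    by (rule nn_integral_mono_AE) (subst AE_lbon, simp, auto intro!: AE_I2 cvn_sq_le)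
  also have "\<dots> = ?A * (\<integral>\<^sup>+t. cvn a (\<lambda>t. (b t)\<^sup>2) t \<partial>lbon {0..T})" by (rule nn_integral_cmult) measurable
  also have "\<dots> \<le> ?A * (?A * (\<integral>\<^sup>+t. (b t)\<^sup>2 \<partial>lbon {0..T}))"
    by (intro mult_left_mono nn_integral_cvn_le) auto
  finally show ?thesis by (simp add: power2_eq_square mult.assoc)
qed

text \<open>Kept in terms of nonnegative integrals so that it applies to every spatial slice of a
  function on space-time, including the null set of slices that are not square integrable.\<close>

lemma cvn_cv_bound:
  assumes [measurable]: "a \<in> borel_measurable borel" "z \<in> borel_measurable borel"
  shows "(\<integral>\<^sup>+t. ennreal ((cv a z t)\<^sup>2) \<partial>lbon {0..T})
    \<le> (\<integral>\<^sup>+t. ennreal \<bar>a t\<bar> \<partial>lbon {0..T})\<^sup>2 * (\<integral>\<^sup>+t. ennreal ((z t)\<^sup>2) \<partial>lbon {0..T})"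
proof -
  have "(\<integral>\<^sup>+t. ennreal ((cv a z t)\<^sup>2) \<partial>lbon {0..T}) \<le> (\<integral>\<^sup>+t. (cvn (\<lambda>t. ennreal \<bar>a t\<bar>) (\<lambda>t. ennreal \<bar>z t\<bar>) t)\<^sup>2 \<partial>lbon {0..T})"
  proof (rule nn_integral_mono)
    fix t
    have "ennreal ((cv a z t)\<^sup>2) = (ennreal \<bar>cv a z t\<bar>)\<^sup>2" by (simp add: ennreal_power)
    also have "\<dots> \<le> (cvn (\<lambda>t. ennreal \<bar>a t\<bar>) (\<lambda>t. ennreal \<bar>z t\<bar>) t)\<^sup>2" by (intro power_mono cv_le_cvn) simp
    finally show "ennreal ((cv a z t)\<^sup>2) \<le> \<dots>" .
  qed
  also have "\<dots> \<le> (\<integral>\<^sup>+t. ennreal \<bar>a t\<bar> \<partial>lbon {0..T})\<^sup>2 * (\<integral>\<^sup>+t. (ennreal \<bar>z t\<bar>)\<^sup>2 \<partial>lbon {0..T})"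
    by (rule nn_integral_cvn_sq_le) auto
  finally show ?thesis by (simp add: ennreal_power)
qed

lemma nn_integral_abs_eq: "integrable M f \<Longrightarrow> (\<integral>\<^sup>+x. ennreal \<bar>f x :: real\<bar> \<partial>M) = ennreal (LINT x|M. \<bar>f x\<bar>)"
  by (intro nn_integral_eq_integral) auto

lemma cv_l2:
  assumes a: "integrable (lbon {0..T}) a" and z: "l2 (lbon {0..T}) z"
  shows "l2 (lbon {0..T}) (cv a z)" "n2 (lbon {0..T}) (cv a z) \<le> (LINT t|lbon {0..T}. \<bar>a t\<bar>) * n2 (lbon {0..T}) z"
proof -
  have [measurable]: "a \<in> borel_measurable borel" "z \<in> borel_measurable borel" using a z by (auto simp: l2_def)
  have "(\<integral>\<^sup>+t. ennreal ((cv a z t)\<^sup>2) \<partial>lbon {0..T}) \<le> ennreal (((LINT t|lbon {0..T}. \<bar>a t\<bar>) * n2 (lbon {0..T}) z)\<^sup>2)"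
    using cvn_cv_bound[of a z T] unfolding nn_integral_abs_eq[OF a] nn_integral_l2[OF z]
    by (simp add: ennreal_power ennreal_mult power_mult_distrib)
  then show "l2 (lbon {0..T}) (cv a z)" "n2 (lbon {0..T}) (cv a z) \<le> (LINT t|lbon {0..T}. \<bar>a t\<bar>) * n2 (lbon {0..T}) z"
    by (auto intro!: l2I_nn)
qed

lemma cvn_finite_AE:
  assumes a: "integrable (lbon {0..T}) a" and b: "integrable (lbon {0..T}) b"
  shows "(\<integral>\<^sup>+t. cvn (\<lambda>t. ennreal \<bar>a t\<bar>) (\<lambda>t. ennreal \<bar>b t\<bar>) t \<partial>lbon {0..T}) < \<infinity>"
    and "AE t in lbon {0..T}. cvn (\<lambda>t. ennreal \<bar>a t\<bar>) (\<lambda>t. ennreal \<bar>b t\<bar>) t < \<infinity>"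
proof -
  have [measurable]: "a \<in> borel_measurable borel" "b \<in> borel_measurable borel" using a b by auto
  have "(\<integral>\<^sup>+t. cvn (\<lambda>t. ennreal \<bar>a t\<bar>) (\<lambda>t. ennreal \<bar>b t\<bar>) t \<partial>lbon {0..T}) \<le>
     ennreal (LINT t|lbon {0..T}. \<bar>a t\<bar>) * ennreal (LINT t|lbon {0..T}. \<bar>b t\<bar>)"
    unfolding nn_integral_abs_eq[OF a, symmetric] nn_integral_abs_eq[OF b, symmetric]
    by (rule nn_integral_cvn_le) auto
  also have "\<dots> < \<infinity>" by (simp add: ennreal_mult_less_top)
  finally show fin: "(\<integral>\<^sup>+t. cvn (\<lambda>t. ennreal \<bar>a t\<bar>) (\<lambda>t. ennreal \<bar>b t\<bar>) t \<partial>lbon {0..T}) < \<infinity>" .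
  have "AE t in lbon {0..T}. cvn (\<lambda>t. ennreal \<bar>a t\<bar>) (\<lambda>t. ennreal \<bar>b t\<bar>) t \<noteq> \<infinity>"
    by (rule nn_integral_PInf_AE) (use fin in auto)
  then show "AE t in lbon {0..T}. cvn (\<lambda>t. ennreal \<bar>a t\<bar>) (\<lambda>t. ennreal \<bar>b t\<bar>) t < \<infinity>" by (simp add: less_top)
qed

lemma cv_integrable:
  assumes a: "integrable (lbon {0..T}) a" and b: "integrable (lbon {0..T}) b"
  shows "integrable (lbon {0..T}) (cv a b)"
proof (rule integrableI_bounded)
  have [measurable]: "a \<in> borel_measurable borel" "b \<in> borel_measurable borel" using a b by auto
  show "cv a b \<in> borel_measurable (lbon {0..T})" by measurable
  have "(\<integral>\<^sup>+t. ennreal (norm (cv a b t)) \<partial>lbon {0..T}) \<le> (\<integral>\<^sup>+t. cvn (\<lambda>t. ennreal \<bar>a t\<bar>) (\<lambda>t. ennreal \<bar>b t\<bar>) t \<partial>lbon {0..T})"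
    by (intro nn_integral_mono) (simp add: cv_le_cvn)
  also have "\<dots> < \<infinity>" by (rule cvn_finite_AE[OF assms])
  finally show "(\<integral>\<^sup>+t. ennreal (norm (cv a b t)) \<partial>lbon {0..T}) < \<infinity>" .
qed

lemma cv_section_integrable_AE:
  fixes a b :: "real \<Rightarrow> real"
  assumes a: "integrable (lbon {0..T}) a" and b: "integrable (lbon {0..T}) b"
  shows "AE t in lbon {0..T}. integrable lborel (\<lambda>s. if 0 \<le> s \<and> s \<le> t then a (t - s) * b s else 0)"
  using cvn_finite_AE(2)[OF assms] by (subst cv_integrable_iff) (use a b in auto)

lemma cv_lincomb:
  assumes "integrable lborel (\<lambda>s. if 0 \<le> s \<and> s \<le> t then a (t - s) * b s else 0)"
    and "integrable lborel (\<lambda>s. if 0 \<le> s \<and> s \<le> t then a (t - s) * c s else 0)"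
  shows "cv a (\<lambda>s. p * b s + q * c s) t = p * cv a b t + q * cv a c t"
proof -
  have "cv a (\<lambda>s. p * b s + q * c s) t = (LINT s|lborel. p * (if 0 \<le> s \<and> s \<le> t then a (t - s) * b s else 0) + q * (if 0 \<le> s \<and> s \<le> t then a (t - s) * c s else 0))"
    unfolding cv_def by (intro Bochner_Integration.integral_cong) (auto simp: algebra_simps)
  also have "\<dots> = p * cv a b t + q * cv a c t" unfolding cv_def
    by (subst Bochner_Integration.integral_add) (use assms in auto)
  finally show ?thesis .
qed

lemma cv_lincomb_AE:
  assumes a: "integrable (lbon {0..T}) a" and b: "integrable (lbon {0..T}) b" and c: "integrable (lbon {0..T}) c"
  shows "AE t in lbon {0..T}. cv a (\<lambda>s. p * b s + q * c s) t = p * cv a b t + q * cv a c t"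
  using cv_section_integrable_AE[OF a b] cv_section_integrable_AE[OF a c]
  by eventually_elim (rule cv_lincomb)

lemma cv_cmult_right: "cv a (\<lambda>s. p * b s) t = p * cv a b t"
  unfolding cv_def by (subst integral_mult_right_zero[symmetric], intro Bochner_Integration.integral_cong) auto

lemma cv_cmult_left: "cv (\<lambda>s. p * a s) b t = p * cv a b t"
  using cv_cmult_right[of b p a t] by (simp add: cv_commute)

lemma cv_minus_right: "cv a (\<lambda>s. - b s) t = - cv a b t"
  using cv_cmult_right[of a "-1" b t] by simp

lemma cv_cong_AE:
  assumes [measurable]: "a \<in> borel_measurable borel" "b \<in> borel_measurable borel" "b' \<in> borel_measurable borel"
    and ae: "AE s in lbon {0..T}. b s = b' s" and t: "t \<le> T"
  shows "cv a b t = cv a b' t"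
proof -
  have "AE s in lborel. s \<in> {0..T} \<longrightarrow> b s = b' s" using ae by (simp add: AE_lbon)
  then have "AE s in lborel. (if 0 \<le> s \<and> s \<le> t then a (t - s) * b s else 0) = (if 0 \<le> s \<and> s \<le> t then a (t - s) * b' s else 0)"
    by eventually_elim (use t in auto)
  then show ?thesis unfolding cv_def by (intro integral_cong_AE) auto
qed

lemma cv_assoc_AE:
  assumes a: "integrable (lbon {0..T}) a" and b: "integrable (lbon {0..T}) b" and c: "integrable (lbon {0..T}) c"
  shows "AE t in lbon {0..T}. cv a (cv b c) t = cv (cv a b) c t"
proof -
  have [measurable]: "a \<in> borel_measurable borel" "b \<in> borel_measurable borel" "c \<in> borel_measurable borel" using a b c by auto
  let ?e = "\<lambda>a t. ennreal \<bar>a t\<bar>"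
  have "(\<integral>\<^sup>+t. cvn (?e a) (cvn (?e b) (?e c)) t \<partial>lbon {0..T}) \<le>
     (\<integral>\<^sup>+t. ?e a t \<partial>lbon {0..T}) * (\<integral>\<^sup>+t. cvn (?e b) (?e c) t \<partial>lbon {0..T})"
    by (rule nn_integral_cvn_le) auto
  also have "\<dots> < \<infinity>" using cvn_finite_AE(1)[OF b c] unfolding nn_integral_abs_eq[OF a] by (simp add: ennreal_mult_less_top)
  finally have "AE t in lbon {0..T}. cvn (?e a) (cvn (?e b) (?e c)) t \<noteq> \<infinity>"
    by (intro nn_integral_PInf_AE) auto
  then show ?thesis by eventually_elim (auto intro!: cv_assoc simp: less_top)
qed

text \<open>The weight is multiplicative along \<open>t = (t - s) + s\<close>, so it distributes
  over the two factors. A weighted convolution equation is therefore again one, with a kernel that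
  can be made small.\<close>

lemma cv_exp: "exp (- (\<sigma> * t)) * cv a b t = cv (\<lambda>s. exp (- (\<sigma> * s)) * a s) (\<lambda>s. exp (- (\<sigma> * s)) * b s) t"
  unfolding cv_def by (subst integral_mult_right_zero[symmetric], intro Bochner_Integration.integral_cong)
    (auto simp: exp_add[symmetric] algebra_simps simp flip: exp_minus)

lemma l2_integrable1:
  assumes "l2 (lbon {0..T::real}) z" shows "integrable (lbon {0..T}) z"
proof -
  interpret finite_measure "lbon {0..T}" by (rule finite_measure_lbon) auto
  have "l2 (lbon {0..T}) (\<lambda>x. 1)" by (simp add: l2_def)
  from l2_mult_integrable[OF assms this] show ?thesis by simp
qed

section \<open>Volterra equations and the Abel kernel\<close>

lemma l2_bounded_mult:
  assumes [measurable]: "g \<in> borel_measurable borel" and z: "l2 (lbon {0..T::real}) z"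
    and g: "\<And>t. t \<in> {0..T} \<Longrightarrow> \<bar>g t\<bar> \<le> B" and B: "0 \<le> B"
  shows "l2 (lbon {0..T}) (\<lambda>t. g t * z t)" "n2 (lbon {0..T}) (\<lambda>t. g t * z t) \<le> B * n2 (lbon {0..T}) z"
proof -
  have [measurable]: "z \<in> borel_measurable borel" using z by (auto simp: l2_def)
  have "(\<integral>\<^sup>+t. ennreal ((g t * z t)\<^sup>2) \<partial>lbon {0..T}) \<le> (\<integral>\<^sup>+t. ennreal (B\<^sup>2) * ennreal ((z t)\<^sup>2) \<partial>lbon {0..T})"
  proof (rule nn_integral_mono_AE, subst AE_lbon, simp, rule AE_I2, rule impI)
    fix t assume t: "t \<in> {0..T}"
    have "(g t)\<^sup>2 \<le> B\<^sup>2" using g[OF t] B by (simp add: abs_le_square_iff[symmetric])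
    then show "ennreal ((g t * z t)\<^sup>2) \<le> ennreal (B\<^sup>2) * ennreal ((z t)\<^sup>2)"
      by (simp add: power_mult_distrib ennreal_mult[symmetric] mult_right_mono)
  qed
  also have "\<dots> = ennreal ((B * n2 (lbon {0..T}) z)\<^sup>2)"
    using nn_integral_l2[OF z] by (subst nn_integral_cmult) (auto simp: power_mult_distrib ennreal_mult)
  finally show "l2 (lbon {0..T}) (\<lambda>t. g t * z t)" "n2 (lbon {0..T}) (\<lambda>t. g t * z t) \<le> B * n2 (lbon {0..T}) z"
    using B by (auto intro!: l2I_nn)
qed

lemma integrable_exp_weight:
  assumes a: "integrable (lbon {0..T::real}) (a :: real \<Rightarrow> real)" and "0 \<le> \<sigma>"
  shows "integrable (lbon {0..T}) (\<lambda>s. exp (- (\<sigma> * s)) * a s)"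
proof (rule Bochner_Integration.integrable_bound[OF a])
  have [measurable]: "a \<in> borel_measurable borel" using a by auto
  show "(\<lambda>s. exp (- (\<sigma> * s)) * a s) \<in> borel_measurable (lbon {0..T})" by measurable
  show "AE s in lbon {0..T}. norm (exp (- (\<sigma> * s)) * a s) \<le> norm (a s)"
    using assms(2) by (subst AE_lbon) (auto simp: abs_mult intro!: AE_I2 mult_left_le_one_le)
qed

text \<open>Dominated convergence along integer \<open>\<sigma>\<close>. This is the source of all
  smallness below; neither \<open>T\<close> nor the kernel has to be small.\<close>

lemma exp_weight_small:
  assumes a: "integrable (lbon {0..T::real}) (a :: real \<Rightarrow> real)" and "0 < \<eta>"
  obtains \<sigma> :: real where "\<sigma> > 0" "(LINT s|lbon {0..T}. \<bar>exp (- (\<sigma> * s)) * a s\<bar>) < \<eta>"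
proof -
  have [measurable]: "a \<in> borel_measurable borel" using a by auto
  have "(\<lambda>n. LINT s|lbon {0..T}. \<bar>exp (- (real n * s)) * a s\<bar>) \<longlonglongrightarrow> (LINT s|lbon {0..T}. 0)"
  proof (rule integral_dominated_convergence[where w="\<lambda>s. \<bar>a s\<bar>"])
    \<comment> \<open>At \<open>s = 0\<close> the weight does not decay, but this is a single
      point.\<close>
    have "AE s in lborel. s \<noteq> (0::real)" by (rule AE_lborel_singleton)
    then have "AE s in lborel. s \<in> {0..T} \<longrightarrow> (\<lambda>n. \<bar>exp (- (real n * s)) * a s\<bar>) \<longlonglongrightarrow> 0"
    proof eventually_elim
      case (elim s)
      show ?case
      proof
        assume "s \<in> {0..T}"
        with elim have s: "s > 0" by auto
        have e: "exp (- (real n * s)) = exp (- s) ^ n" for n by (simp add: exp_of_nat_mult[symmetric])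
        have "(\<lambda>n. exp (- s) ^ n * \<bar>a s\<bar>) \<longlonglongrightarrow> 0 * \<bar>a s\<bar>"
          by (intro tendsto_intros LIMSEQ_power_zero) (use s in auto)
        then show "(\<lambda>n. \<bar>exp (- (real n * s)) * a s\<bar>) \<longlonglongrightarrow> 0" by (simp add: e abs_mult)
      qed
    qed
    then show "AE s in lbon {0..T}. (\<lambda>n. \<bar>exp (- (real n * s)) * a s\<bar>) \<longlonglongrightarrow> 0" by (simp add: AE_lbon)
    show "AE s in lbon {0..T}. norm \<bar>exp (- (real n * s)) * a s\<bar> \<le> \<bar>a s\<bar>" for n
      by (subst AE_lbon) (auto simp: abs_mult intro!: AE_I2 mult_left_le_one_le)
  qed (use a in auto)
  then have "eventually (\<lambda>n. (LINT s|lbon {0..T}. \<bar>exp (- (real n * s)) * a s\<bar>) < \<eta>) sequentially"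
    using assms(2) by (intro order_tendstoD(2)[where y = "LINT s|lbon {0..T}. 0"]) auto
  then have "eventually (\<lambda>n. (LINT s|lbon {0..T}. \<bar>exp (- (real n * s)) * a s\<bar>) < \<eta> \<and> n > 0) sequentially"
    by (intro eventually_conj eventually_gt_at_top)
  then obtain n where "n > 0" "(LINT s|lbon {0..T}. \<bar>exp (- (real n * s)) * a s\<bar>) < \<eta>"
    by (auto simp: eventually_sequentially)
  then show thesis using that[of "real n"] by auto
qed

text \<open>In a weighted norm the convolution operator is a contraction, whatever the size of the
  kernel. The weight depends on the kernel, hence later on the eigenvalue, so no norm bound is
  recorded here; the uniform one comes from the energy argument in
  \<open>mode_solvable\<close>.\<close>

lemma volterra_exists:
  assumes a: "integrable (lbon {0..T::real}) (a :: real \<Rightarrow> real)" and f: "l2 (lbon {0..T}) f"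
  obtains w where "l2 (lbon {0..T}) w" "AE t in lbon {0..T}. w t + cv a w t = f t"
proof -
  let ?M = "lbon {0..T}"
  obtain \<sigma> :: real where \<sigma>: "\<sigma> > 0" "(LINT s|?M. \<bar>exp (- (\<sigma> * s)) * a s\<bar>) < 1"
    using exp_weight_small[OF a zero_less_one] .
  let ?a = "\<lambda>s. exp (- (\<sigma> * s)) * a s" and ?f = "\<lambda>s. exp (- (\<sigma> * s)) * f s"
  have ai: "integrable ?M ?a" by (rule integrable_exp_weight[OF a]) (use \<sigma> in simp)
  have fl: "l2 ?M ?f" by (rule l2_bounded_mult(1)[OF _ f, of _ 1]) (use \<sigma> in auto)
  obtain v where v: "l2 ?M v" "AE t in ?M. v t = ?f t + - cv ?a v t"
  proof (rule l2_contraction[OF fl, where A = "\<lambda>g t. - cv ?a g t" and \<theta> = "LINT s|?M. \<bar>?a s\<bar>"])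
    show "l2 ?M (\<lambda>t. - cv ?a g t)" if "l2 ?M g" for g by (intro l2_minus cv_l2 ai that)
    fix g h assume g: "l2 ?M g" and h: "l2 ?M h"
    have [measurable]: "g \<in> borel_measurable borel" "h \<in> borel_measurable borel" "a \<in> borel_measurable borel"
      using a g h by (auto simp: l2_def)
    have "n2 ?M (\<lambda>x. - cv ?a g x - - cv ?a h x) = n2 ?M (\<lambda>x. - cv ?a (\<lambda>s. g s - h s) x)"
    proof (rule n2_cong_AE)
      show "AE x in ?M. - cv ?a g x - - cv ?a h x = - cv ?a (\<lambda>s. g s - h s) x"
        using cv_lincomb_AE[OF ai l2_integrable1[OF g] l2_integrable1[OF h], of 1 "-1"]
        by eventually_elim simp
    qed measurable
    also have "\<dots> \<le> (LINT s|?M. \<bar>?a s\<bar>) * n2 ?M (\<lambda>s. g s - h s)"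
      unfolding n2_minus by (rule cv_l2(2)[OF ai l2_diff[OF g h]])
    finally show "n2 ?M (\<lambda>x. - cv ?a g x - - cv ?a h x) \<le> (LINT s|?M. \<bar>?a s\<bar>) * n2 ?M (\<lambda>s. g s - h s)" .
  qed (use \<sigma> in auto)
  let ?w = "\<lambda>t. exp (\<sigma> * t) * v t"
  have "l2 ?M ?w" by (rule l2_bounded_mult(1)[OF _ v(1), of _ "exp (\<sigma> * T)"]) (use \<sigma> in auto)
  moreover have "AE t in ?M. ?w t + cv a ?w t = f t"
    using v(2)
  proof eventually_elim
    case (elim t)
    have "exp (- (\<sigma> * t)) * cv a ?w t = cv ?a v t" unfolding cv_exp by (simp add: mult.assoc[symmetric] exp_add[symmetric])
    then have "cv a ?w t = exp (\<sigma> * t) * cv ?a v t" by (simp add: exp_minus field_simps)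
    then have "?w t + cv a ?w t = exp (\<sigma> * t) * (v t + cv ?a v t)" by (simp add: algebra_simps)
    also have "\<dots> = exp (\<sigma> * t) * ?f t" using elim by simp
    finally show ?case by (simp add: mult.assoc[symmetric] exp_add[symmetric])
  qed
  ultimately show thesis by (rule that)
qed

lemma volterra_unique:
  assumes a: "integrable (lbon {0..T::real}) (a :: real \<Rightarrow> real)" and v: "l2 (lbon {0..T}) v"
    and eq: "AE t in lbon {0..T}. v t + cv a v t = 0"
  shows "AE t in lbon {0..T}. v t = 0"
proof -
  let ?M = "lbon {0..T}"
  obtain \<sigma> :: real where \<sigma>: "\<sigma> > 0" "(LINT s|?M. \<bar>exp (- (\<sigma> * s)) * a s\<bar>) < 1"
    using exp_weight_small[OF a zero_less_one] .
  have [measurable]: "a \<in> borel_measurable borel" "v \<in> borel_measurable borel" using a v by (auto simp: l2_def)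
  let ?a = "\<lambda>s. exp (- (\<sigma> * s)) * a s" and ?v = "\<lambda>s. exp (- (\<sigma> * s)) * v s"
  have ai: "integrable ?M ?a" by (rule integrable_exp_weight[OF a]) (use \<sigma> in simp)
  have vl: "l2 ?M ?v" by (rule l2_bounded_mult(1)[OF _ v, of _ 1]) (use \<sigma> in auto)
  have "AE t in ?M. ?v t = - cv ?a ?v t"
    using eq
  proof eventually_elim
    case (elim t)
    then have "exp (- (\<sigma> * t)) * v t + exp (- (\<sigma> * t)) * cv a v t = 0" by (simp flip: distrib_left)
    then show ?case unfolding cv_exp by simp
  qed
  then have "n2 ?M ?v = n2 ?M (\<lambda>t. - cv ?a ?v t)" by (rule n2_cong_AE) measurable
  also have "\<dots> \<le> (LINT s|?M. \<bar>?a s\<bar>) * n2 ?M ?v" unfolding n2_minus by (rule cv_l2(2)[OF ai vl])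
  finally have "(1 - (LINT s|?M. \<bar>?a s\<bar>)) * n2 ?M ?v \<le> 0" by (simp add: left_diff_distrib)
  then have "n2 ?M ?v \<le> 0" using \<sigma>(2) by (simp add: mult_le_0_iff)
  then have "n2 ?M ?v = 0" using n2_nonneg[of ?M ?v] by simp
  from n2_eq_0[OF vl this] show ?thesis by eventually_elim simp
qed

section \<open>The Abel kernel and its positivity\<close>

text \<open>The kernel of fractional integration of order \<open>\<alpha>\<close>. The value 0 at
  the singularity agrees with \<open>0 powr (\<alpha> - 1)\<close>, so that the comparison with the
  variable-order kernel holds at time 0 as well.\<close>

definition beta_k :: "real \<Rightarrow> real \<Rightarrow> real" where
  "beta_k \<alpha> t = (if 0 < t then t powr (\<alpha> - 1) / Gamma \<alpha> else 0)"

lemma borel_measurable_beta_k [measurable]: "beta_k \<alpha> \<in> borel_measurable borel"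
  unfolding beta_k_def[abs_def] by measurable

lemma beta_k_nonneg: "0 < \<alpha> \<Longrightarrow> 0 \<le> beta_k \<alpha> t"
  by (simp add: beta_k_def Gamma_real_pos less_imp_le)

lemma powr_integrable_lbon:
  assumes "0 < (e::real)" shows "integrable (lbon {0..T}) (\<lambda>t. t powr (e - 1))"
proof -
  have "(\<lambda>t. t powr (e - 1)) integrable_on {0..T}"
  proof (cases "0 \<le> T")
    case True
    show ?thesis using has_integral_powr_from_0[of "e - 1" T] assms True by (intro has_integral_integrable) auto
  qed auto
  then have "(\<lambda>t. t powr (e - 1)) absolutely_integrable_on {0..T}"
    by (intro nonnegative_absolutely_integrable_1) auto
  then show ?thesis
    by (subst integrable_lbon) (auto simp: set_integrable_def integrable_completion)
qed

lemma beta_k_integrable: "0 < \<alpha> \<Longrightarrow> integrable (lbon {0..T}) (beta_k \<alpha>)"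
proof -
  assume a: "0 < \<alpha>"
  have "integrable (lbon {0..T}) (\<lambda>t. (1 / Gamma \<alpha>) * t powr (\<alpha> - 1))"
    by (intro integrable_mult_right powr_integrable_lbon a)
  then show ?thesis
    by (rule integrable_cong_AE_imp) (auto simp: AE_lbon beta_k_def intro!: AE_I2)
qed

text \<open>The kernel \<open>exp (- (p * \<bar>t - r\<bar>))\<close> is the Gram kernel of the
  one-sided exponentials \<open>sqrt (2 * p) * exp (- (p * (t - \<xi>)))\<close> on
  \<open>\<xi> < t\<close>. Reflecting \<open>\<xi>\<close> at \<open>min t r\<close> leaves an
  elementary integral over the half-line.\<close>

lemma exp_feature:
  assumes p: "0 < (p::real)"
  shows "(\<integral>\<^sup>+\<xi>. ennreal (if \<xi> < t \<and> \<xi> < r then 2 * p * (exp (- (p * (t - \<xi>))) * exp (- (p * (r - \<xi>)))) else 0) \<partial>lborel)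
    = ennreal (exp (- (p * \<bar>t - r\<bar>)))"
proof -
  let ?m = "min t r"
  have "(\<integral>\<^sup>+\<xi>. ennreal (if \<xi> < t \<and> \<xi> < r then 2 * p * (exp (- (p * (t - \<xi>))) * exp (- (p * (r - \<xi>)))) else 0) \<partial>lborel)
     = (\<integral>\<^sup>+\<xi>. ennreal (if ?m + (-1) * \<xi> < t \<and> ?m + (-1) * \<xi> < r then
          2 * p * (exp (- (p * (t - (?m + (-1) * \<xi>)))) * exp (- (p * (r - (?m + (-1) * \<xi>))))) else 0) \<partial>lborel)"
    by (subst nn_integral_real_affine[where c="-1" and t="?m"]) auto
  also have "\<dots> = (\<integral>\<^sup>+\<xi>. ennreal (2 * p * exp (- (p * (\<bar>t - r\<bar> + 2 * \<xi>)))) * indicator {0..} \<xi> \<partial>lborel)"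
  proof (rule nn_integral_cong_AE)
    have "AE \<xi> in lborel. \<xi> \<noteq> (0::real)" by (rule AE_lborel_singleton)
    then show "AE \<xi> in lborel. ennreal (if ?m + (-1) * \<xi> < t \<and> ?m + (-1) * \<xi> < r then
          2 * p * (exp (- (p * (t - (?m + (-1) * \<xi>)))) * exp (- (p * (r - (?m + (-1) * \<xi>))))) else 0) =
        ennreal (2 * p * exp (- (p * (\<bar>t - r\<bar> + 2 * \<xi>)))) * indicator {0..} \<xi>"
    proof eventually_elim
      case (elim \<xi>)
      have e: "exp (- (p * (t - (?m + (-1) * \<xi>)))) * exp (- (p * (r - (?m + (-1) * \<xi>)))) = exp (- (p * (\<bar>t - r\<bar> + 2 * \<xi>)))"
        by (cases "t \<le> r") (simp_all add: exp_add[symmetric] algebra_simps)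
      have c: "?m + (-1) * \<xi> < t \<and> ?m + (-1) * \<xi> < r \<longleftrightarrow> 0 < \<xi>" by linarith
      show ?case unfolding e c using elim by (simp add: indicator_def)
    qed
  qed
  also have "\<dots> = ennreal (0 - (- exp (- (p * (\<bar>t - r\<bar> + 2 * 0)))))"
  proof (rule nn_integral_FTC_atLeast)
    show "((\<lambda>\<xi>. - exp (- (p * (\<bar>t - r\<bar> + 2 * \<xi>)))) has_real_derivative 2 * p * exp (- (p * (\<bar>t - r\<bar> + 2 * x)))) (at x)" for x
      by (auto intro!: derivative_eq_intros)
    have "filterlim (\<lambda>\<xi>. p * (\<bar>t - r\<bar> + 2 * \<xi>)) at_top at_top"
      by (intro filterlim_tendsto_pos_mult_at_top[OF tendsto_const p] filterlim_tendsto_add_at_top[OF tendsto_const]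
          filterlim_tendsto_pos_mult_at_top[OF tendsto_const]  filterlim_ident) simp
    then have "((\<lambda>\<xi>. exp (- (p * (\<bar>t - r\<bar> + 2 * \<xi>)))) \<longlongrightarrow> 0) at_top"
      by (intro filterlim_compose[OF exp_at_bot]) (simp add: filterlim_uminus_at_top[symmetric])
    then show "((\<lambda>\<xi>. - exp (- (p * (\<bar>t - r\<bar> + 2 * \<xi>)))) \<longlongrightarrow> 0) at_top"
      using tendsto_minus[of _ 0] by fastforce
  qed (use p in auto)
  finally show ?thesis by simp
qed

lemma nn_integral_Gamma:
  assumes "0 < (x::real)"
  shows "(\<integral>\<^sup>+t. ennreal (if 0 < t then t powr (x - 1) * exp (- t) else 0) \<partial>lborel) = ennreal (Gamma x)"
proof -
  have "((\<lambda>t. t powr (x - 1) / exp t) has_integral Gamma x) {0..}" by (rule Gamma_integral_real[OF assms])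
  from nn_integral_has_integral_lebesgue[OF _ this]
  have "(\<integral>\<^sup>+t. ennreal (indicator {0..} t * (t powr (x - 1) / exp t)) \<partial>lborel) = ennreal (Gamma x)" by simp
  also have "(\<lambda>t. indicator {0..} t * (t powr (x - 1) / exp t)) = (\<lambda>t. if 0 < t then t powr (x - 1) * exp (- t) else 0)"
    by (auto simp: indicator_def exp_minus field_simps)
  finally show ?thesis .
qed

text \<open>The Laplace representation of a negative power, from the Gamma integral. Starting the
  rates at \<open>\<sigma>\<close> instead of 0 produces precisely the factor
  \<open>exp (- (\<sigma> * d))\<close>, which is why the exponential weight is compatible with
  positivity.\<close>

lemma powr_feature:
  assumes d: "0 < (d::real)" and \<alpha>: "\<alpha> < 1"
  shows "(\<integral>\<^sup>+p. ennreal (if \<sigma> < p then (p - \<sigma>) powr (- \<alpha>) * exp (- (p * d)) else 0) \<partial>lborel)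
    = ennreal (Gamma (1 - \<alpha>) * d powr (\<alpha> - 1) * exp (- (\<sigma> * d)))"
proof -
  have "(\<integral>\<^sup>+p. ennreal (if \<sigma> < p then (p - \<sigma>) powr (- \<alpha>) * exp (- (p * d)) else 0) \<partial>lborel)
     = ennreal (1/d) * (\<integral>\<^sup>+x. ennreal (if \<sigma> < \<sigma> + 1/d * x then (\<sigma> + 1/d * x - \<sigma>) powr (- \<alpha>) * exp (- ((\<sigma> + 1/d * x) * d)) else 0) \<partial>lborel)"
    using d by (subst nn_integral_real_affine[where c="1/d" and t=\<sigma>]) auto
  also have "\<dots> = ennreal (1/d) * (\<integral>\<^sup>+x. ennreal (d powr \<alpha> * exp (- (\<sigma> * d))) * ennreal (if 0 < x then x powr ((1 - \<alpha>) - 1) * exp (- x) else 0) \<partial>lborel)"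
  proof (intro arg_cong2[where f="(*)"] nn_integral_cong refl)
    fix x :: real
    have e: "exp (- ((\<sigma> + 1/d * x) * d)) = exp (- (\<sigma> * d)) * exp (- x)"
      using d by (simp add: exp_add[symmetric] algebra_simps)
    have q: "(\<sigma> + 1/d * x - \<sigma>) powr (- \<alpha>) = x powr (1 - \<alpha> - 1) * d powr \<alpha>" if "0 < x"
      using d that by (simp add: powr_divide powr_minus_divide)
    have c: "\<sigma> < \<sigma> + 1/d * x \<longleftrightarrow> 0 < x" using d by (simp add: zero_less_divide_iff)
    show "ennreal (if \<sigma> < \<sigma> + 1/d * x then (\<sigma> + 1/d * x - \<sigma>) powr (- \<alpha>) * exp (- ((\<sigma> + 1/d * x) * d)) else 0) =
      ennreal (d powr \<alpha> * exp (- (\<sigma> * d))) * ennreal (if 0 < x then x powr (1 - \<alpha> - 1) * exp (- x) else 0)"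
    proof (cases "0 < x")
      case True
      show ?thesis unfolding e c q[OF True] if_P[OF True]
        by (subst ennreal_mult[symmetric]) (auto simp: mult_ac)
    qed (unfold c, simp)
  qed
  also have "\<dots> = ennreal (1/d) * (ennreal (d powr \<alpha> * exp (- (\<sigma> * d))) * ennreal (Gamma (1 - \<alpha>)))"
    using nn_integral_Gamma[of "1 - \<alpha>"] \<alpha> by (subst nn_integral_cmult) auto
  also have "\<dots> = ennreal (Gamma (1 - \<alpha>) * d powr (\<alpha> - 1) * exp (- (\<sigma> * d)))"
  proof -
    have "1/d * (d powr \<alpha> * exp (- (\<sigma> * d)) * Gamma (1 - \<alpha>)) = Gamma (1 - \<alpha>) * d powr (\<alpha> - 1) * exp (- (\<sigma> * d))"
      using d by (simp add: powr_diff)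
    moreover have "0 \<le> Gamma (1 - \<alpha>)" using \<alpha> by (simp add: Gamma_real_pos less_imp_le)
    ultimately show ?thesis using d by (simp add: ennreal_mult[symmetric] del: times_divide_eq_left)
  qed
  finally show ?thesis .
qed

text \<open>The diagonal has to be excluded: there the superposition representing the Abel kernel
  diverges, while \<open>beta_k\<close> has the value 0.\<close>

lemma AE_lborel_pair_neq: "AE z in (lborel :: (real \<times> real) measure). fst z \<noteq> snd z"
  unfolding lborel_prod[symmetric]
proof (rule lborel_pair.AE_pair_measure)
  have "Measurable.pred (lborel \<Otimes>\<^sub>M lborel) (\<lambda>x::real \<times> real. fst x \<noteq> snd x)" by measurable
  then show "{x \<in> space (lborel \<Otimes>\<^sub>M lborel). fst x \<noteq> (snd x :: real)} \<in> sets (lborel \<Otimes>\<^sub>M lborel)"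
    by (simp add: pred_def)
  have "AE y in lborel. x \<noteq> (y::real)" for x using AE_lborel_singleton[of x] by eventually_elim auto
  then show "AE x in lborel. AE y in lborel. fst (x, y) \<noteq> (snd (x, y) :: real)" by simp
qed

text \<open>The quadratic form of such a kernel is a superposition of squares.\<close>
lemma feature_form_nonneg:
  fixes H :: "'q::euclidean_space \<Rightarrow> real \<Rightarrow> real" and G :: "real \<Rightarrow> real \<Rightarrow> real"
  assumes [measurable]: "(\<lambda>z. H (fst z) (snd z)) \<in> borel_measurable (borel \<Otimes>\<^sub>M borel)" "v \<in> borel_measurable borel"
    and [measurable]: "(\<lambda>z. G (fst z) (snd z)) \<in> borel_measurable (borel \<Otimes>\<^sub>M borel)"
    and H0: "\<And>q t. 0 \<le> H q t" and G0: "\<And>t r. 0 \<le> G t r"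
    and HG: "\<And>t r. t \<noteq> r \<Longrightarrow> (\<integral>\<^sup>+q. ennreal (H q t * H q r) \<partial>lborel) = ennreal (G t r)"
    and fin: "(\<integral>\<^sup>+t. \<integral>\<^sup>+r. ennreal (G t r * (\<bar>v t\<bar> * \<bar>v r\<bar>)) \<partial>lborel \<partial>lborel) < \<infinity>"
  shows "integrable (lborel \<Otimes>\<^sub>M lborel) (\<lambda>z. G (fst z) (snd z) * (v (fst z) * v (snd z)))"
    and "0 \<le> (LINT z|(lborel \<Otimes>\<^sub>M lborel). G (fst z) (snd z) * (v (fst z) * v (snd z)))"
proof -
  define F where "F q z = H q (fst z) * H q (snd z) * (v (fst z) * v (snd z))" for q and z :: "real \<times> real"
  have Hm: "(\<lambda>x. H (f x) (g x)) \<in> borel_measurable N"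
    if "f \<in> borel_measurable N" "g \<in> borel_measurable N" for f g and N :: "'z measure"
    using measurable_compose[OF measurable_Pair[OF that] assms(1)] by simp
  have Hs[measurable]: "(\<lambda>q. H q t) \<in> borel_measurable borel" "H q \<in> borel_measurable borel" for q t
    using measurable_compose[OF measurable_Pair[OF measurable_ident measurable_const] assms(1), of t]
      measurable_compose[OF measurable_Pair[OF measurable_const measurable_ident] assms(1), of q] by simp_all
  have fs: "fst \<in> borel_measurable (borel :: (real \<times> real) measure)" "snd \<in> borel_measurable (borel :: (real \<times> real) measure)"
    by (intro borel_measurable_continuous_onI continuous_intros)+
  have c1[measurable]: "(\<lambda>x. fst (snd x)) \<in> borel_measurable ((lborel :: 'q measure) \<Otimes>\<^sub>M (lborel :: (real \<times> real) measure))"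
    and c2[measurable]: "(\<lambda>x. snd (snd x)) \<in> borel_measurable ((lborel :: 'q measure) \<Otimes>\<^sub>M (lborel :: (real \<times> real) measure))"
    by (rule measurable_compose[OF measurable_snd]; simp add: fs)+
  have c0: "fst \<in> borel_measurable ((lborel :: 'q measure) \<Otimes>\<^sub>M (lborel :: (real \<times> real) measure))"
    using measurable_fst[of "lborel :: 'q measure"] by (simp cong: measurable_cong_sets)
  have [measurable]: "case_prod F \<in> borel_measurable (lborel \<Otimes>\<^sub>M lborel)"
    unfolding F_def[abs_def] case_prod_unfold
    by (intro borel_measurable_times Hm c0 c1 c2 measurable_compose[OF c1 assms(2)] measurable_compose[OF c2 assms(2)])
  have Gm[measurable]: "(\<lambda>z. G (fst z) (snd z)) \<in> borel_measurable (lborel :: (real \<times> real) measure)"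
    using assms(3) by (simp add: borel_prod)
  have vm[measurable]: "(\<lambda>z. v (fst z)) \<in> borel_measurable (lborel :: (real \<times> real) measure)"
    "(\<lambda>z. v (snd z)) \<in> borel_measurable (lborel :: (real \<times> real) measure)"
    unfolding borel_prod[symmetric] by (simp_all add: borel_prod[symmetric])
  \<comment> \<open>Integrating \<open>q\<close> out first turns the absolute value of
    \<open>F\<close> into the expression that \<open>fin\<close> bounds.\<close>
  have int: "integrable (lborel \<Otimes>\<^sub>M lborel) (case_prod F)"
  proof (rule integrableI_bounded)
    have "(\<integral>\<^sup>+x. ennreal (norm (case_prod F x)) \<partial>(lborel \<Otimes>\<^sub>M lborel)) = (\<integral>\<^sup>+z. \<integral>\<^sup>+q. ennreal \<bar>F q z\<bar> \<partial>lborel \<partial>lborel)"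
      by (subst lborel_pair.nn_integral_snd[symmetric]) auto
    also have "\<dots> = (\<integral>\<^sup>+z. ennreal (G (fst z) (snd z) * (\<bar>v (fst z)\<bar> * \<bar>v (snd z)\<bar>)) \<partial>lborel)"
    proof (rule nn_integral_cong_AE)
      show "AE z in lborel. (\<integral>\<^sup>+q. ennreal \<bar>F q z\<bar> \<partial>lborel) = ennreal (G (fst z) (snd z) * (\<bar>v (fst z)\<bar> * \<bar>v (snd z)\<bar>))"
        using AE_lborel_pair_neq
      proof eventually_elim
        case (elim z)
        have "(\<integral>\<^sup>+q. ennreal \<bar>F q z\<bar> \<partial>lborel) = (\<integral>\<^sup>+q. ennreal (H q (fst z) * H q (snd z)) * ennreal (\<bar>v (fst z)\<bar> * \<bar>v (snd z)\<bar>) \<partial>lborel)"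
          by (intro nn_integral_cong) (simp add: F_def abs_mult H0 ennreal_mult[symmetric])
        also have "\<dots> = ennreal (G (fst z) (snd z)) * ennreal (\<bar>v (fst z)\<bar> * \<bar>v (snd z)\<bar>)"
          by (subst nn_integral_multc) (auto simp: HG[OF elim])
        finally show ?case by (simp add: ennreal_mult[symmetric] G0)
      qed
    qed
    also have "\<dots> = (\<integral>\<^sup>+t. \<integral>\<^sup>+r. ennreal (G t r * (\<bar>v t\<bar> * \<bar>v r\<bar>)) \<partial>lborel \<partial>lborel)"
      unfolding lborel_prod[symmetric] by (subst lborel.nn_integral_fst[symmetric]) (auto simp: lborel_prod)
    finally show "(\<integral>\<^sup>+x. ennreal (norm (case_prod F x)) \<partial>(lborel \<Otimes>\<^sub>M lborel)) < \<infinity>" using fin by simp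
  qed measurable
  have inner: "AE z in lborel. (LINT q|lborel. F q z) = G (fst z) (snd z) * (v (fst z) * v (snd z))"
    using AE_lborel_pair_neq
  proof eventually_elim
    case (elim z)
    have "(LINT q|lborel. H q (fst z) * H q (snd z)) = G (fst z) (snd z)"
      by (subst integral_eq_nn_integral) (auto simp: H0 G0 HG[OF elim])
    then show ?case by (simp add: F_def)
  qed
  have "integrable lborel (\<lambda>z. LINT q|lborel. F q z)" by (rule lborel_pair.integrable_snd[OF int])
  then have "integrable (lborel :: (real \<times> real) measure) (\<lambda>z. G (fst z) (snd z) * (v (fst z) * v (snd z)))"
    by (rule integrable_cong_AE_imp) (use inner in auto)
  then show "integrable (lborel \<Otimes>\<^sub>M lborel) (\<lambda>z. G (fst z) (snd z) * (v (fst z) * v (snd z)))"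
    by (simp add: lborel_prod)
  have "(LINT z|(lborel \<Otimes>\<^sub>M lborel). G (fst z) (snd z) * (v (fst z) * v (snd z))) = (LINT z|lborel. LINT q|lborel. F q z)"
    unfolding lborel_prod using inner by (intro integral_cong_AE) auto
  also have "\<dots> = (LINT q|lborel. LINT z|lborel. F q z)" by (rule lborel_pair.Fubini_integral[OF int])
  also have "0 \<le> \<dots>"
  proof (rule integral_nonneg_AE)
    \<comment> \<open>For fixed \<open>q\<close> the kernel has rank one, so the iterated integral
      factors into two equal integrals.\<close>
    show "AE q in lborel. 0 \<le> (LINT z|lborel. F q z)"
      using lborel_pair.AE_integrable_fst'[OF int]
    proof eventually_elim
      case (elim q)
      then have i: "integrable (lborel \<Otimes>\<^sub>M lborel) (F q)" by (simp add: lborel_prod)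
      have "(LINT z|lborel. F q z) = (LINT t|lborel. LINT r|lborel. F q (t, r))"
        using lborel_pair.integral_fst'[OF i] by (simp add: lborel_prod)
      also have "\<dots> = (LINT t|lborel. LINT r|lborel. (H q t * v t) * (H q r * v r))"
        by (simp add: F_def mult_ac)
      also have "\<dots> = (LINT t|lborel. H q t * v t)\<^sup>2" by (simp add: power2_eq_square)
      finally show ?case by simp
    qed
  qed
  finally show "0 \<le> (LINT z|(lborel \<Otimes>\<^sub>M lborel). G (fst z) (snd z) * (v (fst z) * v (snd z)))" .
qed

text \<open>The two preceding representations are combined: a feature is indexed by a decay rate
  \<open>p > \<sigma>\<close> and a cut-off \<open>\<xi>\<close>. The density of rates carries
  \<open>1 / Gamma (1 - \<alpha>)\<close> from the Laplace representation and
  \<open>1 / Gamma \<alpha>\<close> from the Abel kernel; the factor \<open>2 * p\<close> normalises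
  the one-sided exponentials.\<close>

lemma beta_k_feature:
  assumes \<alpha>: "0 < \<alpha>" "\<alpha> < 1" and \<sigma>: "0 < \<sigma>" and tr: "t \<noteq> r"
  defines "H \<equiv> \<lambda>q t. if \<sigma> < fst q \<and> snd q < t then
     sqrt (2 * fst q * ((fst q - \<sigma>) powr (- \<alpha>) / (Gamma \<alpha> * Gamma (1 - \<alpha>)))) * exp (- (fst q * (t - snd q))) else 0"
  shows "(\<integral>\<^sup>+q. ennreal (H q t * H q r) \<partial>(lborel :: (real \<times> real) measure))
    = ennreal (exp (- (\<sigma> * \<bar>t - r\<bar>)) * beta_k \<alpha> \<bar>t - r\<bar>)"
proof -
  define c where "c = 1 / (Gamma \<alpha> * Gamma (1 - \<alpha>))"
  have c: "0 < c" using \<alpha> by (simp add: c_def Gamma_real_pos)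
  have [measurable]: "(\<lambda>q. H q s) \<in> borel_measurable (borel \<Otimes>\<^sub>M borel)" for s unfolding H_def by measurable
  have "(\<integral>\<^sup>+q. ennreal (H q t * H q r) \<partial>(lborel :: (real \<times> real) measure)) =
      (\<integral>\<^sup>+p. \<integral>\<^sup>+\<xi>. ennreal (H (p, \<xi>) t * H (p, \<xi>) r) \<partial>lborel \<partial>lborel)"
    unfolding lborel_prod[symmetric] by (subst lborel.nn_integral_fst[symmetric]) auto
  also have "\<dots> = (\<integral>\<^sup>+p. ennreal c * ennreal (if \<sigma> < p then (p - \<sigma>) powr (- \<alpha>) * exp (- (p * \<bar>t - r\<bar>)) else 0) \<partial>lborel)"
  proof (intro nn_integral_cong)
    fix p :: real
    show "(\<integral>\<^sup>+\<xi>. ennreal (H (p, \<xi>) t * H (p, \<xi>) r) \<partial>lborel) =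
      ennreal c * ennreal (if \<sigma> < p then (p - \<sigma>) powr (- \<alpha>) * exp (- (p * \<bar>t - r\<bar>)) else 0)"
    proof (cases "\<sigma> < p")
      case True
      define d where "d = c * (p - \<sigma>) powr (- \<alpha>)"
      have d: "0 \<le> d" using c by (simp add: d_def)
      have p: "0 < p" using True \<sigma> by simp
      have s: "sqrt (2 * p * ((p - \<sigma>) powr (- \<alpha>) / (Gamma \<alpha> * Gamma (1 - \<alpha>)))) = sqrt (2 * p * d)"
        by (simp add: d_def c_def)
      have "(\<integral>\<^sup>+\<xi>. ennreal (H (p, \<xi>) t * H (p, \<xi>) r) \<partial>lborel) =
        (\<integral>\<^sup>+\<xi>. ennreal d * ennreal (if \<xi> < t \<and> \<xi> < r then 2 * p * (exp (- (p * (t - \<xi>))) * exp (- (p * (r - \<xi>)))) else 0) \<partial>lborel)"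
      proof (intro nn_integral_cong)
        fix \<xi> :: real
        have h: "H (p, \<xi>) x = (if \<xi> < x then sqrt (2 * p * d) * exp (- (p * (x - \<xi>))) else 0)" for x
          unfolding H_def fst_conv snd_conv s using True by simp
        have q: "sqrt (2 * p * d) * sqrt (2 * p * d) = 2 * p * d" using p d by simp
        have "sqrt (2 * p * d) * x * (sqrt (2 * p * d) * y) = d * (2 * p * (x * y))" for x y
          using arg_cong[OF q, of "\<lambda>u. u * (x * y)"] by (simp only: mult_ac)
        then have "H (p, \<xi>) t * H (p, \<xi>) r = d * (if \<xi> < t \<and> \<xi> < r then 2 * p * (exp (- (p * (t - \<xi>))) * exp (- (p * (r - \<xi>)))) else 0)"
          unfolding h by (cases "\<xi> < t"; cases "\<xi> < r"; simp only: if_True if_False simp_thms mult_zero_left mult_zero_right)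
        then show "ennreal (H (p, \<xi>) t * H (p, \<xi>) r) = ennreal d * ennreal (if \<xi> < t \<and> \<xi> < r then 2 * p * (exp (- (p * (t - \<xi>))) * exp (- (p * (r - \<xi>)))) else 0)"
          using p d by (simp add: ennreal_mult)
      qed
      also have "\<dots> = ennreal d * ennreal (exp (- (p * \<bar>t - r\<bar>)))"
        by (subst nn_integral_cmult) (auto simp: exp_feature[OF p])
      finally show ?thesis using True c by (simp add: d_def ennreal_mult[symmetric] mult.assoc)
    qed (simp add: H_def)
  qed
  also have "\<dots> = ennreal c * ennreal (Gamma (1 - \<alpha>) * \<bar>t - r\<bar> powr (\<alpha> - 1) * exp (- (\<sigma> * \<bar>t - r\<bar>)))"
    using powr_feature[of "\<bar>t - r\<bar>" \<alpha> \<sigma>] tr \<alpha> by (subst nn_integral_cmult) auto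
  also have "\<dots> = ennreal (exp (- (\<sigma> * \<bar>t - r\<bar>)) * beta_k \<alpha> \<bar>t - r\<bar>)"
  proof -
    have g: "Gamma (1 - \<alpha>) > 0" using \<alpha> by (simp add: Gamma_real_pos)
    have "c * (Gamma (1 - \<alpha>) * \<bar>t - r\<bar> powr (\<alpha> - 1) * exp (- (\<sigma> * \<bar>t - r\<bar>))) = exp (- (\<sigma> * \<bar>t - r\<bar>)) * beta_k \<alpha> \<bar>t - r\<bar>"
      using tr g by (simp add: c_def beta_k_def mult.commute)
    moreover have "ennreal (c * (Gamma (1 - \<alpha>) * \<bar>t - r\<bar> powr (\<alpha> - 1) * exp (- (\<sigma> * \<bar>t - r\<bar>)))) =
      ennreal c * ennreal (Gamma (1 - \<alpha>) * \<bar>t - r\<bar> powr (\<alpha> - 1) * exp (- (\<sigma> * \<bar>t - r\<bar>)))"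
      using c g by (intro ennreal_mult) simp_all
    ultimately show ?thesis by metis
  qed
  finally show ?thesis .
qed

text \<open>The causal form integrates over \<open>r \<le> t\<close> only. By symmetry it is half of
  the form of the even kernel \<open>k \<bar>t - r\<bar>\<close> on the whole square, and that one
  is a superposition of squares.\<close>

lemma weighted_beta_k_positive:
  assumes \<alpha>: "0 < \<alpha>" "\<alpha> < 1" and \<sigma>: "0 < \<sigma>" and w: "l2 (lbon {0..T}) w"
  shows "0 \<le> (LINT t|lbon {0..T}. w t * cv (\<lambda>s. exp (- (\<sigma> * s)) * beta_k \<alpha> s) w t)"
proof -
  let ?M = "lbon {0..T}"
  have [measurable]: "w \<in> borel_measurable borel" using w by (auto simp: l2_def)
  define k where "k s = exp (- (\<sigma> * s)) * beta_k \<alpha> s" for s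
  have [measurable]: "k \<in> borel_measurable borel" unfolding k_def[abs_def] by measurable
  have k0: "0 \<le> k s" for s using beta_k_nonneg[OF \<alpha>(1)] by (simp add: k_def)
  have kz: "k 0 = 0" by (simp add: k_def beta_k_def)
  have ki: "integrable ?M k" unfolding k_def by (intro integrable_exp_weight beta_k_integrable \<alpha>) (use \<sigma> in simp)
  define v where "v t = indicator {0..T} t * w t" for t
  have [measurable]: "v \<in> borel_measurable borel" unfolding v_def[abs_def] by measurable
  let ?g = "\<lambda>t r. k \<bar>t - r\<bar> * (v t * v r)"
  let ?n = "\<lambda>t r. ennreal (k \<bar>t - r\<bar> * (\<bar>v t\<bar> * \<bar>v r\<bar>))"
  define A where "A = (\<integral>\<^sup>+t. \<integral>\<^sup>+r. (if r \<le> t then ?n t r else 0) \<partial>lborel \<partial>lborel)"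
  have "A = (\<integral>\<^sup>+t. ennreal \<bar>w t\<bar> * cvn (\<lambda>s. ennreal \<bar>k s\<bar>) (\<lambda>s. ennreal \<bar>w s\<bar>) t \<partial>?M)"
    unfolding A_def
  proof (subst nn_integral_lbon)
    show "(\<integral>\<^sup>+t. \<integral>\<^sup>+r. (if r \<le> t then ?n t r else 0) \<partial>lborel \<partial>lborel) =
      (\<integral>\<^sup>+t. indicator {0..T} t * (ennreal \<bar>w t\<bar> * cvn (\<lambda>s. ennreal \<bar>k s\<bar>) (\<lambda>s. ennreal \<bar>w s\<bar>) t) \<partial>lborel)"
    proof (intro nn_integral_cong)
      fix t
      show "(\<integral>\<^sup>+r. (if r \<le> t then ?n t r else 0) \<partial>lborel) = indicator {0..T} t * (ennreal \<bar>w t\<bar> * cvn (\<lambda>s. ennreal \<bar>k s\<bar>) (\<lambda>s. ennreal \<bar>w s\<bar>) t)"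
        unfolding cvn_def
        by (subst nn_integral_cmult[symmetric], measurable, subst nn_integral_cmult[symmetric], measurable, intro nn_integral_cong)
          (auto simp: v_def indicator_def ennreal_mult[symmetric] k0 mult_ac)
    qed
  qed auto
  \<comment> \<open>Cauchy-Schwarz in \<open>t\<close> and Young's inequality for the convolution
    make the absolute form finite on this half of the square.\<close>
  also have "\<dots> < \<infinity>"
  proof -
    let ?c = "cvn (\<lambda>s. ennreal \<bar>k s\<bar>) (\<lambda>s. ennreal \<bar>w s\<bar>)"
    have w2: "(\<integral>\<^sup>+t. (ennreal \<bar>w t\<bar>)\<^sup>2 \<partial>?M) < \<infinity>" using nn_integral_l2[OF w] by (simp add: ennreal_power)
    have "(\<integral>\<^sup>+t. ennreal \<bar>w t\<bar> * ?c t \<partial>?M)\<^sup>2 \<le> (\<integral>\<^sup>+t. (ennreal \<bar>w t\<bar>)\<^sup>2 \<partial>?M) * (\<integral>\<^sup>+t. (?c t)\<^sup>2 \<partial>?M)"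
      by (rule Cauchy_Schwarz_nn_integral) auto
    also have "\<dots> \<le> (\<integral>\<^sup>+t. (ennreal \<bar>w t\<bar>)\<^sup>2 \<partial>?M) * ((\<integral>\<^sup>+t. ennreal \<bar>k t\<bar> \<partial>?M)\<^sup>2 * (\<integral>\<^sup>+t. (ennreal \<bar>w t\<bar>)\<^sup>2 \<partial>?M))"
      by (intro mult_left_mono nn_integral_cvn_sq_le) auto
    also have "\<dots> < \<infinity>" using w2 unfolding nn_integral_abs_eq[OF ki] by (simp add: ennreal_mult_less_top power2_eq_square)
    finally show ?thesis by (simp add: power2_eq_square ennreal_mult_less_top less_top[symmetric] ennreal_mult_eq_top_iff)
  qed
  finally have A: "A < \<infinity>" .
  \<comment> \<open>The square is covered by the half \<open>r \<le> t\<close> and its mirror image,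
    which contributes the same amount \<open>A\<close>.\<close>
  have "(\<integral>\<^sup>+t. \<integral>\<^sup>+r. ?n t r \<partial>lborel \<partial>lborel) \<le>
     (\<integral>\<^sup>+t. (\<integral>\<^sup>+r. (if r \<le> t then ?n t r else 0) \<partial>lborel) + (\<integral>\<^sup>+r. (if t \<le> r then ?n t r else 0) \<partial>lborel) \<partial>lborel)"
    by (intro nn_integral_mono, subst nn_integral_add[symmetric]) (auto intro!: nn_integral_mono)
  also have "\<dots> = A + (\<integral>\<^sup>+t. \<integral>\<^sup>+r. (if t \<le> r then ?n t r else 0) \<partial>lborel \<partial>lborel)"
    unfolding A_def by (rule nn_integral_add) measurable
  also have "(\<integral>\<^sup>+t. \<integral>\<^sup>+r. (if t \<le> r then ?n t r else 0) \<partial>lborel \<partial>lborel) = (\<integral>\<^sup>+r. \<integral>\<^sup>+t. (if t \<le> r then ?n t r else 0) \<partial>lborel \<partial>lborel)"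
    by (rule lborel_pair.Fubini'[symmetric]) measurable
  also have "\<dots> = A" unfolding A_def by (intro nn_integral_cong) (auto simp: abs_minus_commute mult.commute)
  finally have fin: "(\<integral>\<^sup>+t. \<integral>\<^sup>+r. ?n t r \<partial>lborel \<partial>lborel) < \<infinity>" using A by (auto intro: le_less_trans)
  let ?H = "\<lambda>q t. if \<sigma> < fst q \<and> snd q < t then
     sqrt (2 * fst q * ((fst q - \<sigma>) powr (- \<alpha>) / (Gamma \<alpha> * Gamma (1 - \<alpha>)))) * exp (- (fst q * (t - snd q))) else (0::real)"
  have Hm: "(\<lambda>z. ?H (fst z) (snd z)) \<in> borel_measurable (borel \<Otimes>\<^sub>M borel)"
    unfolding borel_prod[symmetric] by measurable
  have H0: "0 \<le> ?H q t" for q t using \<alpha> \<sigma> by (auto simp: Gamma_real_pos less_imp_le)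
  have HG: "(\<integral>\<^sup>+q. ennreal (?H q t * ?H q r) \<partial>lborel) = ennreal (k \<bar>t - r\<bar>)" if "t \<noteq> r" for t r
    unfolding k_def by (rule beta_k_feature[OF \<alpha> \<sigma> that])
  have Gm: "(\<lambda>z. k \<bar>fst z - snd z\<bar>) \<in> borel_measurable (borel \<Otimes>\<^sub>M borel)" by measurable
  have vm: "v \<in> borel_measurable borel" by measurable
  note ff = feature_form_nonneg[where H="?H", OF Hm vm Gm H0 k0 HG fin]
  \<comment> \<open>The diagonal is counted in one half only; the halves are nevertheless exact
    mirror images, because \<open>k 0 = 0\<close>.\<close>
  let ?lo = "\<lambda>t r. if r \<le> t then ?g t r else 0" and ?up = "\<lambda>t r. if t < r then ?g t r else 0"
  have lo: "integrable (lborel \<Otimes>\<^sub>M lborel) (\<lambda>z. ?lo (fst z) (snd z))"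
    and up: "integrable (lborel \<Otimes>\<^sub>M lborel) (\<lambda>z. ?up (fst z) (snd z))"
    by (rule Bochner_Integration.integrable_bound[OF ff(1)]; auto)+
  have "(LINT z|(lborel \<Otimes>\<^sub>M lborel). ?g (fst z) (snd z)) =
     (LINT z|(lborel \<Otimes>\<^sub>M lborel). ?lo (fst z) (snd z) + ?up (fst z) (snd z))"
    by (intro Bochner_Integration.integral_cong) auto
  also have "\<dots> = (LINT z|(lborel \<Otimes>\<^sub>M lborel). ?lo (fst z) (snd z)) + (LINT z|(lborel \<Otimes>\<^sub>M lborel). ?up (fst z) (snd z))"
    by (rule Bochner_Integration.integral_add[OF lo up])
  also have "(LINT z|(lborel \<Otimes>\<^sub>M lborel). ?up (fst z) (snd z)) = (LINT r|lborel. LINT t|lborel. ?up t r)"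
    using lborel_pair.integral_snd[of "?up"] up by (simp add: case_prod_unfold)
  also have "\<dots> = (LINT r|lborel. LINT t|lborel. ?lo r t)"
  proof (intro Bochner_Integration.integral_cong refl)
    fix r t
    show "?up t r = ?lo r t" by (cases "t = r") (auto simp: abs_minus_commute kz)
  qed
  also have "(LINT z|(lborel \<Otimes>\<^sub>M lborel). ?lo (fst z) (snd z)) = (LINT t|lborel. LINT r|lborel. ?lo t r)"
    using lborel_pair.integral_fst'[OF lo, symmetric] unfolding fst_conv snd_conv .
  finally have "0 \<le> (LINT t|lborel. LINT r|lborel. ?lo t r)" using ff(2) by simp
  also have "\<dots> = (LINT t|lborel. indicator {0..T} t * (w t * cv k w t))"
  proof (intro Bochner_Integration.integral_cong refl)
    fix t
    have "(LINT r|lborel. ?lo t r) = (LINT r|lborel. v t * (if 0 \<le> r \<and> r \<le> t then k (t - r) * w r else 0))"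
      by (intro Bochner_Integration.integral_cong) (auto simp: v_def indicator_def)
    then show "(LINT r|lborel. ?lo t r) = indicator {0..T} t * (w t * cv k w t)"
      by (simp add: cv_def v_def mult.assoc)
  qed
  also have "\<dots> = (LINT t|?M. w t * cv k w t)" by (subst integral_lbon) auto
  also have "k = (\<lambda>s. exp (- (\<sigma> * s)) * beta_k \<alpha> s)" by (simp add: k_def fun_eq_iff)
  finally show ?thesis .
qed

text \<open>The bound is uniform in \<open>\<mu>\<close>: in a weighted norm, positivity of the Abel kernel gives
  \<open>\<parallel>w\<parallel>\<^sup>2 + \<parallel>z\<parallel>\<^sup>2 \<le> \<parallel>w + z\<parallel>\<^sup>2\<close> for \<open>z = \<mu> \<beta> * w\<close>, and \<open>m * z\<close> is a small perturbation.\<close>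
lemma mode_solvable:
  assumes \<alpha>: "0 < \<alpha>" "\<alpha> < 1" and m: "integrable (lbon {0..T}) (m :: real \<Rightarrow> real)"
  obtains C where "C > 0" "\<And>\<mu> f. 0 \<le> \<mu> \<Longrightarrow> l2 (lbon {0..T}) f \<Longrightarrow>
     \<exists>w. l2 (lbon {0..T}) w \<and>
      (AE t in lbon {0..T}. w t + \<mu> * cv (beta_k \<alpha>) w t + cv m (\<lambda>t. \<mu> * cv (beta_k \<alpha>) w t) t = f t) \<and>
      n2 (lbon {0..T}) w \<le> C * n2 (lbon {0..T}) f \<and> n2 (lbon {0..T}) (\<lambda>t. \<mu> * cv (beta_k \<alpha>) w t) \<le> C * n2 (lbon {0..T}) f"
proof -
  let ?M = "lbon {0..T}"
  let ?b = "beta_k \<alpha>"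
  have bi: "integrable ?M ?b" by (rule beta_k_integrable[OF \<alpha>(1)])
  \<comment> \<open>The weight is chosen from \<open>m\<close> alone, before \<open>\<mu>\<close>
    and \<open>f\<close> appear. The threshold 1/2 makes the estimate close:
    \<open>n2 g \<le> n2 f + 1/2 * n2 z\<close> and \<open>n2 z \<le> n2 g\<close>, with
    \<open>z\<close> weighted, give \<open>n2 g \<le> 2 * n2 f\<close>.\<close>
  obtain \<sigma> :: real where \<sigma>: "\<sigma> > 0" "(LINT s|?M. \<bar>exp (- (\<sigma> * s)) * m s\<bar>) < 1/2"
    using exp_weight_small[OF m, of "1/2"] by auto
  let ?e = "\<lambda>g s. exp (- (\<sigma> * s)) * g s"
  have mi: "integrable ?M (?e m)" by (rule integrable_exp_weight[OF m]) (use \<sigma> in simp)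
  have ebi: "integrable ?M (?e ?b)" by (rule integrable_exp_weight[OF bi]) (use \<sigma> in simp)
  have [measurable]: "m \<in> borel_measurable borel" using m by auto
  \<comment> \<open>The 2 comes from the absorption, the exponential from removing the weight on
    \<open>{0..T}\<close>.\<close>
  define C where "C = 2 * exp (\<sigma> * \<bar>T\<bar>)"
  have "\<exists>w. l2 ?M w \<and> (AE t in ?M. w t + \<mu> * cv ?b w t + cv m (\<lambda>t. \<mu> * cv ?b w t) t = f t) \<and>
      n2 ?M w \<le> C * n2 ?M f \<and> n2 ?M (\<lambda>t. \<mu> * cv ?b w t) \<le> C * n2 ?M f"
    if mu: "0 \<le> \<mu>" and f: "l2 ?M f" for \<mu> f
  proof -
    \<comment> \<open>For existence the whole memory is gathered into one kernel. This gives a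
      solution for each \<open>\<mu>\<close>; the uniform bound is an a priori estimate on that
      solution.\<close>
    define a where "a t = \<mu> * ?b t + \<mu> * cv m ?b t" for t
    have mbi: "integrable ?M (cv m ?b)" by (rule cv_integrable[OF m bi])
    have ai: "integrable ?M a" unfolding a_def[abs_def] using bi mbi by auto
    obtain w where w: "l2 ?M w" "AE t in ?M. w t + cv a w t = f t" by (rule volterra_exists[OF ai f])
    have wi: "integrable ?M w" by (rule l2_integrable1[OF w(1)])
    have [measurable]: "w \<in> borel_measurable borel" "f \<in> borel_measurable borel" using w f by (auto simp: l2_def)
    define z where "z t = \<mu> * cv ?b w t" for t
    have [measurable]: "z \<in> borel_measurable borel" unfolding z_def[abs_def] by measurable
    have zl: "l2 ?M z" unfolding z_def[abs_def] by (intro l2_cmult cv_l2 bi w)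
    have eq: "AE t in ?M. w t + z t + cv m z t = f t"
      using w(2) cv_assoc_AE[OF m bi wi] cv_section_integrable_AE[OF wi bi] cv_section_integrable_AE[OF wi mbi]
    proof eventually_elim
      case (elim t)
      have "cv a w t = cv w a t" by (rule cv_commute)
      also have "\<dots> = \<mu> * cv w ?b t + \<mu> * cv w (cv m ?b) t"
        unfolding a_def[abs_def] by (rule cv_lincomb[OF elim(3,4)])
      also have "\<dots> = z t + \<mu> * cv m (cv ?b w) t"
        using elim(2) by (simp add: z_def cv_commute[of w])
      also have "\<mu> * cv m (cv ?b w) t = cv m z t" unfolding z_def[abs_def] by (rule cv_cmult_right[symmetric])
      finally show ?case using elim(1) by simp
    qed
    have el2: "l2 ?M (?e g)" "n2 ?M (?e g) \<le> n2 ?M g" if "l2 ?M g" for g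
      using l2_bounded_mult[OF _ that, of "\<lambda>s. exp (- (\<sigma> * s))" 1] \<sigma> by auto
    have ze: "?e z = (\<lambda>t. \<mu> * cv (?e ?b) (?e w) t)"
      unfolding z_def[abs_def] by (rule ext, unfold cv_exp[symmetric], rule mult.left_commute)
    define g where "g t = ?e f t - cv (?e m) (?e z) t" for t
    have [measurable]: "g \<in> borel_measurable borel" unfolding g_def[abs_def] by measurable
    have cl: "l2 ?M (cv (?e m) (?e z))" "n2 ?M (cv (?e m) (?e z)) \<le> 1/2 * n2 ?M (?e z)"
    proof -
      show "l2 ?M (cv (?e m) (?e z))" by (rule cv_l2(1)[OF mi el2(1)[OF zl]])
      have "n2 ?M (cv (?e m) (?e z)) \<le> (LINT s|?M. \<bar>?e m s\<bar>) * n2 ?M (?e z)" by (rule cv_l2(2)[OF mi el2(1)[OF zl]])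
      also have "\<dots> \<le> 1/2 * n2 ?M (?e z)" using \<sigma>(2) by (intro mult_right_mono) auto
      finally show "n2 ?M (cv (?e m) (?e z)) \<le> 1/2 * n2 ?M (?e z)" .
    qed
    have gl: "l2 ?M g" unfolding g_def[abs_def] by (intro l2_diff cl el2 f)
    have geq: "AE t in ?M. ?e w t + ?e z t = g t"
      using eq
    proof eventually_elim
      case (elim t)
      have "?e w t + ?e z t + exp (- (\<sigma> * t)) * cv m z t = ?e f t" using elim by (simp flip: distrib_left)
      then show ?case unfolding cv_exp g_def by simp
    qed
    have pos: "0 \<le> (LINT t|?M. ?e w t * ?e z t)"
    proof -
      have "(LINT t|?M. ?e w t * ?e z t) = (LINT t|?M. \<mu> * (?e w t * cv (?e ?b) (?e w) t))"
        by (intro Bochner_Integration.integral_cong refl, unfold fun_cong[OF ze], rule mult.left_commute)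
      also have "\<dots> = \<mu> * (LINT t|?M. ?e w t * cv (?e ?b) (?e w) t)" by simp
      also have "0 \<le> \<dots>"
        by (intro mult_nonneg_nonneg mu weighted_beta_k_positive[OF \<alpha> \<sigma>(1) el2(1)[OF w(1)]])
      finally show ?thesis .
    qed
    have "(n2 ?M g)\<^sup>2 = (n2 ?M (\<lambda>t. ?e w t + ?e z t))\<^sup>2"
      by (rule arg_cong[where f="\<lambda>x. x\<^sup>2"], rule n2_cong_AE) (use geq in auto)
    also have "\<dots> = (LINT t|?M. (?e w t)\<^sup>2 + 2 * (?e w t * ?e z t) + (?e z t)\<^sup>2)"
      unfolding n2_sq by (simp add: power2_eq_square algebra_simps)
    also have "\<dots> = (n2 ?M (?e w))\<^sup>2 + 2 * (LINT t|?M. ?e w t * ?e z t) + (n2 ?M (?e z))\<^sup>2"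
      using l2_integrable[OF el2(1)[OF w(1)]] l2_integrable[OF el2(1)[OF zl]] l2_mult_integrable[OF el2(1)[OF w(1)] el2(1)[OF zl]]
      unfolding n2_sq by (subst Bochner_Integration.integral_add, simp, simp)+ simp
    finally have en: "(n2 ?M (?e w))\<^sup>2 + (n2 ?M (?e z))\<^sup>2 \<le> (n2 ?M g)\<^sup>2" using pos by simp
    have wg: "n2 ?M (?e w) \<le> n2 ?M g" by (rule power2_le_imp_le[OF order_trans[OF _ en]]) simp_all
    have zg: "n2 ?M (?e z) \<le> n2 ?M g" by (rule power2_le_imp_le[OF order_trans[OF _ en]]) simp_all
    have "n2 ?M g \<le> n2 ?M (?e f) + n2 ?M (\<lambda>t. - cv (?e m) (?e z) t)"
      unfolding g_def[abs_def] using n2_triangle[OF el2(1)[OF f] l2_minus[OF cl(1)]] by simp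
    also have "\<dots> \<le> n2 ?M f + 1/2 * n2 ?M (?e z)"
      unfolding n2_minus by (intro add_mono el2 f cl)
    finally have g2: "n2 ?M g \<le> 2 * n2 ?M f" using zg by simp
    have unweight: "n2 ?M h \<le> C * n2 ?M f" if h: "l2 ?M h" "n2 ?M (?e h) \<le> n2 ?M g" for h
    proof -
      have "n2 ?M (\<lambda>t. exp (\<sigma> * t) * ?e h t) \<le> exp (\<sigma> * \<bar>T\<bar>) * n2 ?M (?e h)"
        by (rule l2_bounded_mult(2)[OF _ el2(1)[OF h(1)]]) (use \<sigma> in auto)
      also have "\<dots> \<le> exp (\<sigma> * \<bar>T\<bar>) * (2 * n2 ?M f)" using h(2) g2 by (intro mult_left_mono) auto
      also have "(\<lambda>t. exp (\<sigma> * t) * ?e h t) = h" by (simp add: mult.assoc[symmetric] exp_add[symmetric])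
      finally show ?thesis by (simp add: C_def)
    qed
    show ?thesis using w(1) eq unweight[OF w(1) wg] unweight[OF zl zg] unfolding z_def[abs_def] by blast
  qed
  then show thesis by (intro that[of C]) (auto simp: C_def)
qed

section \<open>The variable-order kernel\<close>

lemma exp_minus_one_bound: "\<bar>exp x - 1\<bar> \<le> \<bar>x\<bar> * exp \<bar>x\<bar>" for x :: real
proof (cases "0 \<le> x")
  case True
  have "1 - x \<le> exp (- x)" using exp_ge_add_one_self[of "- x"] by simp
  then have "exp x * (1 - x) \<le> exp x * exp (- x)" by (intro mult_left_mono) auto
  then show ?thesis using True by (simp add: exp_add[symmetric] algebra_simps)
next
  case False
  have "1 + x \<le> exp x" by (rule exp_ge_add_one_self)
  moreover have "exp x \<le> 1" using False by simp
  ultimately have "\<bar>exp x - 1\<bar> \<le> \<bar>x\<bar> * 1" using False by linarith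
  also have "\<dots> \<le> \<bar>x\<bar> * exp \<bar>x\<bar>" by (intro mult_left_mono) auto
  finally show ?thesis .
qed

text \<open>A logarithm costs an arbitrarily small power of \<open>t\<close>. Beyond 1 the natural
  bound is \<open>t powr \<epsilon>\<close>; on a bounded interval the factor
  \<open>T powr (2 * \<epsilon>)\<close> exchanges it for \<open>t powr (- \<epsilon>)\<close>, so
  that one expression serves everywhere.\<close>

lemma abs_ln_powr_bound:
  assumes "0 < (t::real)" "t \<le> T" "0 < \<epsilon>"
  shows "\<bar>ln t\<bar> + 1 \<le> (1/\<epsilon> + 1) * (1 + T powr (2 * \<epsilon>)) * t powr (- \<epsilon>)"
proof -
  have b: "\<bar>ln t\<bar> + 1 \<le> (1/\<epsilon> + 1) * (t powr (- \<epsilon>) + t powr \<epsilon>)"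
  proof (cases "1 \<le> t")
    case True
    have "ln t \<le> t powr \<epsilon> / \<epsilon>" using ln_powr_bound[OF True assms(3)] .
    moreover have "1 \<le> t powr \<epsilon>" using True assms by (simp add: ge_one_powr_ge_zero)
    moreover have "0 \<le> (1/\<epsilon> + 1) * t powr (- \<epsilon>)" using assms by (intro mult_nonneg_nonneg add_nonneg_nonneg) auto
    ultimately show ?thesis using True by (simp add: algebra_simps)
  next
    case False
    have "ln (1/t) \<le> (1/t) powr \<epsilon> / \<epsilon>" using False assms by (intro ln_powr_bound) auto
    moreover have e: "(1/t) powr \<epsilon> = t powr (- \<epsilon>)" using assms by (simp add: powr_divide powr_minus_divide)
    moreover have "1 \<le> (1/t) powr \<epsilon>" using False assms by (intro ge_one_powr_ge_zero) auto
    moreover have "0 \<le> (1/\<epsilon> + 1) * t powr \<epsilon>" using assms by (intro mult_nonneg_nonneg add_nonneg_nonneg) auto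
    moreover have "ln (1/t) = \<bar>ln t\<bar>" using False assms by (simp add: ln_div)
    ultimately show ?thesis by (simp add: algebra_simps)
  qed
  have "t powr \<epsilon> = t powr (2 * \<epsilon>) * t powr (- \<epsilon>)" by (simp add: powr_add[symmetric])
  also have "\<dots> \<le> T powr (2 * \<epsilon>) * t powr (- \<epsilon>)" using assms by (intro mult_right_mono powr_mono2) auto
  finally have "t powr (- \<epsilon>) + t powr \<epsilon> \<le> (1 + T powr (2 * \<epsilon>)) * t powr (- \<epsilon>)" by (simp add: algebra_simps)
  then have "(1/\<epsilon> + 1) * (t powr (- \<epsilon>) + t powr \<epsilon>) \<le> (1/\<epsilon> + 1) * ((1 + T powr (2 * \<epsilon>)) * t powr (- \<epsilon>))"
    using assms by (intro mult_left_mono) auto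
  with b show ?thesis by (simp only: mult.assoc)
qed

lemma t_abs_ln_bound:
  assumes "0 < (t::real)" "t \<le> T" shows "t * \<bar>ln t\<bar> \<le> 1 + T\<^sup>2"
proof (cases "1 \<le> t")
  case True
  have "ln t \<le> t" using ln_le_minus_one[of t] assms by simp
  then have "t * \<bar>ln t\<bar> \<le> T * T" using True assms by (intro mult_mono) auto
  then show ?thesis by (simp add: power2_eq_square)
next
  case False
  have "ln (1/t) \<le> 1/t - 1" using assms by (intro ln_le_minus_one) auto
  then have "t * ln (1/t) \<le> t * (1/t)" using assms by (intro mult_left_mono) auto
  then have "t * \<bar>ln t\<bar> \<le> 1" using False assms by (simp add: ln_div)
  then show ?thesis by (smt (verit) zero_le_power2)
qed

text \<open>Up to the factor \<open>t powr (\<alpha> 0 - 1)\<close>, the difference of the two kernels is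
  \<open>O(t (1 + \<bar>ln t\<bar>))\<close>, because \<open>\<alpha>\<close> is Lipschitz.\<close>
lemma variable_order_kernel_split:
  fixes \<alpha> \<alpha>' :: "real \<Rightarrow> real"
  assumes T: "T > 0" and \<alpha>: "\<And>t. t \<in> {0..T} \<Longrightarrow> 0 < \<alpha> t \<and> \<alpha> t < 1"
    and d\<alpha>: "\<And>t. t \<in> {0..T} \<Longrightarrow> (\<alpha> has_real_derivative \<alpha>' t) (at t within {0..T}) \<and> \<bar>\<alpha>' t\<bar> \<le> Q"
  obtains p where "integrable (lbon {0..T}) p"
    "\<And>t. t \<in> {0..T} \<Longrightarrow> t powr (\<alpha> t - 1) / Gamma (\<alpha> t) = beta_k (\<alpha> 0) t + cv (\<lambda>_. 1) p t"
proof -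
  define a where "a = \<alpha> 0"
  have a: "0 < a" "a < 1" using \<alpha>[of 0] T by (auto simp: a_def)
  have Q: "0 \<le> Q" using d\<alpha>[of 0] T by (auto intro: order_trans[of 0 "\<bar>\<alpha>' 0\<bar>"])
  have npi: "\<alpha> t \<notin> \<int>\<^sub>\<le>\<^sub>0" if "t \<in> {0..T}" for t using \<alpha>[OF that] by (auto elim!: nonpos_Ints_cases)
  have cont: "continuous_on {0..T} \<alpha>"
    using d\<alpha> by (intro DERIV_continuous_on) blast
  \<comment> \<open>The reciprocal Gamma function is smooth, with derivative
    \<open>- rGamma * Digamma\<close> away from the poles of Gamma, so composition with
    \<open>\<alpha>\<close> inherits the Lipschitz bound.\<close>
  define r where "r t = rGamma (\<alpha> t)" for t
  define r' where "r' t = - rGamma (\<alpha> t) * Digamma (\<alpha> t)" for t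
  have "continuous_on {0..T} r" unfolding r_def[abs_def]
    by (rule continuous_on_compose2[OF continuous_on_rGamma[of UNIV] cont]) auto
  then have "bounded (r ` {0..T})" by (intro compact_imp_bounded compact_continuous_image) auto
  then obtain R where R: "\<And>t. t \<in> {0..T} \<Longrightarrow> \<bar>r t\<bar> \<le> R" unfolding bounded_iff by (metis imageI real_norm_def)
  have "continuous_on {0..T} (\<lambda>t. Digamma (\<alpha> t))"
    by (rule continuous_on_compose2[OF continuous_on_Polygamma[of "\<alpha> ` {0..T}"] cont]) (use npi in auto)
  with \<open>continuous_on {0..T} r\<close> have "continuous_on {0..T} r'" unfolding r'_def[abs_def] r_def[abs_def]
    by (intro continuous_intros)
  then have "bounded (r' ` {0..T})" by (intro compact_imp_bounded compact_continuous_image) auto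
  then obtain D where D: "\<And>t. t \<in> {0..T} \<Longrightarrow> \<bar>r' t\<bar> \<le> D" unfolding bounded_iff by (metis imageI real_norm_def)
  have R0: "0 \<le> R" using R[of 0] T by auto
  have D0: "0 \<le> D" using D[of 0] T by auto
  have der: "(\<alpha> has_real_derivative \<alpha>' t) (at t)" if "0 < t" "t < T" for t
    using d\<alpha>[of t] that at_within_Icc_at[of 0 t T] by auto
  have derr: "(r has_real_derivative r' t * \<alpha>' t) (at t within {0..T})" if "t \<in> {0..T}" for t
  proof -
    have "(rGamma has_field_derivative r' t) (at (\<alpha> t))" unfolding r'_def
      by (rule has_field_derivative_rGamma_no_nonpos_int[OF npi[OF that]])
    from DERIV_chain2[OF this conjunct1[OF d\<alpha>[OF that]]] show ?thesis by (simp add: r_def[abs_def])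
  qed
  have lip: "\<bar>g t - g 0\<bar> \<le> B * t"
    if "\<And>x. x \<in> {0..T} \<Longrightarrow> (g has_real_derivative g' x) (at x within {0..T})" "\<And>x. x \<in> {0..T} \<Longrightarrow> \<bar>g' x\<bar> \<le> B" "t \<in> {0..T}"
    for g g' :: "real \<Rightarrow> real" and B t
    using field_differentiable_bound[of "{0..T}" g g' B t 0] that T by auto
  have \<alpha>lip: "\<bar>\<alpha> t - a\<bar> \<le> Q * t" if "t \<in> {0..T}" for t
    unfolding a_def by (rule lip[OF _ _ that, of \<alpha> \<alpha>']) (use d\<alpha> in auto)
  have rlip: "\<bar>r t - r 0\<bar> \<le> D * Q * t" if "t \<in> {0..T}" for t
    by (rule lip[OF _ _ that, of r "\<lambda>t. r' t * \<alpha>' t"]) (use derr D d\<alpha> D0 in \<open>auto simp: abs_mult intro!: mult_mono\<close>)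
  \<comment> \<open>For \<open>t > 0\<close> the variable-order kernel is
    \<open>t powr (a - 1) * E t\<close>. Thus \<open>K\<close> is its difference from the Abel
    kernel of order \<open>a\<close>, and \<open>e\<close> and \<open>p\<close> are the derivatives
    of \<open>E\<close> and \<open>K\<close>.\<close>
  define x where "x t = (\<alpha> t - a) * ln t" for t
  define E where "E t = exp (x t) * r t" for t
  define e where "e t = exp (x t) * (\<alpha>' t * ln t + (\<alpha> t - a) / t) * r t + exp (x t) * (r' t * \<alpha>' t)" for t
  define K where "K t = t powr (a - 1) * (E t - r 0)" for t
  define p where "p t = (a - 1) * t powr (a - 2) * (E t - r 0) + t powr (a - 1) * e t" for t
  \<comment> \<open>A bound for \<open>exp \<bar>x t\<bar>\<close>: the Lipschitz estimate gives
    \<open>\<bar>x t\<bar> \<le> Q * t * \<bar>ln t\<bar>\<close>, and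
    \<open>t * \<bar>ln t\<bar> \<le> 1 + T\<^sup>2\<close>.\<close>
  define X where "X = exp (Q * (1 + T\<^sup>2))"
  have X0: "0 < X" by (simp add: X_def)
  have xb: "\<bar>x t\<bar> \<le> Q * t * \<bar>ln t\<bar>" "exp \<bar>x t\<bar> \<le> X" if "0 < t" "t \<le> T" for t
  proof -
    show 1: "\<bar>x t\<bar> \<le> Q * t * \<bar>ln t\<bar>" unfolding x_def abs_mult
      by (intro mult_right_mono \<alpha>lip) (use that in auto)
    also have "\<dots> = Q * (t * \<bar>ln t\<bar>)" by simp
    also have "\<dots> \<le> Q * (1 + T\<^sup>2)" by (intro mult_left_mono t_abs_ln_bound that Q)
    finally show "exp \<bar>x t\<bar> \<le> X" by (simp add: X_def)
  qed
  have exb: "exp (x t) \<le> X" if "0 < t" "t \<le> T" for t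
    using xb(2)[OF that] by (rule order_trans[rotated]) simp
  define C1 where "C1 = Q * X * R + D * Q"
  have C1: "0 \<le> C1" using Q X0 R0 D0 by (simp add: C1_def)
  have Eb: "\<bar>E t - r 0\<bar> \<le> C1 * (t * (\<bar>ln t\<bar> + 1))" if t: "0 < t" "t \<le> T" for t
  proof -
    have "E t - r 0 = (exp (x t) - 1) * r t + (r t - r 0)" by (simp add: E_def algebra_simps)
    then have "\<bar>E t - r 0\<bar> \<le> \<bar>exp (x t) - 1\<bar> * \<bar>r t\<bar> + \<bar>r t - r 0\<bar>" using abs_triangle_ineq by (simp add: abs_mult[symmetric])
    also have "\<bar>exp (x t) - 1\<bar> \<le> \<bar>x t\<bar> * exp \<bar>x t\<bar>" by (rule exp_minus_one_bound)
    also have "\<dots> \<le> Q * t * \<bar>ln t\<bar> * X" by (intro mult_mono xb t) (use Q t in auto)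
    finally have "\<bar>E t - r 0\<bar> \<le> Q * t * \<bar>ln t\<bar> * X * \<bar>r t\<bar> + \<bar>r t - r 0\<bar>" by (simp add: mult_right_mono)
    also have "\<dots> \<le> Q * t * \<bar>ln t\<bar> * X * R + D * Q * t"
      by (intro add_mono mult_left_mono R rlip) (use Q t X0 in auto)
    also have "\<dots> = (Q * X * R) * (t * \<bar>ln t\<bar>) + (D * Q) * t" by simp
    also have "\<dots> \<le> (Q * X * R) * (t * (\<bar>ln t\<bar> + 1)) + (D * Q) * (t * (\<bar>ln t\<bar> + 1))"
      by (intro add_mono mult_left_mono) (use Q X0 R0 D0 t in \<open>auto simp: algebra_simps\<close>)
    finally show ?thesis by (simp add: C1_def algebra_simps)
  qed
  define C2 where "C2 = X * Q * R + X * (D * Q)"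
  have C2: "0 \<le> C2" using Q X0 R0 D0 by (simp add: C2_def)
  have eb: "\<bar>e t\<bar> \<le> C2 * (\<bar>ln t\<bar> + 1)" if t: "0 < t" "t \<le> T" for t
  proof -
    have t': "t \<in> {0..T}" using t by auto
    have "\<bar>\<alpha>' t * ln t + (\<alpha> t - a) / t\<bar> \<le> \<bar>\<alpha>' t\<bar> * \<bar>ln t\<bar> + \<bar>\<alpha> t - a\<bar> / t"
      using abs_triangle_ineq[of "\<alpha>' t * ln t" "(\<alpha> t - a) / t"] t by (simp add: abs_mult)
    also have "\<dots> \<le> Q * \<bar>ln t\<bar> + Q"
      using d\<alpha>[OF t'] \<alpha>lip[OF t'] t by (intro add_mono mult_right_mono) (auto simp: divide_le_eq)
    finally have 1: "\<bar>\<alpha>' t * ln t + (\<alpha> t - a) / t\<bar> \<le> Q * (\<bar>ln t\<bar> + 1)" by (simp add: algebra_simps)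
    have "\<bar>e t\<bar> \<le> exp (x t) * \<bar>\<alpha>' t * ln t + (\<alpha> t - a) / t\<bar> * \<bar>r t\<bar> + exp (x t) * (\<bar>r' t\<bar> * \<bar>\<alpha>' t\<bar>)"
      unfolding e_def by (rule order_trans[OF abs_triangle_ineq]) (simp add: abs_mult)
    also have "\<dots> \<le> X * (Q * (\<bar>ln t\<bar> + 1)) * R + X * (D * Q)"
      by (intro add_mono mult_mono exb t R[OF t'] D[OF t'] 1 conjunct2[OF d\<alpha>[OF t']])
        (use Q X0 R0 D0 in \<open>auto intro!: mult_nonneg_nonneg\<close>)
    also have "\<dots> \<le> X * (Q * (\<bar>ln t\<bar> + 1)) * R + X * (D * Q) * (\<bar>ln t\<bar> + 1)"
      using Q X0 D0 by (intro add_left_mono) (auto simp: algebra_simps)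
    finally show ?thesis by (simp add: C2_def algebra_simps)
  qed
  \<comment> \<open>Half of the exponent pays for the logarithm: \<open>p\<close> is then of order
    \<open>t powr (a/2 - 1)\<close>, still integrable, and \<open>K\<close> of order
    \<open>t powr (a/2)\<close>, still vanishing at 0.\<close>
  define \<epsilon> where "\<epsilon> = a / 2"
  have \<epsilon>: "0 < \<epsilon>" using a by (simp add: \<epsilon>_def)
  define L where "L = (1/\<epsilon> + 1) * (1 + T powr (2 * \<epsilon>))"
  have L0: "0 \<le> L" using \<epsilon> by (simp add: L_def)
  have lb: "\<bar>ln t\<bar> + 1 \<le> L * t powr (- \<epsilon>)" if "0 < t" "t \<le> T" for t
    unfolding L_def by (rule abs_ln_powr_bound[OF that \<epsilon>])
  define C where "C = ((1 - a) * C1 + C2) * L"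
  have pb: "\<bar>p t\<bar> \<le> C * t powr (\<epsilon> - 1)" if t: "0 < t" "t \<le> T" for t
  proof -
    have "\<bar>p t\<bar> \<le> (1 - a) * t powr (a - 2) * \<bar>E t - r 0\<bar> + t powr (a - 1) * \<bar>e t\<bar>"
      unfolding p_def by (rule order_trans[OF abs_triangle_ineq]) (use a in \<open>simp add: abs_mult\<close>)
    also have "\<dots> \<le> (1 - a) * t powr (a - 2) * (C1 * (t * (\<bar>ln t\<bar> + 1))) + t powr (a - 1) * (C2 * (\<bar>ln t\<bar> + 1))"
      by (intro add_mono mult_left_mono Eb eb t) (use a in auto)
    also have "t powr (a - 1) = t powr (a - 2) * t"
      using t powr_add[of t "a - 2" 1] by (simp add: powr_one)
    also have "(1 - a) * t powr (a - 2) * (C1 * (t * (\<bar>ln t\<bar> + 1))) + t powr (a - 2) * t * (C2 * (\<bar>ln t\<bar> + 1))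
      = ((1 - a) * C1 + C2) * (t powr (a - 2) * t) * (\<bar>ln t\<bar> + 1)" by (simp add: algebra_simps)
    also have "t powr (a - 2) * t = t powr (a - 1)"
      using t powr_add[of t "a - 2" 1] by (simp add: powr_one)
    also have "((1 - a) * C1 + C2) * t powr (a - 1) * (\<bar>ln t\<bar> + 1) \<le> ((1 - a) * C1 + C2) * t powr (a - 1) * (L * t powr (- \<epsilon>))"
      by (intro mult_left_mono lb t) (use a C1 C2 in auto)
    also have "\<dots> = C * (t powr (a - 1) * t powr (- \<epsilon>))" by (simp add: C_def)
    also have "t powr (a - 1) * t powr (- \<epsilon>) = t powr (\<epsilon> - 1)" by (simp add: powr_add[symmetric] \<epsilon>_def field_simps)
    finally show ?thesis .
  qed
  have K0: "K 0 = 0" by (simp add: K_def)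
  have Kb: "\<bar>K t\<bar> \<le> C1 * L * t powr \<epsilon>" if t: "0 < t" "t \<le> T" for t
  proof -
    have "\<bar>K t\<bar> = t powr (a - 1) * \<bar>E t - r 0\<bar>" by (simp add: K_def abs_mult)
    also have "\<dots> \<le> t powr (a - 1) * (C1 * (t * (L * t powr (- \<epsilon>))))"
      by (intro mult_left_mono order_trans[OF Eb[OF t]] lb t C1) (use t in auto)
    also have "\<dots> = C1 * L * (t powr (a - 1) * t powr 1 * t powr (- \<epsilon>))" using t by simp
    also have "t powr (a - 1) * t powr 1 * t powr (- \<epsilon>) = t powr \<epsilon>" by (simp only: powr_add[symmetric]) (simp add: \<epsilon>_def field_simps)
    finally show ?thesis .
  qed
  have derK: "(K has_real_derivative p t) (at t)" if t: "0 < t" "t < T" for t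
  proof -
    have [derivative_intros]: "(r has_real_derivative r' t * \<alpha>' t) (at t)"
      using derr[of t] t at_within_Icc_at[of 0 t T] by auto
    note der[OF t, derivative_intros]
    have dx: "(x has_real_derivative \<alpha>' t * ln t + (\<alpha> t - a) / t) (at t)"
      unfolding x_def[abs_def] using t by (auto intro!: derivative_eq_intros simp: field_simps)
    note dx[derivative_intros]
    have dE: "(E has_real_derivative e t) (at t)"
      unfolding E_def[abs_def] e_def by (auto intro!: derivative_eq_intros simp: algebra_simps)
    have "((\<lambda>t. t powr (a - 1)) has_real_derivative (a - 1) * t powr (a - 1 - 1)) (at t)"
      using t(1) by (rule has_real_derivative_powr)
    from DERIV_mult[OF this DERIV_diff[OF dE DERIV_const[of "r 0"]]]
    show ?thesis unfolding K_def[abs_def] p_def by (simp add: algebra_simps)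
  qed
  \<comment> \<open>The derivative exists only in the interior, so the fundamental theorem of
    calculus is used in the form that asks for continuity of \<open>K\<close> up to the end points;
    at 0 this is the bound \<open>Kb\<close>.\<close>
  have contK: "continuous_on {0..T} K"
    unfolding continuous_on_eq_continuous_within
  proof
    fix t assume t: "t \<in> {0..T}"
    show "continuous (at t within {0..T}) K"
    proof (cases "t = 0")
      case True
      have "((\<lambda>t. C1 * L * t powr \<epsilon>) \<longlongrightarrow> C1 * L * 0 powr \<epsilon>) (at 0 within {0..T})"
        by (intro tendsto_intros) (use \<epsilon> in \<open>auto simp: eventually_at_filter\<close>)
      then have "((\<lambda>t. C1 * L * t powr \<epsilon>) \<longlongrightarrow> 0) (at 0 within {0..T})" by simp
      then have "(K \<longlongrightarrow> 0) (at 0 within {0..T})"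
        by (rule Lim_null_comparison[rotated]) (use Kb in \<open>auto simp: eventually_at_filter intro!: always_eventually\<close>)
      then show ?thesis using True K0 by (simp add: continuous_within)
    next
      case False
      have cr: "continuous (at t within {0..T}) r" "continuous (at t within {0..T}) \<alpha>"
        using \<open>continuous_on {0..T} r\<close> cont t by (auto simp: continuous_on_eq_continuous_within)
      show ?thesis unfolding K_def[abs_def] E_def x_def
        by (intro continuous_intros cr) (use False t in auto)
    qed
  qed
  have hi: "(p has_integral K t) {0..t}" if t: "t \<in> {0..T}" for t
  proof -
    have "(p has_integral K t - K 0) {0..t}"
    proof (rule fundamental_theorem_of_calculus_interior)
      show "continuous_on {0..t} K" by (rule continuous_on_subset[OF contK]) (use t in auto)
      show "(K has_vector_derivative p x) (at x)" if "x \<in> {0<..<t}" for x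
        using derK[of x] that t by (auto simp: has_real_derivative_iff_has_vector_derivative)
    qed (use t in auto)
    then show ?thesis by (simp add: K0)
  qed
  \<comment> \<open>Measurability of \<open>p\<close> cannot be read off its formula, since
    \<open>\<alpha>'\<close> is merely a pointwise derivative. It follows from gauge integrability
    \<open>hi\<close>, and the bound \<open>pb\<close> then gives absolute integrability.\<close>
  have pai: "p absolutely_integrable_on {0..T}"
  proof (rule measurable_bounded_by_integrable_imp_absolutely_integrable)
    show "p \<in> borel_measurable (lebesgue_on {0..T})"
      using hi[of T] T by (intro integrable_imp_measurable has_integral_integrable) auto
    show "(\<lambda>t. C * t powr (\<epsilon> - 1)) integrable_on {0..T}"
    proof (rule has_integral_integrable, rule has_integral_mult_right)
      show "((\<lambda>t. t powr (\<epsilon> - 1)) has_integral T powr (\<epsilon> - 1 + 1) / (\<epsilon> - 1 + 1)) {0..T}"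
        by (rule has_integral_powr_from_0) (use \<epsilon> T in auto)
    qed
    show "norm (p t) \<le> C * t powr (\<epsilon> - 1)" if "t \<in> {0..T}" for t
    proof (cases "t = 0")
      case True then show ?thesis by (simp add: p_def)
    qed (use pb[of t] that in auto)
  qed simp
  then have pil: "integrable (lebesgue_on {0..T}) p" by (rule absolutely_integrable_imp_integrable) simp
  obtain q where q: "q \<in> borel_measurable borel" "AE t in lbon {0..T}. p t = q t"
    by (rule lebesgue_on_borel_rep[OF atLeastAtMost_borel borel_measurable_integrable[OF pil]])
  have qi: "integrable (lbon {0..T}) q"
    by (rule iffD1[OF integral_lebesgue_on_cong(2)[OF atLeastAtMost_borel q] pil])
  have "cv (\<lambda>_. 1) q t = K t" if t: "t \<in> {0..T}" for t
  proof -
    have ae: "AE s in lbon {0..t}. p s = q s"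
      using q(2) unfolding AE_lbon[OF atLeastAtMost_borel] by eventually_elim (use t in auto)
    have "cv (\<lambda>_. 1) q t = (LINT s|lborel. indicator {0..t} s * q s)"
      unfolding cv_def by (intro Bochner_Integration.integral_cong refl) (simp add: indicator_def)
    also have "\<dots> = integral\<^sup>L (lbon {0..t}) q" using q(1) by (simp add: integral_lbon)
    also have "\<dots> = integral\<^sup>L (lebesgue_on {0..t}) p" by (rule integral_lebesgue_on_cong(1)[OF _ q(1) ae, symmetric]) simp
    also have "\<dots> = integral {0..t} p"
    proof (rule lebesgue_integral_eq_integral)
      have "p absolutely_integrable_on {0..t}" by (rule set_integrable_subset[OF pai]) (use t in auto)
      then show "integrable (lebesgue_on {0..t}) p" by (rule absolutely_integrable_imp_integrable) simp
    qed simp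
    also have "\<dots> = K t" using hi[OF t] by (rule integral_unique)
    finally show ?thesis .
  qed
  moreover have "t powr (\<alpha> t - 1) / Gamma (\<alpha> t) = beta_k (\<alpha> 0) t + K t" if t: "t \<in> {0..T}" for t
  proof (cases "t = 0")
    case False
    then have "t > 0" using t by auto
    have e: "t powr (a - 1) * exp (x t) = t powr (\<alpha> t - 1)"
    proof -
      have "exp (x t) = t powr (\<alpha> t - a)" using \<open>t > 0\<close> by (simp add: x_def powr_def)
      then show ?thesis by (simp add: powr_add[symmetric])
    qed
    have "K t = (t powr (a - 1) * exp (x t)) * r t - t powr (a - 1) * r 0"
      unfolding K_def E_def by (simp only: right_diff_distrib mult.assoc)
    then show ?thesis unfolding e
      using \<open>t > 0\<close> by (simp add: beta_k_def r_def a_def rGamma_inverse_Gamma divide_inverse)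
  qed (simp add: K0 beta_k_def)
  ultimately show thesis using that[OF qi] by simp
qed

section \<open>Complementary Abel kernels and the inversion of the variable-order kernel\<close>

lemma nn_integral_Beta:
  assumes "0 < (a::real)" "0 < b"
  shows "(\<integral>\<^sup>+x. ennreal (indicator {0..1} x * (x powr (a - 1) * (1 - x) powr (b - 1))) \<partial>lborel) = ennreal (Beta a b)"
  by (rule nn_integral_has_integral_lebesgue[OF _ has_integral_Beta_real[OF assms]]) auto

text \<open>Fractional integrations of orders \<open>a\<close> and \<open>1 - a\<close> compose to
  one of order 1. Substituting \<open>s = t * x\<close>, the powers of \<open>t\<close> cancel and
  the Beta integral \<open>Gamma a * Gamma (1 - a)\<close> remains, which is the product of the two
  normalisations.\<close>

lemma cvn_beta_k_complementary:
  assumes a: "0 < a" "a < 1" and t: "0 < t"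
  shows "cvn (\<lambda>t. ennreal (beta_k (1 - a) t)) (\<lambda>t. ennreal (beta_k a t)) t = 1"
proof -
  define c where "c = 1 / (Gamma a * Gamma (1 - a))"
  have c: "0 \<le> c" using a by (simp add: c_def)
  let ?f = "\<lambda>s. if 0 \<le> s \<and> s \<le> t then ennreal (beta_k (1 - a) (t - s)) * ennreal (beta_k a s) else 0"
  have "cvn (\<lambda>t. ennreal (beta_k (1 - a) t)) (\<lambda>t. ennreal (beta_k a t)) t = ennreal \<bar>t\<bar> * (\<integral>\<^sup>+x. ?f (0 + t * x) \<partial>lborel)"
    unfolding cvn_def using t by (subst nn_integral_real_affine[where c=t and t=0]) auto
  also have "(\<integral>\<^sup>+x. ?f (0 + t * x) \<partial>lborel) = (\<integral>\<^sup>+x. ennreal (c / t) * ennreal (indicator {0..1} x * (x powr (a - 1) * (1 - x) powr ((1 - a) - 1))) \<partial>lborel)"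
  proof (rule nn_integral_cong_AE)
    have "AE x in lborel. x \<noteq> (0::real) \<and> x \<noteq> 1" by (intro AE_conjI AE_lborel_singleton)
    then show "AE x in lborel. ?f (0 + t * x) = ennreal (c / t) * ennreal (indicator {0..1} x * (x powr (a - 1) * (1 - x) powr ((1 - a) - 1)))"
    proof eventually_elim
      case (elim x)
      show ?case
      proof (cases "0 < x \<and> x < 1")
        case True
        have tx: "t - t * x = t * (1 - x)" by (simp add: algebra_simps)
        have "beta_k (1 - a) (t - t * x) * beta_k a (t * x) = c * ((t powr (a - 1) * t powr (- a)) * (x powr (a - 1) * (1 - x) powr (- a)))"
          using True t by (simp add: beta_k_def tx c_def powr_mult mult_ac)
        also have "t powr (a - 1) * t powr (- a) = 1 / t" using t by (simp only: powr_add[symmetric]) (simp add: powr_minus_divide)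
        finally have "beta_k (1 - a) (t - t * x) * beta_k a (t * x) = c / t * (x powr (a - 1) * (1 - x) powr (- a))" by simp
        moreover have "0 + t * x \<le> t \<and> 0 \<le> 0 + t * x" using True t by (simp add: mult_le_cancel_left1)
        ultimately show ?thesis using True t c a beta_k_nonneg[of a] beta_k_nonneg[of "1 - a"]
          by (simp add: ennreal_mult[symmetric])
      next
        case False
        with elim have "x < 0 \<or> 1 < x" by auto
        then have "\<not> (0 \<le> t * x \<and> t * x \<le> t)" using t by (auto simp: zero_le_mult_iff)
        then show ?thesis using \<open>x < 0 \<or> 1 < x\<close> by auto
      qed
    qed
  qed
  also have "\<dots> = ennreal (c / t) * ennreal (Beta a (1 - a))"
    using a nn_integral_Beta[of a "1 - a"] by (subst nn_integral_cmult) auto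
  also have "Beta a (1 - a) = Gamma a * Gamma (1 - a)" by (simp add: Beta_def)
  also have "ennreal \<bar>t\<bar> * (ennreal (c / t) * ennreal (Gamma a * Gamma (1 - a))) = ennreal (t * (c / t * (Gamma a * Gamma (1 - a))))"
  proof -
    have g: "0 \<le> Gamma a * Gamma (1 - a)" using a by (intro mult_nonneg_nonneg Gamma_real_nonneg) auto
    have "ennreal t * (ennreal (c / t) * ennreal G) = ennreal (t * (c / t * G))" if "0 \<le> G" for G
      using t c that by (simp add: ennreal_mult[symmetric] del: times_divide_eq_left times_divide_eq_right)
    from this[OF g] show ?thesis using t by simp
  qed
  also have "t * (c / t * (Gamma a * Gamma (1 - a))) = 1"
  proof -
    have "Gamma a > 0" "Gamma (1 - a) > 0" using a by (auto intro!: Gamma_real_pos)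
    then show ?thesis using t by (simp add: c_def)
  qed
  finally show ?thesis by simp
qed

lemma cv_beta_k_complementary:
  assumes a: "0 < a" "a < 1" and t: "0 < t"
  shows "cv (beta_k (1 - a)) (beta_k a) t = 1"
proof -
  have "cv (beta_k (1 - a)) (beta_k a) t = enn2real (\<integral>\<^sup>+s. ennreal (if 0 \<le> s \<and> s \<le> t then beta_k (1 - a) (t - s) * beta_k a s else 0) \<partial>lborel)"
    unfolding cv_def using a by (intro integral_eq_nn_integral) (auto intro!: mult_nonneg_nonneg beta_k_nonneg)
  also have "(\<integral>\<^sup>+s. ennreal (if 0 \<le> s \<and> s \<le> t then beta_k (1 - a) (t - s) * beta_k a s else 0) \<partial>lborel) =
     cvn (\<lambda>t. ennreal (beta_k (1 - a) t)) (\<lambda>t. ennreal (beta_k a t)) t"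
    unfolding cvn_def using a by (intro nn_integral_cong) (auto simp: ennreal_mult beta_k_nonneg)
  finally show ?thesis using cvn_beta_k_complementary[OF assms] by simp
qed

lemma cvn_one_le:
  assumes [measurable]: "g \<in> borel_measurable borel" and t: "t \<le> T"
  shows "cvn (\<lambda>t. ennreal \<bar>1\<bar>) g t \<le> (\<integral>\<^sup>+s. g s \<partial>lbon {0..T})"
  by (subst nn_integral_lbon, simp, simp, unfold cvn_def, intro nn_integral_mono) (use t in \<open>auto simp: indicator_def\<close>)

lemma cvn_mono:
  assumes "\<And>s. 0 \<le> s \<Longrightarrow> s \<le> t \<Longrightarrow> a s \<le> a' s" "\<And>s. 0 \<le> s \<Longrightarrow> s \<le> t \<Longrightarrow> b s \<le> b' s"
  shows "cvn a b t \<le> cvn a' b' t"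
  unfolding cvn_def by (intro nn_integral_mono) (use assms in \<open>auto intro!: mult_mono\<close>)

text \<open>A convolution with 1 is bounded at every time by the full integral, so these identities
  hold at each \<open>t\<close> and not just almost everywhere. This matters because the definition
  of the time derivative prescribes an identity at every time.\<close>

lemma cv_one_exchange:
  assumes a: "integrable (lbon {0..T}) (a :: real \<Rightarrow> real)" and c: "integrable (lbon {0..T}) c" and t: "t \<le> T"
  shows "cvn (\<lambda>t. ennreal \<bar>a t\<bar>) (\<lambda>t. ennreal \<bar>cv (\<lambda>_. 1) c t\<bar>) t
      \<le> (\<integral>\<^sup>+t. cvn (\<lambda>t. ennreal \<bar>a t\<bar>) (\<lambda>t. ennreal \<bar>c t\<bar>) t \<partial>lbon {0..T})"
    and "cv a (cv (\<lambda>_. 1) c) t = cv (\<lambda>_. 1) (cv a c) t"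
proof -
  have [measurable]: "a \<in> borel_measurable borel" "c \<in> borel_measurable borel" using a c by auto
  let ?e = "\<lambda>a t. ennreal \<bar>a t\<bar>" and ?o = "\<lambda>t::real. 1::real"
  have le: "cvn (?e ?o) (cvn (?e a) (?e c)) t \<le> (\<integral>\<^sup>+t. cvn (?e a) (?e c) t \<partial>lbon {0..T})"
    by (rule cvn_one_le) (use t in auto)
  have "cvn (?e a) (cvn (?e ?o) (?e c)) t = cvn (cvn (?e a) (?e ?o)) (?e c) t" by (rule cvn_assoc) auto
  also have "cvn (?e a) (?e ?o) = cvn (?e ?o) (?e a)" by (rule ext, rule cvn_commute) auto
  also have "cvn (cvn (?e ?o) (?e a)) (?e c) t = cvn (?e ?o) (cvn (?e a) (?e c)) t" by (rule cvn_assoc[symmetric]) auto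
  finally have eq: "cvn (?e a) (cvn (?e ?o) (?e c)) t = cvn (?e ?o) (cvn (?e a) (?e c)) t" .
  have "cvn (?e a) (\<lambda>t. ennreal \<bar>cv ?o c t\<bar>) t \<le> cvn (?e a) (cvn (?e ?o) (?e c)) t"
    by (intro cvn_mono cv_le_cvn) auto
  also note eq
  also note le
  finally show "cvn (?e a) (\<lambda>t. ennreal \<bar>cv ?o c t\<bar>) t \<le> (\<integral>\<^sup>+t. cvn (?e a) (?e c) t \<partial>lbon {0..T})" .
  have fin: "cvn (?e ?o) (cvn (?e a) (?e c)) t < \<infinity>" using le cvn_finite_AE(1)[OF a c] by (rule le_less_trans)
  have "cv a (cv ?o c) t = cv (cv a ?o) c t" by (rule cv_assoc) (use fin eq in auto)
  also have "cv a ?o = cv ?o a" by (rule ext, rule cv_commute)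
  also have "cv (cv ?o a) c t = cv ?o (cv a c) t" by (rule cv_assoc[symmetric]) (use fin in auto)
  finally show "cv a (cv ?o c) t = cv ?o (cv a c) t" .
qed

text \<open>Convolving with the complementary Abel kernel turns the variable-order kernel into
  \<open>1 + 1 * m\<close>, so that its convolution with \<open>\<beta>\<^sub>1\<^sub>-\<^sub>\<alpha> * z\<close> is differentiable in time.\<close>
lemma variable_order_kernel_inversion:
  fixes \<alpha> \<alpha>' :: "real \<Rightarrow> real"
  assumes T: "T > 0" and \<alpha>: "\<And>t. t \<in> {0..T} \<Longrightarrow> 0 < \<alpha> t \<and> \<alpha> t < 1"
    and d\<alpha>: "\<And>t. t \<in> {0..T} \<Longrightarrow> (\<alpha> has_real_derivative \<alpha>' t) (at t within {0..T}) \<and> \<bar>\<alpha>' t\<bar> \<le> Q"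
  obtains k m where "integrable (lbon {0..T}) k" "integrable (lbon {0..T}) m"
    "\<And>t. t \<in> {0..T} \<Longrightarrow> k t = t powr (\<alpha> t - 1) / Gamma (\<alpha> t)"
    "\<And>z t. integrable (lbon {0..T}) z \<Longrightarrow> t \<in> {0..T} \<Longrightarrow>
      cv k (cv (beta_k (1 - \<alpha> 0)) z) t = cv (\<lambda>_. 1) (\<lambda>s. z s + cv m z s) t"
proof -
  let ?M = "lbon {0..T}"
  obtain p where p: "integrable ?M p"
    and kp: "\<And>t. t \<in> {0..T} \<Longrightarrow> t powr (\<alpha> t - 1) / Gamma (\<alpha> t) = beta_k (\<alpha> 0) t + cv (\<lambda>_. 1) p t"
    using variable_order_kernel_split[OF T \<alpha> d\<alpha>] by blast
  define a where "a = \<alpha> 0"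
  have a: "0 < a" "a < 1" using \<alpha>[of 0] T by (auto simp: a_def)
  let ?e = "\<lambda>a t. ennreal \<bar>a t\<bar>" and ?o = "\<lambda>t::real. 1::real"
  define b where "b = beta_k a"
  define b' where "b' = beta_k (1 - a)"
  have b: "integrable ?M b" and b': "integrable ?M b'" using a by (auto simp: b_def b'_def intro!: beta_k_integrable)
  have oi: "integrable ?M ?o"
    using finite_measure.integrable_const[OF finite_measure_lbon[of "{0..T}"]] by auto
  have [measurable]: "p \<in> borel_measurable borel" "b \<in> borel_measurable borel" "b' \<in> borel_measurable borel"
    using p b b' by auto
  have ab: "?e b = (\<lambda>t. ennreal (b t))" "?e b' = (\<lambda>t. ennreal (b' t))"
    using a by (auto simp: b_def b'_def beta_k_nonneg)
  \<comment> \<open>The order is known only on \<open>{0..T}\<close>, so the variable-order kernel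
    is replaced by this Borel function on the line, which agrees with it there.\<close>
  define k where "k t = b t + cv ?o p t" for t
  have [measurable]: "k \<in> borel_measurable borel" unfolding k_def[abs_def] by measurable
  have ki: "integrable ?M k" unfolding k_def[abs_def] by (intro Bochner_Integration.integrable_add b cv_integrable oi p)
  define m where "m = cv p b'"
  have mi: "integrable ?M m" unfolding m_def by (rule cv_integrable[OF p b'])
  have [measurable]: "m \<in> borel_measurable borel" using mi by auto
  define P where "P = (\<integral>\<^sup>+t. cvn (?e b') (?e p) t \<partial>?M)"
  have P: "P < \<infinity>" unfolding P_def by (rule cvn_finite_AE(1)[OF b' p])
  have bb: "cvn (?e b') (?e b) s = (if 0 < s then 1 else 0)" for s
  proof (cases "0 < s")
    case True
    then show ?thesis using cvn_beta_k_complementary[OF a True] by (simp add: ab b_def[symmetric] b'_def[symmetric])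
  next
    case False
    then have "cvn (?e b') (?e b) s = (\<integral>\<^sup>+_. 0 \<partial>(lborel :: real measure))"
      unfolding cvn_def by (intro nn_integral_cong) (auto simp: b_def beta_k_def)
    then show ?thesis using False by simp
  qed
  \<comment> \<open>By the decomposition of \<open>k\<close>, the convolution is
    \<open>b' * b + b' * (1 * p)\<close>; the first summand is 1, and in the second the factor 1 is
    moved outside, leaving \<open>m = p * b'\<close>.\<close>
  have A: "cv k b' s = 1 + cv ?o m s" if s: "0 < s" "s \<le> T" for s
  proof -
    have "cv k b' s = cv b' k s" by (rule cv_commute)
    also have "\<dots> = cv b' b s + cv b' (cv ?o p) s"
    proof -
      have 1: "integrable lborel (\<lambda>r. if 0 \<le> r \<and> r \<le> s then b' (s - r) * b r else 0)"
        by (subst cv_integrable_iff) (auto simp: bb)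
      have 2: "integrable lborel (\<lambda>r. if 0 \<le> r \<and> r \<le> s then b' (s - r) * cv ?o p r else 0)"
        by (subst cv_integrable_iff) (use le_less_trans[OF cv_one_exchange(1)[OF b' p s(2)] P[unfolded P_def]] in auto)
      show ?thesis using cv_lincomb[OF 1 2, of 1 1] by (simp add: k_def[abs_def])
    qed
    also have "cv b' b s = 1" unfolding b_def b'_def by (rule cv_beta_k_complementary[OF a s(1)])
    also have "cv b' (cv ?o p) s = cv ?o (cv b' p) s" by (rule cv_one_exchange(2)[OF b' p s(2)])
    also have "cv b' p = m" unfolding m_def by (rule ext, rule cv_commute)
    finally show ?thesis .
  qed
  \<comment> \<open>A bound that holds at every \<open>s\<close>, so that the convolutions with
    \<open>z\<close> can be reassociated at every \<open>t\<close>.\<close>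
  have kb: "cvn (?e k) (?e b') s \<le> 1 + P" if s: "s \<le> T" for s
  proof -
    have "cvn (?e k) (?e b') s = cvn (?e b') (?e k) s" by (rule cvn_commute) auto
    also have "\<dots> \<le> cvn (?e b') (\<lambda>t. ?e b t + ennreal \<bar>cv ?o p t\<bar>) s"
      by (rule cvn_mono) (auto simp: k_def ennreal_plus[symmetric] simp del: ennreal_plus intro!: ennreal_leI)
    also have "\<dots> = cvn (?e b') (?e b) s + cvn (?e b') (\<lambda>t. ennreal \<bar>cv ?o p t\<bar>) s"
      unfolding cvn_def by (subst nn_integral_add[symmetric]) (auto intro!: nn_integral_cong simp: distrib_left)
    also have "\<dots> \<le> 1 + P" unfolding P_def by (intro add_mono cv_one_exchange(1) b' p s) (simp add: bb)
    finally show ?thesis .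
  qed
  have inv: "cv k (cv b' z) t = cv ?o (\<lambda>s. z s + cv m z s) t" if z: "integrable ?M z" and t: "t \<in> {0..T}" for z t
  proof -
    have tT: "t \<le> T" using t by auto
    have [measurable]: "z \<in> borel_measurable borel" using z by auto
    have zf: "(\<integral>\<^sup>+t. ?e z t \<partial>?M) < \<infinity>" unfolding nn_integral_abs_eq[OF z] by simp
    have "cvn (?e k) (cvn (?e b') (?e z)) t = cvn (cvn (?e k) (?e b')) (?e z) t" by (rule cvn_assoc) auto
    also have "\<dots> \<le> cvn (\<lambda>_. 1 + P) (?e z) t" by (rule cvn_mono) (use t in \<open>auto intro!: kb\<close>)
    also have "\<dots> = (1 + P) * cvn (?e ?o) (?e z) t" unfolding cvn_def
      by (subst nn_integral_cmult[symmetric]) (auto intro!: nn_integral_cong)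
    also have "\<dots> \<le> (1 + P) * (\<integral>\<^sup>+t. ?e z t \<partial>?M)" by (intro mult_left_mono cvn_one_le tT) auto
    also have "\<dots> < \<infinity>" using P zf by (simp add: ennreal_mult_less_top)
    finally have "cv k (cv b' z) t = cv (cv k b') z t" by (intro cv_assoc) auto
    also have "\<dots> = cv z (cv k b') t" by (rule cv_commute)
    also have "\<dots> = cv z (\<lambda>s. 1 * 1 + 1 * cv ?o m s) t"
    proof (rule cv_cong_AE[OF _ _ _ _ tT])
      have "AE s in lborel. s \<noteq> (0::real)" by (rule AE_lborel_singleton)
      then show "AE s in ?M. cv k b' s = 1 * 1 + 1 * cv ?o m s"
        unfolding AE_lbon[OF atLeastAtMost_borel] by eventually_elim (auto simp: A)
    qed measurable
    also have "\<dots> = 1 * cv z ?o t + 1 * cv z (cv ?o m) t"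
    proof (rule cv_lincomb)
      have "cvn (?e z) (?e ?o) t = cvn (?e ?o) (?e z) t" by (rule cvn_commute) auto
      also have "\<dots> < \<infinity>" using cvn_one_le[of "?e z" t T] tT zf by (auto intro: le_less_trans)
      finally show "integrable lborel (\<lambda>s. if 0 \<le> s \<and> s \<le> t then z (t - s) * 1 else 0)"
        using cv_integrable_iff[of z ?o t] by simp
      show "integrable lborel (\<lambda>s. if 0 \<le> s \<and> s \<le> t then z (t - s) * cv ?o m s else 0)"
        by (subst cv_integrable_iff) (use le_less_trans[OF cv_one_exchange(1)[OF z mi tT] cvn_finite_AE(1)[OF z mi]] in auto)
    qed
    also have "cv z (cv ?o m) t = cv ?o (cv z m) t" by (rule cv_one_exchange(2)[OF z mi tT])
    also have "cv z m = cv m z" by (rule ext, rule cv_commute)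
    also have "cv z ?o t = cv ?o z t" by (rule cv_commute)
    also have "1 * cv ?o z t + 1 * cv ?o (cv m z) t = cv ?o (\<lambda>s. 1 * z s + 1 * cv m z s) t"
    proof (rule cv_lincomb[symmetric])
      show "integrable lborel (\<lambda>s. if 0 \<le> s \<and> s \<le> t then 1 * z s else 0)"
        using cv_integrable_iff[of ?o z t] le_less_trans[OF cvn_one_le[of "?e z" t T] zf] tT by simp
      have cf: "(\<integral>\<^sup>+t. ennreal \<bar>cv m z t\<bar> \<partial>?M) < \<infinity>"
        unfolding nn_integral_abs_eq[OF cv_integrable[OF mi z]] by simp
      show "integrable lborel (\<lambda>s. if 0 \<le> s \<and> s \<le> t then 1 * cv m z s else 0)"
        using cv_integrable_iff[of ?o "cv m z" t] le_less_trans[OF cvn_one_le[of "\<lambda>t. ennreal \<bar>cv m z t\<bar>" t T] cf] tT by simp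
    qed
    finally show ?thesis by simp
  qed
  show thesis
    by (rule that[OF ki mi]) (use kp inv in \<open>simp_all add: k_def b_def b'_def a_def\<close>)
qed

section \<open>Eigenfunction expansions in space-time\<close>

text \<open>Completeness is stated as totality. Together with Bessel's inequality and the
  convergence of orthogonal series this suffices, so Parseval's identity is never invoked.\<close>

locale expansion = X: sigma_finite_measure X for X :: "'a measure" +
  fixes T :: real and \<phi> :: "nat \<Rightarrow> 'a \<Rightarrow> real"
  assumes phi_l2: "l2 X (\<phi> i)"
    and phi_orthonormal: "(LINT x|X. \<phi> i x * \<phi> j x) = (if i = j then 1 else 0)"
    and phi_complete: "l2 X f \<Longrightarrow> (\<And>i. (LINT x|X. f x * \<phi> i x) = 0) \<Longrightarrow> AE x in X. f x = 0"
begin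

abbreviation Mt :: "real measure" where "Mt \<equiv> lbon {0..T}"
abbreviation P :: "(real \<times> 'a) measure" where "P \<equiv> Mt \<Otimes>\<^sub>M X"

sublocale Mt: finite_measure Mt by (rule finite_measure_lbon) auto
sublocale pair_sigma_finite Mt X ..

definition co :: "(real \<times> 'a \<Rightarrow> real) \<Rightarrow> nat \<Rightarrow> real \<Rightarrow> real" where
  "co U i t = (LINT x|X. U (t, x) * \<phi> i x)"

definition tens :: "(real \<Rightarrow> real) \<Rightarrow> nat \<Rightarrow> real \<times> 'a \<Rightarrow> real" where
  "tens w i z = w (fst z) * \<phi> i (snd z)"

definition pcv :: "(real \<Rightarrow> real) \<Rightarrow> (real \<times> 'a \<Rightarrow> real) \<Rightarrow> real \<times> 'a \<Rightarrow> real" where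
  "pcv a Z z = cv a (\<lambda>s. Z (s, snd z)) (fst z)"

lemma phi_measurable [measurable]: "\<phi> i \<in> borel_measurable X" using phi_l2 by (simp add: l2_def)

lemma n2_phi: "n2 X (\<phi> i) = 1"
  using phi_orthonormal[of i i] by (simp add: n2_def power2_eq_square)

lemma co_measurable [measurable]: "U \<in> borel_measurable P \<Longrightarrow> co U i \<in> borel_measurable borel"
proof -
  assume [measurable]: "U \<in> borel_measurable P"
  have "co U i \<in> borel_measurable Mt" unfolding co_def[abs_def] by measurable
  then show ?thesis by (simp cong: measurable_cong_sets)
qed

lemma slice_measurable: "U \<in> borel_measurable P \<Longrightarrow> (\<lambda>s. U (s, x)) \<in> borel_measurable borel" if "x \<in> space X"
proof -
  assume [measurable]: "U \<in> borel_measurable P"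
  have "(\<lambda>s. U (s, x)) \<in> borel_measurable Mt" using that by measurable
  then show ?thesis by (simp cong: measurable_cong_sets)
qed

lemma pcv_measurable [measurable]:
  assumes [measurable]: "a \<in> borel_measurable borel" "Z \<in> borel_measurable P"
  shows "pcv a Z \<in> borel_measurable P"
proof -
  have s: "sets P = sets (borel \<Otimes>\<^sub>M X)" by (intro sets_pair_measure_cong) auto
  have "Z \<in> borel_measurable (borel \<Otimes>\<^sub>M X)" using assms(2) by (simp cong: measurable_cong_sets add: s)
  from borel_measurable_cv_pair[OF assms(1) this] show ?thesis
    unfolding pcv_def[abs_def] by (simp cong: measurable_cong_sets add: s)
qed

lemma slice_l2_AE:
  assumes "l2 P U"
  shows "AE t in Mt. l2 X (\<lambda>x. U (t, x))" "AE x in X. l2 Mt (\<lambda>t. U (t, x))"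
proof -
  have [measurable]: "U \<in> borel_measurable P" using assms by (simp add: l2_def)
  show "AE t in Mt. l2 X (\<lambda>x. U (t, x))"
    using AE_integrable_fst'[OF l2_integrable[OF assms]] by eventually_elim (auto simp: l2_def)
  have "integrable (X \<Otimes>\<^sub>M Mt) (\<lambda>(x, t). (U (t, x))\<^sup>2)"
    using integrable_product_swap[OF l2_integrable[OF assms]] by simp
  then have "integrable (X \<Otimes>\<^sub>M Mt) (\<lambda>z. (U (snd z, fst z))\<^sup>2)" by (simp add: case_prod_unfold)
  interpret Q: pair_sigma_finite X Mt ..
  from Q.AE_integrable_fst'[OF \<open>integrable (X \<Otimes>\<^sub>M Mt) (\<lambda>z. (U (snd z, fst z))\<^sup>2)\<close>] AE_space
  show "AE x in X. l2 Mt (\<lambda>t. U (t, x))"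
    by eventually_elim (auto simp: l2_def slice_measurable)
qed

lemma co_lincomb:
  assumes "l2 P U" "l2 P V"
  shows "AE t in Mt. co (\<lambda>z. a * U z + b * V z) i t = a * co U i t + b * co V i t"
  using slice_l2_AE(1)[OF assms(1)] slice_l2_AE(1)[OF assms(2)]
proof eventually_elim
  case (elim t)
  have "co (\<lambda>z. a * U z + b * V z) i t = (LINT x|X. a * (U (t, x) * \<phi> i x) + b * (V (t, x) * \<phi> i x))"
    unfolding co_def by (simp add: algebra_simps)
  also have "\<dots> = a * co U i t + b * co V i t" unfolding co_def
    using l2_mult_integrable[OF elim(1) phi_l2] l2_mult_integrable[OF elim(2) phi_l2]
    by (subst Bochner_Integration.integral_add) auto
  finally show ?case .
qed

lemma co_l2:
  assumes "l2 P U" shows "l2 Mt (co U i)" "n2 Mt (co U i) \<le> n2 P U"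
proof -
  have [measurable]: "U \<in> borel_measurable P" using assms by (simp add: l2_def)
  have "(\<integral>\<^sup>+t. ennreal ((co U i t)\<^sup>2) \<partial>Mt) \<le> (\<integral>\<^sup>+t. \<integral>\<^sup>+x. ennreal ((U (t, x))\<^sup>2) \<partial>X \<partial>Mt)"
  proof (rule nn_integral_mono_AE)
    show "AE t in Mt. ennreal ((co U i t)\<^sup>2) \<le> (\<integral>\<^sup>+x. ennreal ((U (t, x))\<^sup>2) \<partial>X)"
      using slice_l2_AE(1)[OF assms]
    proof eventually_elim
      case (elim t)
      have "\<bar>co U i t\<bar> \<le> n2 X (\<lambda>x. U (t, x))"
        using l2_Cauchy_Schwarz[OF elim phi_l2[of i]] by (simp add: co_def n2_phi)
      then have "(co U i t)\<^sup>2 \<le> (n2 X (\<lambda>x. U (t, x)))\<^sup>2" by (simp add: abs_le_square_iff[symmetric])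
      then show ?case using nn_integral_l2[OF elim] by (simp add: ennreal_leI)
    qed
  qed
  also have "\<dots> = ennreal ((n2 P U)\<^sup>2)"
    by (subst X.nn_integral_fst) (auto simp: nn_integral_l2[OF assms])
  finally show "l2 Mt (co U i)" "n2 Mt (co U i) \<le> n2 P U" by (auto intro!: l2I_nn)
qed

text \<open>There are countably many coefficients, so outside one null set of times all of them
  vanish and completeness applies to the slice. Equations in space-time are thereby verified mode by
  mode.\<close>

lemma co_zero_imp_zero:
  assumes "l2 P G" "\<And>i. AE t in Mt. co G i t = 0"
  shows "AE z in P. G z = 0"
proof (rule AE_pair_measure)
  have [measurable]: "G \<in> borel_measurable P" using assms by (simp add: l2_def)
  show "{z \<in> space P. G z = 0} \<in> sets P" by measurable
  have "AE t in Mt. \<forall>i. co G i t = 0" using assms(2) by (simp add: AE_all_countable)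
  with slice_l2_AE(1)[OF assms(1)] show "AE t in Mt. AE x in X. G (t, x) = 0"
    by eventually_elim (rule phi_complete, auto simp: co_def)
qed

lemma tens_l2:
  assumes w: "l2 Mt w" shows "l2 P (tens w i)"
proof -
  have wm: "w \<in> borel_measurable Mt" using w by (simp add: l2_def)
  have [measurable]: "tens w i \<in> borel_measurable P"
    unfolding tens_def[abs_def]
    by (intro borel_measurable_times measurable_compose[OF measurable_fst wm] measurable_compose[OF measurable_snd phi_measurable])
  have "(\<integral>\<^sup>+z. ennreal ((tens w i z)\<^sup>2) \<partial>P) = (\<integral>\<^sup>+t. \<integral>\<^sup>+x. ennreal ((tens w i (t, x))\<^sup>2) \<partial>X \<partial>Mt)"
    by (subst X.nn_integral_fst) auto
  also have "\<dots> = (\<integral>\<^sup>+t. ennreal ((w t)\<^sup>2) \<partial>Mt)"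
  proof (rule nn_integral_cong)
    fix t
    have "(\<integral>\<^sup>+x. ennreal ((tens w i (t, x))\<^sup>2) \<partial>X) = (\<integral>\<^sup>+x. ennreal ((w t)\<^sup>2) * ennreal ((\<phi> i x)\<^sup>2) \<partial>X)"
      by (simp add: tens_def power_mult_distrib ennreal_mult)
    also have "\<dots> = ennreal ((w t)\<^sup>2) * (\<integral>\<^sup>+x. ennreal ((\<phi> i x)\<^sup>2) \<partial>X)"
      by (rule nn_integral_cmult) measurable
    also have "(\<integral>\<^sup>+x. ennreal ((\<phi> i x)\<^sup>2) \<partial>X) = 1" unfolding nn_integral_l2[OF phi_l2] n2_phi by simp
    finally show "(\<integral>\<^sup>+x. ennreal ((tens w i (t, x))\<^sup>2) \<partial>X) = ennreal ((w t)\<^sup>2)" by simp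
  qed
  also have "\<dots> = ennreal ((n2 Mt w)\<^sup>2)" by (rule nn_integral_l2[OF w])
  finally show ?thesis by (intro l2I_nn(1)) auto
qed

lemma integral_mult_tens:
  assumes "l2 P F" "l2 Mt w"
  shows "(LINT z|P. F z * tens w i z) = (LINT t|Mt. co F i t * w t)"
proof -
  have "(LINT z|P. F z * tens w i z) = (LINT t|Mt. LINT x|X. F (t, x) * tens w i (t, x))"
    by (rule integral_fst'[symmetric]) (rule l2_mult_integrable[OF assms(1) tens_l2[OF assms(2)]])
  also have "\<dots> = (LINT t|Mt. LINT x|X. (F (t, x) * \<phi> i x) * w t)" by (simp add: tens_def mult_ac)
  finally show ?thesis by (simp add: co_def)
qed

lemma co_tens: "co (tens w j) i t = (if i = j then w t else 0)"
  using phi_orthonormal[of j i] by (simp add: co_def tens_def mult.assoc)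

lemma n2_sum_tens:
  assumes w: "\<And>i. l2 Mt (w i)" and I: "finite I"
  shows "(n2 P (\<lambda>z. \<Sum>i\<in>I. tens (w i) i z))\<^sup>2 = (\<Sum>i\<in>I. (n2 Mt (w i))\<^sup>2)"
proof -
  have "(n2 P (\<lambda>z. \<Sum>i\<in>I. tens (w i) i z))\<^sup>2 = (LINT z|P. (\<Sum>i\<in>I. \<Sum>j\<in>I. tens (w i) i z * tens (w j) j z))"
    unfolding n2_sq by (simp add: power2_eq_square sum_product)
  also have "\<dots> = (\<Sum>i\<in>I. \<Sum>j\<in>I. (LINT z|P. tens (w i) i z * tens (w j) j z))"
    by (subst Bochner_Integration.integral_sum, auto intro!: Bochner_Integration.integrable_sum l2_mult_integrable tens_l2 w)+
  also have "\<dots> = (\<Sum>i\<in>I. \<Sum>j\<in>I. if j = i then (n2 Mt (w i))\<^sup>2 else 0)"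
    unfolding n2_sq by (intro sum.cong refl) (auto simp: integral_mult_tens tens_l2 w co_tens power2_eq_square)
  also have "\<dots> = (\<Sum>i\<in>I. (n2 Mt (w i))\<^sup>2)" using I by simp
  finally show ?thesis .
qed

lemma bessel:
  assumes F: "l2 P F"
  shows "summable (\<lambda>i. (n2 Mt (co F i))\<^sup>2)" "(\<Sum>i. (n2 Mt (co F i))\<^sup>2) \<le> (n2 P F)\<^sup>2"
proof -
  have le: "(\<Sum>i<n. (n2 Mt (co F i))\<^sup>2) \<le> (n2 P F)\<^sup>2" for n
  proof -
    let ?S = "\<lambda>z. \<Sum>i<n. tens (co F i) i z"
    have t: "l2 P (tens (co F i) i)" for i by (intro tens_l2 co_l2 F)
    have S: "l2 P ?S" by (intro l2_sum t)
    have FS: "(LINT z|P. F z * ?S z) = (\<Sum>i<n. (n2 Mt (co F i))\<^sup>2)"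
      using F t unfolding n2_sq
      by (simp add: sum_distrib_left Bochner_Integration.integral_sum l2_mult_integrable integral_mult_tens co_l2 power2_eq_square)
    have "0 \<le> (LINT z|P. (F z - ?S z)\<^sup>2)" by simp
    also have "\<dots> = (LINT z|P. (F z)\<^sup>2 - 2 * (F z * ?S z) + (?S z)\<^sup>2)"
      by (simp add: power2_eq_square algebra_simps)
    also have "\<dots> = (n2 P F)\<^sup>2 - 2 * (LINT z|P. F z * ?S z) + (n2 P ?S)\<^sup>2"
      unfolding n2_sq using l2_integrable[OF F] l2_integrable[OF S] l2_mult_integrable[OF F S]
      by (subst Bochner_Integration.integral_add, simp, simp, subst Bochner_Integration.integral_diff, simp, simp) simp
    also have "(n2 P ?S)\<^sup>2 = (\<Sum>i<n. (n2 Mt (co F i))\<^sup>2)" by (rule n2_sum_tens) (auto intro: co_l2 F)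
    finally show ?thesis unfolding FS by simp
  qed
  show s: "summable (\<lambda>i. (n2 Mt (co F i))\<^sup>2)" by (rule summableI_nonneg_bounded[OF _ le]) simp
  show "(\<Sum>i. (n2 Mt (co F i))\<^sup>2) \<le> (n2 P F)\<^sup>2" by (rule suminf_le_const[OF s le])
qed

text \<open>The passage from modes to space-time: by orthonormality the partial sums are Cauchy, and
  the coefficients of the limit are found from the continuity of \<open>co\<close> in the
  norm.\<close>

lemma series_exists:
  assumes w: "\<And>i. l2 Mt (w i)" and sm: "summable (\<lambda>i. (n2 Mt (w i))\<^sup>2)"
  obtains W where "l2 P W" "\<And>i. AE t in Mt. co W i t = w i t" "(n2 P W)\<^sup>2 \<le> (\<Sum>i. (n2 Mt (w i))\<^sup>2)"
proof -
  define S where "S n z = (\<Sum>i<n. tens (w i) i z)" for n z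
  have Sl: "l2 P (S n)" for n unfolding S_def[abs_def] by (intro l2_sum tens_l2 w)
  have diff: "(n2 P (\<lambda>z. S m z - S n z))\<^sup>2 = (\<Sum>i\<in>{n..<m}. (n2 Mt (w i))\<^sup>2)" if "n \<le> m" for m n
  proof -
    have "(\<lambda>z. S m z - S n z) = (\<lambda>z. \<Sum>i\<in>{n..<m}. tens (w i) i z)"
    proof
      fix z show "S m z - S n z = (\<Sum>i\<in>{n..<m}. tens (w i) i z)"
        using sum_diff_nat_ivl[of 0 n m "\<lambda>i. tens (w i) i z"] that by (simp add: S_def lessThan_atLeast0)
    qed
    then show ?thesis using n2_sum_tens[of w "{n..<m}"] w by simp
  qed
  have cau: "\<exists>N. \<forall>m\<ge>N. \<forall>n\<ge>N. n2 P (\<lambda>z. S m z - S n z) < e" if e: "e > 0" for e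
  proof -
    obtain N where N: "\<And>m n. m \<ge> N \<Longrightarrow> norm (\<Sum>i\<in>{m..<n}. (n2 Mt (w i))\<^sup>2) < e\<^sup>2"
      using sm[unfolded summable_Cauchy] e by (metis zero_less_power)
    have *: "n2 P (\<lambda>z. S m z - S n z) < e" if "N \<le> n" "n \<le> m" for m n
    proof (rule power2_less_imp_less)
      show "(n2 P (\<lambda>z. S m z - S n z))\<^sup>2 < e\<^sup>2" using N[of n m] that diff[of n m] by simp
    qed (use e in simp)
    have "n2 P (\<lambda>z. S m z - S n z) < e" if "m \<ge> N" "n \<ge> N" for m n
      using *[of n m] *[of m n] that n2_diff_commute[of P "S m" "S n"] by (cases "n \<le> m") auto
    then show ?thesis by blast
  qed
  obtain W where W: "l2 P W" "(\<lambda>n. n2 P (\<lambda>z. S n z - W z)) \<longlonglongrightarrow> 0"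
    by (rule l2_complete[of P S]) (use Sl cau in auto)
  have [measurable]: "W \<in> borel_measurable P" using W by (simp add: l2_def)
  have coS: "AE t in Mt. co (S n) i t = (if i < n then w i t else 0)" for n i
  proof (induction n)
    case 0 then show ?case by (simp add: S_def co_def)
  next
    case (Suc n)
    have "S (Suc n) = (\<lambda>z. 1 * S n z + 1 * tens (w n) n z)" by (simp add: S_def fun_eq_iff)
    with co_lincomb[OF Sl[of n] tens_l2[OF w[of n], of n], of 1 1 i]
    have "AE t in Mt. co (S (Suc n)) i t = co (S n) i t + co (tens (w n) n) i t" by simp
    with Suc show ?case by eventually_elim (auto simp: co_tens less_Suc_eq)
  qed
  have coW: "AE t in Mt. co W i t = w i t" for i
  proof -
    have dl: "l2 Mt (\<lambda>t. w i t - co W i t)" by (intro l2_diff w co_l2 W)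
    have [measurable]: "w i \<in> borel_measurable borel" using w[of i] by (auto simp: l2_def)
    have [measurable]: "S n \<in> borel_measurable P" for n using Sl by (simp add: l2_def)
    \<comment> \<open>Once \<open>n\<close> exceeds \<open>i\<close> the partial sum has the exact
      coefficient \<open>w i\<close>, so the discrepancy is bounded by the distance of that sum from
      the limit.\<close>
    have "n2 Mt (\<lambda>t. w i t - co W i t) \<le> n2 P (\<lambda>z. S n z - W z)" if "i < n" for n
    proof -
      have "n2 Mt (\<lambda>t. w i t - co W i t) = n2 Mt (co (\<lambda>z. S n z - W z) i)"
      proof (rule n2_cong_AE)
        show "AE t in Mt. w i t - co W i t = co (\<lambda>z. S n z - W z) i t"
          using coS[of n i] co_lincomb[OF Sl[of n] W(1), of 1 "-1" i] by eventually_elim (use that in simp)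
      qed measurable
      also have "\<dots> \<le> n2 P (\<lambda>z. S n z - W z)" by (intro co_l2 l2_diff Sl W)
      finally show ?thesis .
    qed
    then have "n2 Mt (\<lambda>t. w i t - co W i t) \<le> 0"
      by (intro LIMSEQ_le_const[OF W(2)]) (auto intro!: exI[of _ "Suc i"])
    then have "n2 Mt (\<lambda>t. w i t - co W i t) = 0" using n2_nonneg[of Mt "\<lambda>t. w i t - co W i t"] by simp
    from n2_eq_0[OF dl this] show ?thesis by eventually_elim simp
  qed
  have "n2 P W \<le> sqrt (\<Sum>i. (n2 Mt (w i))\<^sup>2)"
  proof (rule LIMSEQ_le_const)
    show "(\<lambda>n. sqrt (\<Sum>i. (n2 Mt (w i))\<^sup>2) + n2 P (\<lambda>z. S n z - W z)) \<longlonglongrightarrow> sqrt (\<Sum>i. (n2 Mt (w i))\<^sup>2)"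
      using tendsto_add[OF tendsto_const W(2)] by simp
    have "n2 P W \<le> sqrt (\<Sum>i. (n2 Mt (w i))\<^sup>2) + n2 P (\<lambda>z. S n z - W z)" for n
    proof -
      have "(n2 P (S n))\<^sup>2 = (\<Sum>i<n. (n2 Mt (w i))\<^sup>2)" unfolding S_def[abs_def] by (rule n2_sum_tens) (auto simp: w)
      also have "\<dots> \<le> (\<Sum>i. (n2 Mt (w i))\<^sup>2)" by (rule sum_le_suminf[OF sm]) auto
      finally have "n2 P (S n) \<le> sqrt (\<Sum>i. (n2 Mt (w i))\<^sup>2)" by (rule real_le_rsqrt)
      moreover have "n2 P W \<le> n2 P (S n) + n2 P (\<lambda>z. - (S n z - W z))"
        using n2_triangle[OF Sl[of n] l2_minus[OF l2_diff[OF Sl[of n] W(1)]]] by simp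
      ultimately show ?thesis unfolding n2_minus by simp
    qed
    then show "\<exists>N. \<forall>n\<ge>N. n2 P W \<le> sqrt (\<Sum>i. (n2 Mt (w i))\<^sup>2) + n2 P (\<lambda>z. S n z - W z)" by blast
  qed
  then have "(n2 P W)\<^sup>2 \<le> (sqrt (\<Sum>i. (n2 Mt (w i))\<^sup>2))\<^sup>2" by (intro power_mono) auto
  also have "\<dots> = (\<Sum>i. (n2 Mt (w i))\<^sup>2)" by (intro real_sqrt_pow2 suminf_nonneg sm) auto
  finally show thesis using that W(1) coW by blast
qed

text \<open>Young's inequality in time on every spatial slice, then integration over space.\<close>

lemma pcv_l2:
  assumes a: "integrable Mt a" and Z: "l2 P Z"
  shows "l2 P (pcv a Z)" "n2 P (pcv a Z) \<le> (LINT t|Mt. \<bar>a t\<bar>) * n2 P Z"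
proof -
  have [measurable]: "a \<in> borel_measurable borel" "Z \<in> borel_measurable P" using a Z by (auto simp: l2_def)
  let ?A = "LINT t|Mt. \<bar>a t\<bar>"
  have "(\<integral>\<^sup>+z. ennreal ((pcv a Z z)\<^sup>2) \<partial>P) = (\<integral>\<^sup>+x. \<integral>\<^sup>+t. ennreal ((cv a (\<lambda>s. Z (s, x)) t)\<^sup>2) \<partial>Mt \<partial>X)"
    by (subst nn_integral_snd[symmetric], measurable, simp add: pcv_def)
  also have "\<dots> \<le> (\<integral>\<^sup>+x. ennreal (?A\<^sup>2) * (\<integral>\<^sup>+t. ennreal ((Z (t, x))\<^sup>2) \<partial>Mt) \<partial>X)"
  proof (rule nn_integral_mono)
    fix x assume "x \<in> space X"
    then have "(\<lambda>s. Z (s, x)) \<in> borel_measurable borel" by (rule slice_measurable) measurable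
    from cvn_cv_bound[OF _ this, of a T]
    show "(\<integral>\<^sup>+t. ennreal ((cv a (\<lambda>s. Z (s, x)) t)\<^sup>2) \<partial>Mt) \<le> ennreal (?A\<^sup>2) * (\<integral>\<^sup>+t. ennreal ((Z (t, x))\<^sup>2) \<partial>Mt)"
      unfolding nn_integral_abs_eq[OF a] by (simp add: ennreal_power)
  qed
  also have "\<dots> = ennreal (?A\<^sup>2) * (\<integral>\<^sup>+x. \<integral>\<^sup>+t. ennreal ((Z (t, x))\<^sup>2) \<partial>Mt \<partial>X)"
    by (rule nn_integral_cmult) measurable
  also have "(\<integral>\<^sup>+x. \<integral>\<^sup>+t. ennreal ((Z (t, x))\<^sup>2) \<partial>Mt \<partial>X) = ennreal ((n2 P Z)\<^sup>2)"
    by (subst nn_integral_snd) (auto simp: nn_integral_l2[OF Z])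
  finally have "(\<integral>\<^sup>+z. ennreal ((pcv a Z z)\<^sup>2) \<partial>P) \<le> ennreal ((?A * n2 P Z)\<^sup>2)"
    by (simp add: ennreal_mult power_mult_distrib)
  then show "l2 P (pcv a Z)" "n2 P (pcv a Z) \<le> ?A * n2 P Z" by (auto intro!: l2I_nn)
qed

text \<open>Fubini at almost every \<open>t\<close>. By Cauchy-Schwarz in space the function
  \<open>N\<close> is square integrable in time, so its convolution with
  \<open>\<bar>a\<bar>\<close> is finite almost everywhere, and that is the absolute integrability
  required.\<close>

lemma co_pcv:
  assumes a: "integrable Mt a" and Z: "l2 P Z"
  shows "AE t in Mt. co (pcv a Z) i t = cv a (co Z i) t"
proof -
  have [measurable]: "a \<in> borel_measurable borel" "Z \<in> borel_measurable P" using a Z by (auto simp: l2_def)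
  have s1: "sets (borel \<Otimes>\<^sub>M X) = sets P" and s2: "sets (lborel \<Otimes>\<^sub>M X) = sets P"
    by (intro sets_pair_measure_cong; simp)+
  have [measurable]: "Z \<in> borel_measurable (borel \<Otimes>\<^sub>M X)" "Z \<in> borel_measurable (lborel \<Otimes>\<^sub>M X)"
    using \<open>Z \<in> borel_measurable P\<close> unfolding measurable_cong_sets[OF s1 refl] measurable_cong_sets[OF s2 refl] by assumption+
  define N where "N s = (\<integral>\<^sup>+x. ennreal \<bar>Z (s, x) * \<phi> i x\<bar> \<partial>X)" for s
  have [measurable]: "N \<in> borel_measurable borel" unfolding N_def[abs_def] by measurable
  have "(\<integral>\<^sup>+s. (N s)\<^sup>2 \<partial>Mt) \<le> (\<integral>\<^sup>+s. \<integral>\<^sup>+x. ennreal ((Z (s, x))\<^sup>2) \<partial>X \<partial>Mt)"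
  proof (rule nn_integral_mono)
    fix s
    have "(N s)\<^sup>2 = (\<integral>\<^sup>+x. ennreal \<bar>Z (s, x)\<bar> * ennreal \<bar>\<phi> i x\<bar> \<partial>X)\<^sup>2"
      by (simp add: N_def abs_mult ennreal_mult)
    also have "\<dots> \<le> (\<integral>\<^sup>+x. (ennreal \<bar>Z (s, x)\<bar>)\<^sup>2 \<partial>X) * (\<integral>\<^sup>+x. (ennreal \<bar>\<phi> i x\<bar>)\<^sup>2 \<partial>X)"
      by (rule Cauchy_Schwarz_nn_integral) measurable
    also have "(\<integral>\<^sup>+x. (ennreal \<bar>\<phi> i x\<bar>)\<^sup>2 \<partial>X) = 1"
      using nn_integral_l2[OF phi_l2[of i]] by (simp add: n2_phi ennreal_power)
    finally show "(N s)\<^sup>2 \<le> (\<integral>\<^sup>+x. ennreal ((Z (s, x))\<^sup>2) \<partial>X)" by (simp add: ennreal_power)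
  qed
  also have "\<dots> = ennreal ((n2 P Z)\<^sup>2)" by (subst X.nn_integral_fst) (auto simp: nn_integral_l2[OF Z])
  finally have N2: "(\<integral>\<^sup>+s. (N s)\<^sup>2 \<partial>Mt) \<le> ennreal ((n2 P Z)\<^sup>2)" .
  have "(\<integral>\<^sup>+t. (cvn (\<lambda>t. ennreal \<bar>a t\<bar>) N t)\<^sup>2 \<partial>Mt) \<le> (\<integral>\<^sup>+t. ennreal \<bar>a t\<bar> \<partial>Mt)\<^sup>2 * (\<integral>\<^sup>+s. (N s)\<^sup>2 \<partial>Mt)"
    by (rule nn_integral_cvn_sq_le) measurable
  also have "\<dots> < \<infinity>" using le_less_trans[OF N2] unfolding nn_integral_abs_eq[OF a]
    by (simp add: ennreal_mult_less_top power2_eq_square)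
  finally have "AE t in Mt. (cvn (\<lambda>t. ennreal \<bar>a t\<bar>) N t)\<^sup>2 \<noteq> \<infinity>"
    by (intro nn_integral_PInf_AE) auto
  then show ?thesis
  proof eventually_elim
    case (elim t)
    then have fin: "cvn (\<lambda>t. ennreal \<bar>a t\<bar>) N t < \<infinity>"
      by (auto simp: power2_eq_square ennreal_mult_eq_top_iff less_top)
    interpret L: pair_sigma_finite lborel X ..
    let ?F = "\<lambda>s x. if 0 \<le> s \<and> s \<le> t then a (t - s) * Z (s, x) * \<phi> i x else 0"
    have int: "integrable (lborel \<Otimes>\<^sub>M X) (\<lambda>(s, x). ?F s x)"
    proof (rule integrableI_bounded)
      have "(\<integral>\<^sup>+z. ennreal (norm (case z of (s, x) \<Rightarrow> ?F s x)) \<partial>(lborel \<Otimes>\<^sub>M X)) = (\<integral>\<^sup>+s. \<integral>\<^sup>+x. ennreal \<bar>?F s x\<bar> \<partial>X \<partial>lborel)"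
        by (subst X.nn_integral_fst[symmetric]) auto
      also have "\<dots> = cvn (\<lambda>t. ennreal \<bar>a t\<bar>) N t"
        unfolding cvn_def
      proof (intro nn_integral_cong)
        fix s
        show "(\<integral>\<^sup>+x. ennreal \<bar>?F s x\<bar> \<partial>X) = (if 0 \<le> s \<and> s \<le> t then ennreal \<bar>a (t - s)\<bar> * N s else 0)"
          unfolding N_def by (auto simp: nn_integral_cmult[symmetric] abs_mult ennreal_mult mult.assoc intro!: nn_integral_cong)
      qed
      finally show "(\<integral>\<^sup>+z. ennreal (norm (case z of (s, x) \<Rightarrow> ?F s x)) \<partial>(lborel \<Otimes>\<^sub>M X)) < \<infinity>" using fin by simp
    qed measurable
    have "co (pcv a Z) i t = (LINT x|X. LINT s|lborel. ?F s x)"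
      unfolding co_def pcv_def cv_def fst_conv snd_conv
    proof (intro Bochner_Integration.integral_cong refl)
      fix x
      show "(LINT s|lborel. (if 0 \<le> s \<and> s \<le> t then a (t - s) * Z (s, x) else 0)) * \<phi> i x = (LINT s|lborel. ?F s x)"
        by (subst integral_mult_left_zero[symmetric], intro Bochner_Integration.integral_cong) auto
    qed
    also have "\<dots> = (LINT s|lborel. LINT x|X. ?F s x)" by (rule L.Fubini_integral[OF int])
    also have "\<dots> = cv a (co Z i) t"
      unfolding cv_def co_def
    proof (intro Bochner_Integration.integral_cong refl)
      fix s
      show "(LINT x|X. ?F s x) = (if 0 \<le> s \<and> s \<le> t then a (t - s) * (LINT x|X. Z (s, x) * \<phi> i x) else 0)"
        by (auto simp: mult.assoc)
    qed
    finally show ?case .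
  qed
qed

end

section \<open>The Dirichlet eigensystem\<close>

lemma L2_on_iff_l2: "L2_on S f \<longleftrightarrow> l2 (lebesgue_on S) f"
  by (simp add: L2_on_def l2_def)

lemma continuous_compact_support_l2:
  fixes g :: "'a::euclidean_space \<Rightarrow> real"
  assumes g: "continuous_on UNIV g" and K: "compact K" "\<And>x. x \<notin> K \<Longrightarrow> g x = 0"
    and S: "S \<in> sets borel" "K \<subseteq> S"
  shows "l2 (lebesgue_on S) g"
proof -
  have gm: "g \<in> borel_measurable borel" using g by (rule borel_measurable_continuous_onI)
  have "bounded ((\<lambda>x. (g x)\<^sup>2) ` K)"
    by (intro compact_imp_bounded compact_continuous_image continuous_intros continuous_on_subset[OF g] K) auto
  then obtain B where B: "\<And>x. x \<in> K \<Longrightarrow> norm ((g x)\<^sup>2) \<le> B"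
    unfolding bounded_iff by blast
  have "integrable lborel (\<lambda>x. indicator K x *\<^sub>R B)"
    using K emeasure_compact_finite[of K] by (intro integrable_indicator) (auto simp: compact_imp_closed)
  then have "integrable lborel (\<lambda>x. indicator S x * (g x)\<^sup>2)"
  proof (rule Bochner_Integration.integrable_bound)
    show "(\<lambda>x. indicator S x * (g x)\<^sup>2) \<in> borel_measurable lborel" using gm S by measurable
    have "norm (indicator S x * (g x)\<^sup>2) \<le> norm (indicator K x *\<^sub>R B)" for x
    proof (cases "x \<in> K")
      case True
      then show ?thesis using B[OF True] S(2) by (simp add: subset_iff)
    qed (simp add: K(2))
    then show "AE x in lborel. norm (indicator S x * (g x)\<^sup>2) \<le> norm (indicator K x *\<^sub>R B)" by simp
  qed
  then have "integrable (lbon S) (\<lambda>x. (g x)\<^sup>2)" using gm S by (subst integrable_lbon) auto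
  then have "integrable (lebesgue_on S) (\<lambda>x. (g x)\<^sup>2)"
    using gm S by (subst integral_lebesgue_on_borel(2)) auto
  moreover have "g \<in> borel_measurable (lebesgue_on S)" using gm by (intro measurable_restrict_space1 measurable_completion) auto
  ultimately show ?thesis by (simp add: l2_def)
qed

text \<open>The eigenvalue is the Dirichlet energy of its eigenfunction.\<close>
lemma dirichlet_eigenvalue_nonneg:
  fixes S :: "'a::euclidean_space set"
  assumes S: "S \<in> sets borel" and de: "dirichlet_eigensystem S lam phi"
  shows "0 \<le> lam i"
proof -
  let ?L = "lebesgue_on S"
  have "\<forall>i. \<exists>G. H10_with_grad S (phi i) G \<and> (\<forall>psi Gpsi. Cc1_on S psi Gpsi \<longrightarrow>
      integral\<^sup>L ?L (\<lambda>x. G x \<bullet> Gpsi x) = lam i * ip_on S (phi i) psi)"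
    using de unfolding dirichlet_eigensystem_def by (elim conjE)
  then obtain G where G: "H10_with_grad S (phi i) G"
    and weak: "\<And>psi Gpsi. Cc1_on S psi Gpsi \<Longrightarrow> integral\<^sup>L ?L (\<lambda>x. G x \<bullet> Gpsi x) = lam i * ip_on S (phi i) psi"
    by blast
  have "\<forall>i j. ip_on S (phi i) (phi j) = (if i = j then 1 else 0)"
    using de unfolding dirichlet_eigensystem_def by (elim conjE)
  then have "ip_on S (phi i) (phi i) = 1" by simp
  then have norm1: "integral\<^sup>L ?L (\<lambda>x. phi i x * phi i x) = 1" by (simp only: ip_on_def)
  \<comment> \<open>The weak equation may be tested only with compactly supported C1 functions, so
    the eigenfunction is inserted as a limit of such functions; both sides pass to the limit by
    Cauchy-Schwarz.\<close>
  obtain psi Gpsi where cc: "\<And>n. Cc1_on S (psi n) (Gpsi n)"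
    and l1: "(\<lambda>n. integral\<^sup>L ?L (\<lambda>x. (psi n x - phi i x)^2)) \<longlonglongrightarrow> 0"
    and l2: "(\<lambda>n. integral\<^sup>L ?L (\<lambda>x. (norm (Gpsi n x - G x))^2)) \<longlonglongrightarrow> 0"
    using G unfolding H10_with_grad_def by blast
  have pl: "l2 ?L (phi i)" using G by (simp add: H10_with_grad_def L2_on_iff_l2)
  have Gm: "G \<in> borel_measurable ?L" using G by (simp add: H10_with_grad_def)
  have Gl: "l2 ?L (\<lambda>x. norm (G x))" using G Gm by (simp add: H10_with_grad_def l2_def)
  have der: "(psi n has_derivative (\<lambda>h. Gpsi n x \<bullet> h)) (at x)" for n x
    using cc[of n] by (simp add: Cc1_on_def)
  have cG: "continuous_on UNIV (Gpsi n)" for n using cc[of n] by (simp add: Cc1_on_def)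
  have Gnm: "Gpsi n \<in> borel_measurable ?L" for n
    using borel_measurable_continuous_onI[OF cG[of n]] by (intro measurable_restrict_space1 measurable_completion) auto
  have psil: "l2 ?L (psi n)" and Gpl: "l2 ?L (\<lambda>x. norm (Gpsi n x))" for n
  proof -
    obtain K where K: "compact K" "K \<subseteq> S" "\<And>x. x \<notin> K \<Longrightarrow> psi n x = 0"
      using cc[of n] unfolding Cc1_on_def by blast
    have "continuous_on UNIV (psi n)"
      using der by (auto intro!: continuous_at_imp_continuous_on has_derivative_continuous)
    then show "l2 ?L (psi n)" by (rule continuous_compact_support_l2) (use K S in auto)
    \<comment> \<open>On the open complement of the support the function is locally 0, and
      derivatives are unique.\<close>
    have "Gpsi n x = 0" if x: "x \<notin> K" for x
    proof -
      have "((\<lambda>_. 0) has_derivative (\<lambda>h. Gpsi n x \<bullet> h)) (at x)"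
        by (rule has_derivative_transform_within_open[OF der, of "- K"]) (use K x in \<open>auto simp: compact_imp_closed open_Compl\<close>)
      moreover have "((\<lambda>_. 0) has_derivative (\<lambda>_. 0 :: real)) (at x)" by simp
      ultimately have "(\<lambda>h. Gpsi n x \<bullet> h) = (\<lambda>_. 0)" by (rule has_derivative_unique)
      from fun_cong[OF this, of "Gpsi n x"] show ?thesis by simp
    qed
    then show "l2 ?L (\<lambda>x. norm (Gpsi n x))"
      by (intro continuous_compact_support_l2[OF _ K(1)] continuous_on_norm cG) (use K S in auto)
  qed
  have Gdl: "l2 ?L (\<lambda>x. norm (Gpsi n x - G x))" for n
  proof -
    have "integrable ?L (\<lambda>x. (norm (Gpsi n x) + norm (G x))\<^sup>2)" by (rule l2_integrable[OF l2_add[OF Gpl[of n] Gl]])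
    then have "integrable ?L (\<lambda>x. (norm (Gpsi n x - G x))\<^sup>2)"
    proof (rule Bochner_Integration.integrable_bound)
      have "(norm (Gpsi n x - G x))\<^sup>2 \<le> (norm (Gpsi n x) + norm (G x))\<^sup>2" for x
        by (intro power_mono norm_triangle_ineq4) auto
      then show "AE x in ?L. norm ((norm (Gpsi n x - G x))\<^sup>2) \<le> norm ((norm (Gpsi n x) + norm (G x))\<^sup>2)" by simp
    qed (use Gm Gnm[of n] in measurable)
    then show ?thesis using Gm Gnm[of n] by (simp add: l2_def)
  qed
  have n1: "(\<lambda>n. n2 ?L (\<lambda>x. psi n x - phi i x)) \<longlonglongrightarrow> 0"
    using tendsto_real_sqrt[OF l1] by (simp add: n2_def)
  have n2: "(\<lambda>n. n2 ?L (\<lambda>x. norm (Gpsi n x - G x))) \<longlonglongrightarrow> 0"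
    using tendsto_real_sqrt[OF l2] by (simp add: n2_def)
  have c1: "(\<lambda>n. ip_on S (phi i) (psi n)) \<longlonglongrightarrow> 1"
  proof (rule LIM_zero_cancel, rule Lim_null_comparison)
    show "(\<lambda>n. n2 ?L (phi i) * n2 ?L (\<lambda>x. psi n x - phi i x)) \<longlonglongrightarrow> 0"
      using tendsto_mult[OF tendsto_const n1] by simp
    have "norm (ip_on S (phi i) (psi n) - 1) \<le> n2 ?L (phi i) * n2 ?L (\<lambda>x. psi n x - phi i x)" for n
    proof -
      have "ip_on S (phi i) (psi n) - 1 = integral\<^sup>L ?L (\<lambda>x. phi i x * psi n x - phi i x * phi i x)"
        using l2_mult_integrable[OF pl psil[of n]] l2_mult_integrable[OF pl pl] by (simp add: ip_on_def norm1)
      also have "\<dots> = integral\<^sup>L ?L (\<lambda>x. phi i x * (psi n x - phi i x))" by (simp add: right_diff_distrib)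
      finally show ?thesis using l2_Cauchy_Schwarz[OF pl l2_diff[OF psil[of n] pl]] by simp
    qed
    then show "eventually (\<lambda>n. norm (ip_on S (phi i) (psi n) - 1) \<le> n2 ?L (phi i) * n2 ?L (\<lambda>x. psi n x - phi i x)) sequentially" by simp
  qed
  have c2: "(\<lambda>n. integral\<^sup>L ?L (\<lambda>x. G x \<bullet> Gpsi n x)) \<longlonglongrightarrow> integral\<^sup>L ?L (\<lambda>x. (norm (G x))\<^sup>2)"
  proof (rule LIM_zero_cancel, rule Lim_null_comparison)
    show "(\<lambda>n. n2 ?L (\<lambda>x. norm (G x)) * n2 ?L (\<lambda>x. norm (Gpsi n x - G x))) \<longlonglongrightarrow> 0"
      using tendsto_mult[OF tendsto_const n2] by simp
    have "norm (integral\<^sup>L ?L (\<lambda>x. G x \<bullet> Gpsi n x) - integral\<^sup>L ?L (\<lambda>x. (norm (G x))\<^sup>2)) \<le> n2 ?L (\<lambda>x. norm (G x)) * n2 ?L (\<lambda>x. norm (Gpsi n x - G x))" for n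
    proof -
      have i1: "integrable ?L (\<lambda>x. G x \<bullet> Gpsi n x)"
        by (rule Bochner_Integration.integrable_bound[OF l2_mult_integrable[OF Gl Gpl[of n]]])
          (use Gm Gnm[of n] in \<open>auto simp: Cauchy_Schwarz_ineq2\<close>)
      have i3: "integrable ?L (\<lambda>x. norm (G x) * norm (Gpsi n x - G x))" by (rule l2_mult_integrable[OF Gl Gdl])
      have "integral\<^sup>L ?L (\<lambda>x. G x \<bullet> Gpsi n x) - integral\<^sup>L ?L (\<lambda>x. (norm (G x))\<^sup>2) = integral\<^sup>L ?L (\<lambda>x. G x \<bullet> Gpsi n x - (norm (G x))\<^sup>2)"
        using i1 l2_integrable[OF Gl] by simp
      also have "\<dots> = integral\<^sup>L ?L (\<lambda>x. G x \<bullet> (Gpsi n x - G x))" by (simp add: inner_diff_right power2_norm_eq_inner)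
      also have "norm \<dots> \<le> integral\<^sup>L ?L (\<lambda>x. norm (G x \<bullet> (Gpsi n x - G x)))" by (rule integral_norm_bound)
      also have "\<dots> \<le> integral\<^sup>L ?L (\<lambda>x. norm (G x) * norm (Gpsi n x - G x))"
      proof (rule integral_mono)
        show "integrable ?L (\<lambda>x. norm (G x \<bullet> (Gpsi n x - G x)))"
          by (rule Bochner_Integration.integrable_bound[OF i3])
            (use Gm Gnm[of n] in \<open>auto simp: Cauchy_Schwarz_ineq2\<close>)
      qed (use i3 in \<open>auto simp: Cauchy_Schwarz_ineq2\<close>)
      also have "\<dots> \<le> n2 ?L (\<lambda>x. norm (G x)) * n2 ?L (\<lambda>x. norm (Gpsi n x - G x))"
        using l2_Cauchy_Schwarz[OF Gl Gdl[of n]] by simp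
      finally show ?thesis .
    qed
    then show "eventually (\<lambda>n. norm (integral\<^sup>L ?L (\<lambda>x. G x \<bullet> Gpsi n x) - integral\<^sup>L ?L (\<lambda>x. (norm (G x))\<^sup>2))
      \<le> n2 ?L (\<lambda>x. norm (G x)) * n2 ?L (\<lambda>x. norm (Gpsi n x - G x))) sequentially" by simp
  qed
  have "(\<lambda>n. integral\<^sup>L ?L (\<lambda>x. G x \<bullet> Gpsi n x)) \<longlonglongrightarrow> lam i * 1"
    unfolding weak[OF cc] by (intro tendsto_intros c1)
  from LIMSEQ_unique[OF this c2] have "lam i = integral\<^sup>L ?L (\<lambda>x. (norm (G x))\<^sup>2)" by simp
  then show ?thesis by simp
qed

lemma l2_lebesgue_on_cong:
  fixes f g :: "'a::euclidean_space \<Rightarrow> real"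
  assumes S: "S \<in> sets borel" and g: "g \<in> borel_measurable borel" and ae: "AE x in lbon S. f x = g x"
  shows "l2 (lebesgue_on S) f \<longleftrightarrow> l2 (lbon S) g" "n2 (lebesgue_on S) f = n2 (lbon S) g"
proof -
  have ae2: "AE x in lbon S. (f x)\<^sup>2 = (g x)\<^sup>2" using ae by eventually_elim simp
  have gm: "(\<lambda>x. (g x)\<^sup>2) \<in> borel_measurable borel" using g by measurable
  show "l2 (lebesgue_on S) f \<longleftrightarrow> l2 (lbon S) g"
    using borel_measurable_lebesgue_onI[OF S g ae] integral_lebesgue_on_cong(2)[OF S gm ae2] g by (simp add: l2_def)
  show "n2 (lebesgue_on S) f = n2 (lbon S) g"
    using integral_lebesgue_on_cong(1)[OF S gm ae2] by (simp add: n2_def)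
qed

lemma ip_on_cong:
  fixes f g :: "'a::euclidean_space \<Rightarrow> real"
  assumes S: "S \<in> sets borel" and m: "f' \<in> borel_measurable borel" "g' \<in> borel_measurable borel"
    and ae: "AE x in lbon S. f x = f' x" "AE x in lbon S. g x = g' x"
  shows "ip_on S f g = (LINT x|lbon S. f' x * g' x)"
proof -
  have "AE x in lbon S. f x * g x = f' x * g' x" using ae by eventually_elim simp
  then show ?thesis unfolding ip_on_def by (intro integral_lebesgue_on_cong(1)[OF S]) (use m in auto)
qed

text \<open>Both versions of the eigenfunctions are kept: \<open>phi\<close> is the given one,
  Lebesgue measurable on \<open>S\<close>, and \<open>\<phi>\<close> a Borel representative, for
  which products with functions of time are measurable.\<close>

locale dirichlet_expansion = expansion "lbon S" T \<phi>
  for S :: "'a::euclidean_space set" and T :: real and \<phi> :: "nat \<Rightarrow> 'a \<Rightarrow> real" +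
  fixes phi :: "nat \<Rightarrow> 'a \<Rightarrow> real" and lam :: "nat \<Rightarrow> real"
  assumes S_borel: "S \<in> sets borel"
    and phi_rep: "AE x in lbon S. phi i x = \<phi> i x"
    and lam_nonneg: "0 \<le> lam i"

lemma dirichlet_expansion_exists:
  fixes S :: "'a::euclidean_space set"
  assumes S: "S \<in> sets borel" and de: "dirichlet_eigensystem S lam phi"
  obtains \<phi> where "dirichlet_expansion S \<phi> phi lam"
proof -
  have L2: "L2_on S (phi i)" for i
  proof -
    have "\<forall>i. \<exists>G. H10_with_grad S (phi i) G \<and> (\<forall>psi Gpsi. Cc1_on S psi Gpsi \<longrightarrow>
      integral\<^sup>L (lebesgue_on S) (\<lambda>x. G x \<bullet> Gpsi x) = lam i * ip_on S (phi i) psi)"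
      using de unfolding dirichlet_eigensystem_def by (elim conjE)
    then show ?thesis unfolding H10_with_grad_def by blast
  qed
  have "\<exists>g. g \<in> borel_measurable borel \<and> (AE x in lbon S. phi i x = g x)" for i
    using L2[of i] lebesgue_on_borel_rep[OF S, of "phi i"] by (metis L2_on_def)
  then obtain \<phi> where \<phi>: "\<And>i. \<phi> i \<in> borel_measurable borel" "\<And>i. AE x in lbon S. phi i x = \<phi> i x" by metis
  have "dirichlet_expansion S \<phi> phi lam"
  proof (intro dirichlet_expansion.intro expansion.intro sigma_finite_lbon S dirichlet_expansion_axioms.intro expansion_axioms.intro)
    show "l2 (lbon S) (\<phi> i)" for i
      using L2[of i] l2_lebesgue_on_cong(1)[OF S \<phi>(1,2), of i] by (simp add: L2_on_iff_l2)
    have "\<forall>i j. ip_on S (phi i) (phi j) = (if i = j then 1 else 0)"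
      using de unfolding dirichlet_eigensystem_def by (elim conjE)
    then show "(LINT x|lbon S. \<phi> i x * \<phi> j x) = (if i = j then 1 else 0)" for i j
      unfolding ip_on_cong[OF S \<phi>(1)[of i] \<phi>(1)[of j] \<phi>(2) \<phi>(2), symmetric] by blast
    show "AE x in lbon S. f x = 0" if f: "l2 (lbon S) f" "\<And>i. (LINT x|lbon S. f x * \<phi> i x) = 0" for f
    proof -
      have fm: "f \<in> borel_measurable borel" using f(1) by (auto simp: l2_def)
      have "L2_on S f" using f(1) l2_lebesgue_on_cong(1)[OF S fm, of f] by (simp add: L2_on_iff_l2)
      moreover have "ip_on S f (phi i) = 0" for i
        using ip_on_cong[OF S fm \<phi>(1)[of i] _ \<phi>(2), of f] f(2) by simp
      moreover have "\<forall>f. L2_on S f \<longrightarrow> (\<forall>i. ip_on S f (phi i) = 0) \<longrightarrow> (AE x in lebesgue_on S. f x = 0)"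
        using de unfolding dirichlet_eigensystem_def by (elim conjE)
      ultimately have "AE x in lebesgue_on S. f x = 0" by blast
      then show ?thesis by (simp add: AE_lebesgue_on S)
    qed
    show "0 \<le> lam i" for i by (rule dirichlet_eigenvalue_nonneg[OF S de])
  qed (rule \<phi>)
  then show thesis by (rule that)
qed

section \<open>Existence and uniqueness\<close>

lemma cv_zero_time: "cv a b 0 = 0"
proof -
  have "AE s in lborel. s \<noteq> (0::real)" by (rule AE_lborel_singleton)
  then have "AE s in lborel. (if 0 \<le> s \<and> s \<le> 0 then a (0 - s) * b s else 0) = (0::real)"
    by eventually_elim auto
  then show ?thesis unfolding cv_def by (rule integral_eq_zero_AE)
qed

text \<open>The bridge from the memory integral of the statement to \<open>cv\<close>: the integrand
  \<open>f\<close> may deviate from \<open>g\<close> on a null set, and the kernel \<open>h\<close>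
  is consulted only at arguments in \<open>{0..t}\<close>.\<close>

lemma integral_lebesgue_on_eq_cv:
  assumes [measurable]: "a \<in> borel_measurable borel" "g \<in> borel_measurable borel"
    and ae: "AE s in lbon {0..T}. f s = g s" and t: "t \<le> T" and h: "\<And>s. s \<in> {0..t} \<Longrightarrow> h (t - s) = a (t - s)"
  shows "integral\<^sup>L (lebesgue_on {0..t}) (\<lambda>s. h (t - s) * f s) = cv a g t"
proof -
  have "AE s in lbon {0..t}. h (t - s) * f s = a (t - s) * g s"
    using ae unfolding AE_lbon[OF atLeastAtMost_borel] by eventually_elim (use t h in auto)
  then have "integral\<^sup>L (lebesgue_on {0..t}) (\<lambda>s. h (t - s) * f s) = integral\<^sup>L (lbon {0..t}) (\<lambda>s. a (t - s) * g s)"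
    by (rule integral_lebesgue_on_cong(1)[rotated 2]) measurable
  also have "\<dots> = cv a g t"
    unfolding cv_def by (subst integral_lbon, simp, measurable, intro Bochner_Integration.integral_cong refl) (simp add: indicator_def)
  finally show ?thesis .
qed

lemma integral_lebesgue_on_eq_cv_one:
  assumes "g \<in> borel_measurable borel" "AE s in lbon {0..T}. f s = g s" "t \<le> T"
  shows "integral\<^sup>L (lebesgue_on {0..t}) f = cv (\<lambda>_. 1) g t"
  using integral_lebesgue_on_eq_cv[OF _ assms, of "\<lambda>_. 1" "\<lambda>_. 1"] by simp

lemma suminf_sq_l2:
  assumes y: "\<And>i. l2 M (y i)" and sm: "summable (\<lambda>i. (n2 M (y i))\<^sup>2)"
  shows "AE t in M. summable (\<lambda>i. (y i t)\<^sup>2)" "integrable M (\<lambda>t. \<Sum>i. (y i t)\<^sup>2)"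
    "(LINT t|M. (\<Sum>i. (y i t)\<^sup>2)) = (\<Sum>i. (n2 M (y i))\<^sup>2)"
proof -
  have [measurable]: "y i \<in> borel_measurable M" for i using y[of i] by (simp add: l2_def)
  have "(\<integral>\<^sup>+t. (\<Sum>i. ennreal ((y i t)\<^sup>2)) \<partial>M) = (\<Sum>i. \<integral>\<^sup>+t. ennreal ((y i t)\<^sup>2) \<partial>M)"
    by (rule nn_integral_suminf) measurable
  also have "\<dots> = (\<Sum>i. ennreal ((n2 M (y i))\<^sup>2))" by (simp add: nn_integral_l2[OF y])
  also have "\<dots> = ennreal (\<Sum>i. (n2 M (y i))\<^sup>2)" by (rule suminf_ennreal2[OF _ sm]) simp
  finally have "(\<integral>\<^sup>+t. (\<Sum>i. ennreal ((y i t)\<^sup>2)) \<partial>M) \<noteq> \<infinity>" by simp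
  then have "AE t in M. (\<Sum>i. ennreal ((y i t)\<^sup>2)) \<noteq> \<infinity>"
    by (intro nn_integral_PInf_AE) measurable
  then show ae: "AE t in M. summable (\<lambda>i. (y i t)\<^sup>2)"
    by eventually_elim (auto intro: summable_suminf_not_top)
  have ae': "AE t in M. summable (\<lambda>i. norm ((y i t)\<^sup>2))" using ae by simp
  have i: "integrable M (\<lambda>t. (y i t)\<^sup>2)" for i by (rule l2_integrable[OF y])
  have sm': "summable (\<lambda>i. LINT t|M. norm ((y i t)\<^sup>2))" using sm by (simp add: n2_sq)
  show "integrable M (\<lambda>t. \<Sum>i. (y i t)\<^sup>2)" by (rule integrable_suminf[OF i ae' sm'])
  show "(LINT t|M. (\<Sum>i. (y i t)\<^sup>2)) = (\<Sum>i. (n2 M (y i))\<^sup>2)"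
    using integral_suminf[OF i ae' sm'] by (simp add: n2_sq)
qed

section \<open>Assembling the modes into functions on space-time\<close>

context expansion begin

text \<open>The time derivative is defined along almost every point \<open>x\<close>, whereas
  coefficients live at almost every time \<open>t\<close>; null sets therefore have to be read in
  both orders.\<close>

lemma AE_pair_swap: "AE z in P. Q z \<Longrightarrow> AE x in X. AE t in Mt. Q (t, x)"
proof -
  assume "AE z in P. Q z"
  then have "AE z in distr (X \<Otimes>\<^sub>M Mt) P (\<lambda>(x, y). (y, x)). Q z" by (subst (asm) distr_pair_swap)
  from AE_distrD[OF _ this] have "AE z in X \<Otimes>\<^sub>M Mt. Q (snd z, fst z)" by (simp add: case_prod_unfold)
  interpret Q: pair_sigma_finite X Mt ..
  from Q.AE_pair[OF \<open>AE z in X \<Otimes>\<^sub>M Mt. Q (snd z, fst z)\<close>] show ?thesis by simp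
qed

lemma AE_pairI:
  assumes [measurable]: "U \<in> borel_measurable P" "V \<in> borel_measurable P"
    and ae: "AE x in X. AE t in Mt. U (t, x) = (V (t, x) :: real)"
  shows "AE z in P. U z = V z"
proof (rule AE_pair_measure)
  show m: "{z \<in> space P. U z = V z} \<in> sets P" by measurable
  have "(AE t in Mt. AE x in X. U (t, x) = V (t, x)) \<longleftrightarrow> (AE x in X. AE t in Mt. U (t, x) = V (t, x))"
    by (rule AE_commute) (use m in simp)
  with ae show "AE t in Mt. AE x in X. U (t, x) = V (t, x)" by simp
qed

lemma co_cong_AE:
  assumes "U \<in> borel_measurable P" "V \<in> borel_measurable P" "AE z in P. U z = V z"
  shows "AE t in Mt. co U i t = co V i t"
  using AE_pair[OF assms(3)] AE_space
proof eventually_elim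
  case (elim t)
  have [measurable]: "U \<in> borel_measurable P" "V \<in> borel_measurable P" by fact+
  show ?case unfolding co_def
    by (rule integral_cong_AE) (use elim in \<open>auto elim!: eventually_mono\<close>)
qed

text \<open>The function \<open>Z\<close> gets a series of its own: with unbounded eigenvalues,
  square summability of the \<open>lam i * cv (beta_k a) (w i)\<close> does not follow from that of
  the \<open>w i\<close>, but each sequence is bounded separately by the uniform constant.\<close>

lemma modes_solvable:
  assumes a: "0 < a" "a < 1" and m: "integrable Mt (m :: real \<Rightarrow> real)"
    and lam: "\<And>i. 0 \<le> lam i" and C: "0 < C"
    and mode: "\<And>\<mu> f. 0 \<le> \<mu> \<Longrightarrow> l2 Mt f \<Longrightarrow> \<exists>w. l2 Mt w \<and>
      (AE t in Mt. w t + \<mu> * cv (beta_k a) w t + cv m (\<lambda>t. \<mu> * cv (beta_k a) w t) t = f t) \<and>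
      n2 Mt w \<le> C * n2 Mt f \<and> n2 Mt (\<lambda>t. \<mu> * cv (beta_k a) w t) \<le> C * n2 Mt f"
    and F: "l2 P F"
  obtains W Z where "l2 P W" "l2 P Z" "n2 P W \<le> C * n2 P F" "n2 P Z \<le> C * n2 P F"
    "AE z in P. W z + Z z + pcv m Z z = F z"
    "\<And>i. AE t in Mt. lam i * cv (\<lambda>_. 1) (co W i) t = cv (beta_k (1 - a)) (co Z i) t"
proof -
  let ?b = "beta_k a" and ?b' = "beta_k (1 - a)" and ?o = "\<lambda>_::real. 1::real"
  have bi: "integrable Mt ?b" "integrable Mt ?b'" using a by (auto intro: beta_k_integrable)
  have Fi: "l2 Mt (co F i)" for i by (rule co_l2[OF F])
  define w where "w i = (SOME w. l2 Mt w \<and>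
      (AE t in Mt. w t + lam i * cv ?b w t + cv m (\<lambda>t. lam i * cv ?b w t) t = co F i t) \<and>
      n2 Mt w \<le> C * n2 Mt (co F i) \<and> n2 Mt (\<lambda>t. lam i * cv ?b w t) \<le> C * n2 Mt (co F i))" for i
  have w: "l2 Mt (w i)" "AE t in Mt. w i t + lam i * cv ?b (w i) t + cv m (\<lambda>t. lam i * cv ?b (w i) t) t = co F i t"
      "n2 Mt (w i) \<le> C * n2 Mt (co F i)" "n2 Mt (\<lambda>t. lam i * cv ?b (w i) t) \<le> C * n2 Mt (co F i)" for i
    using someI_ex[OF mode[OF lam[of i] Fi[of i]]] unfolding w_def[symmetric] by blast+
  define z where "z i t = lam i * cv ?b (w i) t" for i t
  have zl: "l2 Mt (z i)" for i unfolding z_def[abs_def] by (intro l2_cmult cv_l2 bi w)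
  have [measurable]: "w i \<in> borel_measurable borel" "z i \<in> borel_measurable borel" for i
    using w(1)[of i] zl[of i] by (auto simp: l2_def)
  have [measurable]: "m \<in> borel_measurable borel" using m by auto
  \<comment> \<open>Here uniformity in the eigenvalue is decisive: with a single \<open>C\<close>,
    Bessel's inequality for \<open>F\<close> sums the bounds of all modes.\<close>
  have bound: "summable (\<lambda>i. (n2 Mt (y i))\<^sup>2)" "(\<Sum>i. (n2 Mt (y i))\<^sup>2) \<le> (C * n2 P F)\<^sup>2"
    if "\<And>i. n2 Mt (y i) \<le> C * n2 Mt (co F i)" for y
  proof -
    have le: "(n2 Mt (y i))\<^sup>2 \<le> C\<^sup>2 * (n2 Mt (co F i))\<^sup>2" for i
      using power_mono[OF that[of i], of 2] by (simp add: power_mult_distrib)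
    have sF: "summable (\<lambda>i. C\<^sup>2 * (n2 Mt (co F i))\<^sup>2)" by (intro summable_mult bessel F)
    show s: "summable (\<lambda>i. (n2 Mt (y i))\<^sup>2)" by (rule summable_comparison_test'[OF sF, of 0]) (use le in simp)
    have "(\<Sum>i. (n2 Mt (y i))\<^sup>2) \<le> (\<Sum>i. C\<^sup>2 * (n2 Mt (co F i))\<^sup>2)" by (rule suminf_le[OF le s sF])
    also have "\<dots> = C\<^sup>2 * (\<Sum>i. (n2 Mt (co F i))\<^sup>2)" by (rule suminf_mult[OF bessel(1)[OF F]])
    also have "\<dots> \<le> C\<^sup>2 * (n2 P F)\<^sup>2" by (intro mult_left_mono bessel F) simp
    finally show "(\<Sum>i. (n2 Mt (y i))\<^sup>2) \<le> (C * n2 P F)\<^sup>2" by (simp add: power_mult_distrib)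
  qed
  obtain W where W: "l2 P W" "\<And>i. AE t in Mt. co W i t = w i t" "(n2 P W)\<^sup>2 \<le> (\<Sum>i. (n2 Mt (w i))\<^sup>2)"
    using series_exists[of w] w(1) bound(1)[of w] w(3) by blast
  obtain Z where Z: "l2 P Z" "\<And>i. AE t in Mt. co Z i t = z i t" "(n2 P Z)\<^sup>2 \<le> (\<Sum>i. (n2 Mt (z i))\<^sup>2)"
    using series_exists[of z] zl bound(1)[of z] w(4) unfolding z_def[abs_def] by blast
  have [measurable]: "W \<in> borel_measurable P" "Z \<in> borel_measurable P" using W Z by (auto simp: l2_def)
  have nW: "n2 P W \<le> C * n2 P F"
    by (rule power2_le_imp_le[OF order_trans[OF W(3) bound(2)[of w]]]) (use w C in auto)
  have nZ: "n2 P Z \<le> C * n2 P F"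
    by (rule power2_le_imp_le[OF order_trans[OF Z(3) bound(2)[of z]]]) (use w(4) C in \<open>auto simp: z_def[abs_def]\<close>)
  have mZ: "l2 P (pcv m Z)" by (rule pcv_l2(1)[OF m Z(1)])
  \<comment> \<open>The residual is written as nested linear combinations, so that its coefficients
    reduce to the scalar equations.\<close>
  have eq: "AE y in P. W y + Z y + pcv m Z y = F y"
  proof -
    let ?V = "\<lambda>y. 1 * W y + 1 * Z y" and ?V' = "\<lambda>y. 1 * pcv m Z y + (-1) * F y"
    have V: "l2 P ?V" "l2 P ?V'" by (intro l2_lincomb W Z mZ F)+
    have "AE y in P. 1 * ?V y + 1 * ?V' y = 0"
    proof (rule co_zero_imp_zero[OF l2_lincomb[OF V]])
      fix i
      have "AE t in Mt. cv m (co Z i) t = cv m (z i) t"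
        unfolding AE_lbon[OF atLeastAtMost_borel]
      proof (rule AE_I2, intro impI)
        fix t :: real assume "t \<in> {0..T}"
        then show "cv m (co Z i) t = cv m (z i) t" by (intro cv_cong_AE[OF _ _ _ Z(2)]) auto
      qed
      with co_lincomb[OF V, of 1 1 i] co_lincomb[OF W(1) Z(1), of 1 1 i] co_lincomb[OF mZ F, of 1 "-1" i]
        W(2)[of i] Z(2)[of i] co_pcv[OF m Z(1), of i] w(2)[of i]
      show "AE t in Mt. co (\<lambda>y. 1 * ?V y + 1 * ?V' y) i t = 0"
      proof eventually_elim
        case (elim t)
        have "co (\<lambda>y. 1 * ?V y + 1 * ?V' y) i t = 1 * (1 * co W i t + 1 * co Z i t) + 1 * (1 * co (pcv m Z) i t + (-1) * co F i t)"
          using elim(1-3) by metis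
        then show ?case using elim(4-) by (simp add: z_def[abs_def])
      qed
    qed
    then show ?thesis by eventually_elim simp
  qed
  \<comment> \<open>Convolving \<open>z i\<close> with the complementary kernel gives
    \<open>lam i\<close> times the convolution of \<open>w i\<close> with 1; this recovers the
    Laplacian from \<open>Z\<close>.\<close>
  have rel: "AE t in Mt. lam i * cv ?o (co W i) t = cv ?b' (co Z i) t" for i
    using cv_assoc_AE[OF bi(2,1) l2_integrable1[OF w(1)[of i]]] unfolding AE_lbon[OF atLeastAtMost_borel]
  proof eventually_elim
    case (elim t)
    show ?case
    proof
      assume t: "t \<in> {0..T}"
      then have tT: "t \<le> T" by simp
      have "cv ?b' (co Z i) t = cv ?b' (z i) t" by (rule cv_cong_AE[OF _ _ _ Z(2) tT]) measurable
      also have "\<dots> = lam i * cv ?b' (cv ?b (w i)) t" unfolding z_def[abs_def] by (rule cv_cmult_right)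
      also have "cv ?b' (cv ?b (w i)) t = cv (cv ?b' ?b) (w i) t" using elim t by simp
      also have "\<dots> = cv (w i) (cv ?b' ?b) t" by (rule cv_commute)
      also have "\<dots> = cv (w i) ?o t"
      proof (rule cv_cong_AE[OF _ _ _ _ tT])
        have "AE s in lborel. s \<noteq> (0::real)" by (rule AE_lborel_singleton)
        then show "AE s in Mt. cv ?b' ?b s = 1"
          unfolding AE_lbon[OF atLeastAtMost_borel] by eventually_elim (use a in \<open>auto simp: cv_beta_k_complementary\<close>)
      qed measurable
      also have "\<dots> = cv ?o (w i) t" by (rule cv_commute)
      also have "\<dots> = cv ?o (co W i) t" by (rule cv_cong_AE[OF _ _ _ _ tT, symmetric]) (use W(2) in auto)
      finally show "lam i * cv ?o (co W i) t = cv ?b' (co Z i) t" by simp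
    qed
  qed
  show thesis by (rule that[OF W(1) Z(1) nW nZ eq rel])
qed

end

section \<open>Solutions and their Borel representatives\<close>

context dirichlet_expansion begin

lemma P_eq: "P = lbon ({0..T} \<times> S)" by (rule lbon_pair) (use S_borel in auto)

lemma TS_borel: "{0..T} \<times> S \<in> sets borel" by (rule borel_Times) (use S_borel in auto)

lemma measurable_P_iff: "U \<in> borel_measurable P \<longleftrightarrow> U \<in> borel_measurable borel"
  unfolding P_eq by (simp cong: measurable_cong_sets)

lemma phi_borel: "\<phi> i \<in> borel_measurable borel"
  using phi_measurable[of i] by (simp cong: measurable_cong_sets)

lemma L2L2_rep:
  assumes "L2L2 T S u"
  obtains U where "l2 P U" "AE z in P. u (fst z) (snd z) = U z" "L2L2_norm T S u = n2 P U"
proof -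
  have l: "l2 (lebesgue_on ({0..T} \<times> S)) (\<lambda>z. u (fst z) (snd z))" using assms by (simp add: L2L2_def L2_on_iff_l2)
  obtain U where U: "U \<in> borel_measurable borel" "AE z in lbon ({0..T} \<times> S). u (fst z) (snd z) = U z"
    by (rule lebesgue_on_borel_rep[OF TS_borel l2_measurable[OF l]])
  show thesis
  proof (rule that[of U], unfold P_eq)
    show "l2 (lbon ({0..T} \<times> S)) U" "L2L2_norm T S u = n2 (lbon ({0..T} \<times> S)) U"
      using l l2_lebesgue_on_cong[OF TS_borel U] by (auto simp: L2L2_norm_def n2_def)
  qed (rule U)
qed

lemma L2L2_I:
  assumes U: "l2 P U" and ae: "AE z in P. u (fst z) (snd z) = U z"
  shows "L2L2 T S u" "L2L2_norm T S u = n2 P U"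
proof -
  have "U \<in> borel_measurable borel" using U unfolding measurable_P_iff[symmetric] by (simp add: l2_def)
  note c = l2_lebesgue_on_cong[OF TS_borel this ae[unfolded P_eq]]
  show "L2L2 T S u" "L2L2_norm T S u = n2 P U"
    using c U[unfolded P_eq] unfolding P_eq by (auto simp: L2L2_def L2_on_iff_l2 L2L2_norm_def n2_def)
qed

lemma slice_L2_on:
  assumes U: "l2 P U" and ae: "AE z in P. u (fst z) (snd z) = U z"
  shows "AE t in Mt. L2_on S (u t) \<and> (\<forall>i. ip_on S (u t) (phi i) = co U i t)"
  using slice_l2_AE(1)[OF U] AE_pair[OF ae]
proof eventually_elim
  case (elim t)
  have m: "(\<lambda>x. U (t, x)) \<in> borel_measurable borel" using elim(1) by (auto simp: l2_def)
  have ae': "AE x in lbon S. u t x = U (t, x)" using elim(2) by simp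
  show ?case
    using elim(1) l2_lebesgue_on_cong(1)[OF S_borel m ae'] ip_on_cong[OF S_borel m phi_borel ae' phi_rep]
    by (simp add: L2_on_iff_l2 co_def)
qed

end

lemma integrable_lebesgue_on_Icc_subset:
  assumes g: "integrable (lbon {0..T::real}) (g :: real \<Rightarrow> real)" and t: "t \<le> T"
  shows "integrable (lebesgue_on {0..t}) g"
proof -
  have [measurable]: "g \<in> borel_measurable borel" using g by auto
  have "integrable lborel (\<lambda>s. indicator {0..T} s * g s)" using g by (simp add: integrable_lbon)
  then have "integrable lborel (\<lambda>s. indicator {0..t} s * g s)"
    by (rule Bochner_Integration.integrable_bound) (use t in \<open>auto simp: indicator_def\<close>)
  then have "integrable (lbon {0..t}) g" by (simp add: integrable_lbon)
  then show ?thesis by (simp add: integral_lebesgue_on_borel(2))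
qed

context dirichlet_expansion begin

lemma one_integrable: "integrable Mt (\<lambda>_. 1)" by simp

lemma AE_P_iff: "(AE z in P. Q z) \<longleftrightarrow> (AE z in lebesgue_on ({0..T} \<times> S). Q z)"
  unfolding P_eq by (rule AE_lebesgue_on[OF TS_borel, symmetric])

lemma AE_P_time: "AE z in P. fst z \<in> {0..T}"
  unfolding P_eq AE_lbon[OF TS_borel] by auto

lemma section_borel: "U \<in> borel_measurable P \<Longrightarrow> (\<lambda>s. U (s, x)) \<in> borel_measurable borel"
  by (rule slice_measurable) auto

lemma solution_exists:
  assumes T: "0 < T" and a: "0 < a" "a < 1"
    and k: "integrable Mt k" and m: "integrable Mt m"
    and k\<alpha>: "\<And>t. t \<in> {0..T} \<Longrightarrow> k t = vo_kernel \<alpha> t"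
    and inv: "\<And>z t. integrable Mt z \<Longrightarrow> t \<in> {0..T} \<Longrightarrow>
      cv k (cv (beta_k (1 - a)) z) t = cv (\<lambda>_. 1) (\<lambda>s. z s + cv m z s) t"
    and C: "0 < C"
    and mode: "\<And>\<mu> f. 0 \<le> \<mu> \<Longrightarrow> l2 Mt f \<Longrightarrow> \<exists>w. l2 Mt w \<and>
      (AE t in Mt. w t + \<mu> * cv (beta_k a) w t + cv m (\<lambda>t. \<mu> * cv (beta_k a) w t) t = f t) \<and>
      n2 Mt w \<le> C * n2 Mt f \<and> n2 Mt (\<lambda>t. \<mu> * cv (beta_k a) w t) \<le> C * n2 Mt f"
    and f: "L2L2 T S f"
  shows "\<exists>u ut. state_solution S lam phi \<alpha> T f u ut \<and>
    H1L2_norm T S u ut + L2checkH2_norm T S lam phi u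
      \<le> (((LINT t|Mt. \<bar>1\<bar>) + 1 + (LINT t|Mt. \<bar>beta_k (1 - a) t\<bar>)) * C) * L2L2_norm T S f"
proof -
  let ?o = "\<lambda>_::real. 1::real" and ?b' = "beta_k (1 - a)"
  obtain F where F: "l2 P F" "AE z in P. f (fst z) (snd z) = F z" "L2L2_norm T S f = n2 P F"
    by (rule L2L2_rep[OF f])
  obtain W Z where W: "l2 P W" and Z: "l2 P Z" and nW: "n2 P W \<le> C * n2 P F" and nZ: "n2 P Z \<le> C * n2 P F"
    and eq: "AE z in P. W z + Z z + pcv m Z z = F z"
    and rel: "\<And>i. AE t in Mt. lam i * cv ?o (co W i) t = cv ?b' (co Z i) t"
    using modes_solvable[where lam = lam, OF a m lam_nonneg C mode F(1)] by blast
  have bi: "integrable Mt ?b'" using a by (auto intro: beta_k_integrable)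
  have [measurable]: "k \<in> borel_measurable borel" "m \<in> borel_measurable borel" "W \<in> borel_measurable P" "Z \<in> borel_measurable P"
    using k m W Z by (auto simp: l2_def)
  have Wb[measurable]: "(\<lambda>s. W (s, x)) \<in> borel_measurable borel" and Zb[measurable]: "(\<lambda>s. Z (s, x)) \<in> borel_measurable borel" for x
    by (rule section_borel; measurable)+
  \<comment> \<open>The memory integral of \<open>Lu\<close> is minus \<open>k * ?b' * Z\<close>,
    and \<open>inv\<close> turns this into minus the time integral of \<open>Z + m * Z\<close>.
    Hence \<open>D\<close> is its derivative, and \<open>ut - D\<close> is the left side of
    \<open>eq\<close>.\<close>
  define u where "u t x = cv ?o (\<lambda>s. W (s, x)) t" for t x
  define ut where "ut t x = W (t, x)" for t x
  define Lu where "Lu t x = - cv ?b' (\<lambda>s. Z (s, x)) t" for t x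
  define D where "D t x = - (Z (t, x) + cv m (\<lambda>s. Z (s, x)) t)" for t x
  let ?U = "pcv ?o W" and ?L = "\<lambda>z. - pcv ?b' Z z" and ?D = "\<lambda>z. - (Z z + pcv m Z z)"
  have Ul: "l2 P ?U" and bZ: "l2 P (pcv ?b' Z)" and mZ: "l2 P (pcv m Z)"
    by (intro pcv_l2 one_integrable bi m W Z)+
  have Ll: "l2 P ?L" and Dl: "l2 P ?D" by (intro l2_minus l2_add bZ Z mZ)+
  have uU: "AE z in P. u (fst z) (snd z) = ?U z" by (simp add: u_def pcv_def)
  have LuL: "AE z in P. Lu (fst z) (snd z) = ?L z" by (simp add: Lu_def pcv_def)
  have DD: "AE z in P. D (fst z) (snd z) = ?D z" by (simp add: D_def pcv_def)
  have utW: "AE z in P. ut (fst z) (snd z) = W z" by (simp add: ut_def)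
  have Lb[measurable]: "(\<lambda>s. Lu s x) \<in> borel_measurable borel" for x unfolding Lu_def by measurable
  have Db[measurable]: "(\<lambda>s. D s x) \<in> borel_measurable borel" for x unfolding D_def by measurable
  have 1: "has_time_deriv_L2L2 T S u ut"
    unfolding has_time_deriv_L2L2_def
  proof (intro conjI)
    show "L2L2 T S u" by (rule L2L2_I(1)[OF Ul uU])
    show "L2L2 T S ut" by (rule L2L2_I(1)[OF W utW])
    show "AE x in lebesgue_on S. \<forall>t\<in>{0..T}. integrable (lebesgue_on {0..t}) (\<lambda>s. ut s x) \<and>
      u t x = u 0 x + integral\<^sup>L (lebesgue_on {0..t}) (\<lambda>s. ut s x)"
      unfolding AE_lebesgue_on[OF S_borel] using slice_l2_AE(2)[OF W]
    proof eventually_elim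
      case (elim x)
      show ?case
      proof (intro ballI conjI)
        fix t assume t: "t \<in> {0..T}"
        then have tT: "t \<le> T" by simp
        show "integrable (lebesgue_on {0..t}) (\<lambda>s. ut s x)" unfolding ut_def
          by (rule integrable_lebesgue_on_Icc_subset[OF l2_integrable1[OF elim] tT])
        show "u t x = u 0 x + integral\<^sup>L (lebesgue_on {0..t}) (\<lambda>s. ut s x)"
          unfolding u_def ut_def cv_zero_time using integral_lebesgue_on_eq_cv_one[OF Wb[of x] _ tT] by simp
      qed
    qed
  qed
  have v: "integral\<^sup>L (lebesgue_on {0..t}) (\<lambda>s. vo_kernel \<alpha> (t - s) * Lu s x) = cv k (\<lambda>s. Lu s x) t" if t: "t \<in> {0..T}" for t x
    by (rule integral_lebesgue_on_eq_cv[where a = k and T = T]) (use t k\<alpha> in auto)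
  have 2: "has_time_deriv_L2L2 T S (\<lambda>t x. integral\<^sup>L (lebesgue_on {0..t}) (\<lambda>s. vo_kernel \<alpha> (t - s) * Lu s x)) D"
    unfolding has_time_deriv_L2L2_def
  proof (intro conjI)
    show "L2L2 T S (\<lambda>t x. integral\<^sup>L (lebesgue_on {0..t}) (\<lambda>s. vo_kernel \<alpha> (t - s) * Lu s x))"
    proof (rule L2L2_I(1)[OF pcv_l2(1)[OF k Ll]])
      show "AE z in P. integral\<^sup>L (lebesgue_on {0..fst z}) (\<lambda>s. vo_kernel \<alpha> (fst z - s) * Lu s (snd z)) = pcv k ?L z"
        using AE_P_time
      proof eventually_elim
        case (elim z)
        show ?case unfolding v[OF elim] by (simp add: pcv_def Lu_def)
      qed
    qed
    show "L2L2 T S D" by (rule L2L2_I(1)[OF Dl DD])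
    show "AE x in lebesgue_on S. \<forall>t\<in>{0..T}. integrable (lebesgue_on {0..t}) (\<lambda>s. D s x) \<and>
      integral\<^sup>L (lebesgue_on {0..t}) (\<lambda>s. vo_kernel \<alpha> (t - s) * Lu s x) =
      integral\<^sup>L (lebesgue_on {0..0}) (\<lambda>s. vo_kernel \<alpha> (0 - s) * Lu s x) + integral\<^sup>L (lebesgue_on {0..t}) (\<lambda>s. D s x)"
      unfolding AE_lebesgue_on[OF S_borel] using slice_l2_AE(2)[OF Z]
    proof eventually_elim
      case (elim x)
      have Zi: "integrable Mt (\<lambda>s. Z (s, x))" by (rule l2_integrable1[OF elim])
      have Di: "integrable Mt (\<lambda>s. D s x)" unfolding D_def
        by (intro Bochner_Integration.integrable_minus Bochner_Integration.integrable_add Zi cv_integrable[OF m Zi])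
      show ?case
      proof (intro ballI conjI)
        fix t assume t: "t \<in> {0..T}"
        then have tT: "t \<le> T" by simp
        have T0: "0 \<in> {0..T}" using T by simp
        show "integrable (lebesgue_on {0..t}) (\<lambda>s. D s x)" by (rule integrable_lebesgue_on_Icc_subset[OF Di tT])
        have "cv k (\<lambda>s. Lu s x) t = - cv k (cv ?b' (\<lambda>s. Z (s, x))) t" unfolding Lu_def by (rule cv_minus_right)
        also have "\<dots> = - cv ?o (\<lambda>s. Z (s, x) + cv m (\<lambda>s. Z (s, x)) s) t" unfolding inv[OF Zi t] ..
        also have "\<dots> = cv ?o (\<lambda>s. D s x) t" unfolding D_def by (rule cv_minus_right[symmetric])
        finally show "integral\<^sup>L (lebesgue_on {0..t}) (\<lambda>s. vo_kernel \<alpha> (t - s) * Lu s x) =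
          integral\<^sup>L (lebesgue_on {0..0}) (\<lambda>s. vo_kernel \<alpha> (0 - s) * Lu s x) + integral\<^sup>L (lebesgue_on {0..t}) (\<lambda>s. D s x)"
          unfolding v[OF t] v[OF T0] cv_zero_time using integral_lebesgue_on_eq_cv_one[OF Db[of x] _ tT] by simp
      qed
    qed
  qed
  \<comment> \<open>By \<open>rel\<close>, \<open>y i\<close> is \<open>lam i\<close> times the
    coefficient of \<open>u\<close>, so the squares of the \<open>y i\<close> sum to the squared
    second-order norm. Expressed through \<open>Z\<close>, they are bounded without any factor
    \<open>lam i\<close>.\<close>
  define y where "y i = cv ?b' (co Z i)" for i
  have yl: "l2 Mt (y i)" for i unfolding y_def by (intro cv_l2 bi co_l2 Z)
  let ?B = "LINT t|Mt. \<bar>?b' t\<bar>"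
  have yle: "(n2 Mt (y i))\<^sup>2 \<le> ?B\<^sup>2 * (n2 Mt (co Z i))\<^sup>2" for i
    using power_mono[OF cv_l2(2)[OF bi co_l2(1)[OF Z, of i]], of 2] by (simp add: y_def power_mult_distrib)
  have sB: "summable (\<lambda>i. ?B\<^sup>2 * (n2 Mt (co Z i))\<^sup>2)" by (intro summable_mult bessel Z)
  have ys: "summable (\<lambda>i. (n2 Mt (y i))\<^sup>2)" by (rule summable_comparison_test'[OF sB, of 0]) (use yle in simp)
  have "(\<Sum>i. (n2 Mt (y i))\<^sup>2) \<le> (\<Sum>i. ?B\<^sup>2 * (n2 Mt (co Z i))\<^sup>2)" by (rule suminf_le[OF yle ys sB])
  also have "\<dots> = ?B\<^sup>2 * (\<Sum>i. (n2 Mt (co Z i))\<^sup>2)" by (rule suminf_mult[OF bessel(1)[OF Z]])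
  also have "\<dots> \<le> ?B\<^sup>2 * (n2 P Z)\<^sup>2" by (intro mult_left_mono bessel Z) simp
  finally have ysum: "(\<Sum>i. (n2 Mt (y i))\<^sup>2) \<le> (?B * n2 P Z)\<^sup>2" by (simp add: power_mult_distrib)
  have lamu: "AE t in Mt. \<forall>i. L2_on S (u t) \<and> ip_on S (u t) (phi i) = co ?U i t \<and> lam i * ip_on S (u t) (phi i) = y i t"
  proof -
    have "AE t in Mt. \<forall>i. co ?U i t = cv ?o (co W i) t \<and> lam i * cv ?o (co W i) t = y i t"
      unfolding AE_all_countable y_def using rel co_pcv[OF one_integrable W] by (intro allI AE_conjI) auto
    with slice_L2_on[OF Ul uU] show ?thesis by eventually_elim auto
  qed
  have chk: "AE t in Mt. in_checkH S lam phi 2 (u t) \<and> (checkH_norm S lam phi 2 (u t))\<^sup>2 = (\<Sum>i. (y i t)\<^sup>2)"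
    using lamu suminf_sq_l2(1)[OF yl ys]
  proof eventually_elim
    case (elim t)
    have e: "lam i powr 2 * (ip_on S (u t) (phi i))\<^sup>2 = (y i t)\<^sup>2" for i
    proof -
      have "lam i * ip_on S (u t) (phi i) = y i t" using elim(1) by blast
      moreover have "lam i powr 2 = (lam i)\<^sup>2" using lam_nonneg[of i] by simp
      ultimately show ?thesis by (simp only: power_mult_distrib[symmetric])
    qed
    show ?case unfolding in_checkH_def checkH_norm_def e using elim by (auto simp: suminf_nonneg)
  qed
  have gm: "(\<lambda>t. \<Sum>i. (y i t)\<^sup>2) \<in> borel_measurable borel" using suminf_sq_l2(2)[OF yl ys] by auto
  have chk2: "AE t in Mt. (checkH_norm S lam phi 2 (u t))\<^sup>2 = (\<Sum>i. (y i t)\<^sup>2)" using chk by eventually_elim simp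
  have 3: "L2checkH2 T S lam phi u"
    unfolding L2checkH2_def AE_lebesgue_on[OF atLeastAtMost_borel]
    using chk integral_lebesgue_on_cong(2)[OF atLeastAtMost_borel gm chk2] suminf_sq_l2(2)[OF yl ys]
    by (auto elim: eventually_mono)
  have n3: "L2checkH2_norm T S lam phi u \<le> ?B * n2 P Z"
    unfolding L2checkH2_norm_def integral_lebesgue_on_cong(1)[OF atLeastAtMost_borel gm chk2] suminf_sq_l2(3)[OF yl ys]
    by (rule real_le_lsqrt) (auto intro!: ysum mult_nonneg_nonneg)
  have 4: "AE x in lebesgue_on S. u 0 x = 0" by (simp add: u_def cv_zero_time)
  have 5: "AE t in lebesgue_on {0..T}. L2_on S (Lu t) \<and> (\<forall>i. ip_on S (Lu t) (phi i) = - lam i * ip_on S (u t) (phi i))"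
  proof -
    have "AE t in Mt. \<forall>i. co (pcv ?b' Z) i t = y i t"
      unfolding AE_all_countable y_def using co_pcv[OF bi Z] by blast
    with slice_L2_on[OF Ll LuL] lamu show ?thesis unfolding AE_lebesgue_on[OF atLeastAtMost_borel]
    proof eventually_elim
      case (elim t)
      have "co ?L i t = - co (pcv ?b' Z) i t" for i by (simp add: co_def)
      then show ?case using elim by (metis mult_minus_left)
    qed
  qed
  have 6: "AE z in lebesgue_on ({0..T} \<times> S). ut (fst z) (snd z) - D (fst z) (snd z) = f (fst z) (snd z)"
    unfolding AE_P_iff[symmetric] using eq F(2) DD utW by eventually_elim simp
  have 7: "L2L2 T S Lu" by (rule L2L2_I(1)[OF Ll LuL])
  have sol: "state_solution S lam phi \<alpha> T f u ut"
    unfolding state_solution_def using 1 3 4 5 2 6 7 by blast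
  \<comment> \<open>The three summands of the constant come from \<open>u\<close> as the time
    integral of \<open>W\<close>, from \<open>ut = W\<close>, and from the Laplacian as a
    convolution of \<open>Z\<close> with the complementary kernel.\<close>
  have "H1L2_norm T S u ut \<le> L2L2_norm T S u + L2L2_norm T S ut"
    unfolding H1L2_norm_def by (rule sqrt_sum_squares_le_sum) (auto simp: L2L2_norm_def)
  also have "\<dots> = n2 P ?U + n2 P W" by (simp only: L2L2_I(2)[OF Ul uU] L2L2_I(2)[OF W utW])
  also have "\<dots> \<le> (LINT t|Mt. \<bar>1\<bar>) * n2 P W + n2 P W" by (intro add_right_mono pcv_l2(2) one_integrable W)
  finally have "H1L2_norm T S u ut + L2checkH2_norm T S lam phi u \<le> (LINT t|Mt. \<bar>1\<bar>) * n2 P W + n2 P W + ?B * n2 P Z"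
    using n3 by linarith
  also have "\<dots> \<le> (LINT t|Mt. \<bar>1\<bar>) * (C * n2 P F) + C * n2 P F + ?B * (C * n2 P F)"
    by (intro add_mono mult_left_mono nW nZ) auto
  also have "\<dots> = (((LINT t|Mt. \<bar>1\<bar>) + 1 + ?B) * C) * L2L2_norm T S f"
    unfolding F(3) by (simp only: distrib_right mult.assoc mult_1_left)
  finally show ?thesis using sol by blast
qed

section \<open>Uniqueness\<close>

text \<open>The equation is integrated once in time: \<open>u\<close> is the integral of
  \<open>ut\<close>, the memory integral that of \<open>D\<close>, and both start from 0. Taking
  coefficients then leaves a Volterra equation for the coefficient of \<open>u\<close>
  itself.\<close>

lemma solution_modes:
  assumes T: "0 < T" and k: "integrable Mt k" and k\<alpha>: "\<And>t. t \<in> {0..T} \<Longrightarrow> k t = vo_kernel \<alpha> t"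
    and F: "l2 P F" "AE z in P. f (fst z) (snd z) = F z"
    and sol: "state_solution S lam phi \<alpha> T f u ut"
  obtains U where "l2 P U" "AE z in P. u (fst z) (snd z) = U z"
    "\<And>i. AE t in Mt. co U i t + lam i * cv k (co U i) t = cv (\<lambda>_. 1) (co F i) t"
proof -
  let ?o = "\<lambda>_::real. 1::real"
  from sol obtain Lu D where du: "has_time_deriv_L2L2 T S u ut" and u0: "AE x in lebesgue_on S. u 0 x = 0"
    and Lu: "L2L2 T S Lu"
    and Lco: "AE t in lebesgue_on {0..T}. L2_on S (Lu t) \<and> (\<forall>i. ip_on S (Lu t) (phi i) = - lam i * ip_on S (u t) (phi i))"
    and dv: "has_time_deriv_L2L2 T S (\<lambda>t x. integral\<^sup>L (lebesgue_on {0..t}) (\<lambda>s. vo_kernel \<alpha> (t - s) * Lu s x)) D"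
    and eq: "AE z in lebesgue_on ({0..T} \<times> S). ut (fst z) (snd z) - D (fst z) (snd z) = f (fst z) (snd z)"
    unfolding state_solution_def by blast
  obtain U where U: "l2 P U" "AE z in P. u (fst z) (snd z) = U z"
    using L2L2_rep[of u] du unfolding has_time_deriv_L2L2_def by blast
  obtain V where V: "l2 P V" "AE z in P. ut (fst z) (snd z) = V z"
    using L2L2_rep[of ut] du unfolding has_time_deriv_L2L2_def by blast
  obtain L where L: "l2 P L" "AE z in P. Lu (fst z) (snd z) = L z"
    using L2L2_rep[OF Lu] by blast
  obtain E where E: "l2 P E" "AE z in P. D (fst z) (snd z) = E z"
    using L2L2_rep[of D] dv unfolding has_time_deriv_L2L2_def by blast
  have [measurable]: "U \<in> borel_measurable P" "V \<in> borel_measurable P" "L \<in> borel_measurable P" "E \<in> borel_measurable P"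
    "k \<in> borel_measurable borel" "F \<in> borel_measurable P"
    using U V L E k F by (auto simp: l2_def)
  have UV: "AE z in P. U z = pcv ?o V z"
  proof (rule AE_pairI)
    have d: "AE x in lbon S. \<forall>t\<in>{0..T}. u t x = u 0 x + integral\<^sup>L (lebesgue_on {0..t}) (\<lambda>s. ut s x)"
      using du unfolding has_time_deriv_L2L2_def AE_lebesgue_on[OF S_borel] by (auto elim: eventually_mono)
    show "AE x in lbon S. AE t in Mt. U (t, x) = pcv ?o V (t, x)"
      using d u0[unfolded AE_lebesgue_on[OF S_borel]] AE_pair_swap[OF U(2)] AE_pair_swap[OF V(2)]
    proof eventually_elim
      case (elim x)
      have Vb: "(\<lambda>s. V (s, x)) \<in> borel_measurable borel" by (rule section_borel) measurable
      from elim(3) show ?case unfolding AE_lbon[OF atLeastAtMost_borel]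
      proof eventually_elim
        case (elim t)
        show ?case
        proof
          assume t: "t \<in> {0..T}"
          have "integral\<^sup>L (lebesgue_on {0..t}) (\<lambda>s. ut s x) = cv ?o (\<lambda>s. V (s, x)) t"
            using integral_lebesgue_on_eq_cv_one[OF Vb, where T = T and f = "\<lambda>s. ut s x" and t = t] \<open>AE t in Mt. ut (fst (t, x)) (snd (t, x)) = V (t, x)\<close> t by simp
          then show "U (t, x) = pcv ?o V (t, x)"
            using elim t \<open>\<forall>t\<in>{0..T}. u t x = u 0 x + _ t\<close> \<open>u 0 x = 0\<close> by (simp add: pcv_def)
        qed
      qed
    qed
  qed measurable
  have LE: "AE z in P. pcv k L z = pcv ?o E z"
  proof (rule AE_pairI)
    have d: "AE x in lbon S. \<forall>t\<in>{0..T}. integral\<^sup>L (lebesgue_on {0..t}) (\<lambda>s. vo_kernel \<alpha> (t - s) * Lu s x) =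
        integral\<^sup>L (lebesgue_on {0..0}) (\<lambda>s. vo_kernel \<alpha> (0 - s) * Lu s x) + integral\<^sup>L (lebesgue_on {0..t}) (\<lambda>s. D s x)"
      using dv unfolding has_time_deriv_L2L2_def AE_lebesgue_on[OF S_borel] by (auto elim: eventually_mono)
    show "AE x in lbon S. AE t in Mt. pcv k L (t, x) = pcv ?o E (t, x)"
      using d AE_pair_swap[OF L(2)] AE_pair_swap[OF E(2)]
    proof eventually_elim
      case (elim x)
      have Lb: "(\<lambda>s. L (s, x)) \<in> borel_measurable borel" and Eb: "(\<lambda>s. E (s, x)) \<in> borel_measurable borel"
        by (rule section_borel; measurable)+
      have l: "integral\<^sup>L (lebesgue_on {0..t}) (\<lambda>s. vo_kernel \<alpha> (t - s) * Lu s x) = cv k (\<lambda>s. L (s, x)) t" if t: "t \<in> {0..T}" for t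
        by (rule integral_lebesgue_on_eq_cv[where a = k and T = T]) (use t k\<alpha> Lb elim(2) in auto)
      have e: "integral\<^sup>L (lebesgue_on {0..t}) (\<lambda>s. D s x) = cv ?o (\<lambda>s. E (s, x)) t" if t: "t \<in> {0..T}" for t
        using integral_lebesgue_on_eq_cv_one[OF Eb, where T = T and f = "\<lambda>s. D s x" and t = t] elim(3) t by simp
      have T0: "0 \<in> {0..T}" using T by simp
      \<comment> \<open>At time 0 the memory integral runs over a single point, so its initial value
        vanishes.\<close>
      have "pcv k L (t, x) = pcv ?o E (t, x)" if t: "t \<in> {0..T}" for t
        using bspec[OF elim(1) t] unfolding l[OF t] l[OF T0] e[OF t] by (simp add: pcv_def cv_zero_time)
      then show ?case unfolding AE_lbon[OF atLeastAtMost_borel] by auto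
    qed
  qed measurable
  have VEF: "AE z in P. 1 * V z + (-1) * E z = F z"
    using eq[unfolded AE_P_iff[symmetric]] V(2) E(2) F(2) by eventually_elim simp
  have "AE t in Mt. co U i t + lam i * cv k (co U i) t = cv ?o (co F i) t" for i
  proof -
    have cL: "AE t in Mt. co L i t = - lam i * co U i t"
      using slice_L2_on[OF L] slice_L2_on[OF U] Lco[unfolded AE_lebesgue_on[OF atLeastAtMost_borel]]
      by eventually_elim metis
    have e1: "AE t in Mt. co U i t = co (pcv ?o V) i t" by (rule co_cong_AE[OF _ _ UV]) measurable
    have e2: "AE t in Mt. co (pcv k L) i t = co (pcv ?o E) i t" by (rule co_cong_AE[OF _ _ LE]) measurable
    have e3: "AE t in Mt. co (\<lambda>z. 1 * V z + (-1) * E z) i t = co F i t" by (rule co_cong_AE[OF _ _ VEF]) measurable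
    have cF: "AE t in Mt. co F i t = 1 * co V i t + (-1) * co E i t"
      using co_lincomb[OF V(1) E(1), of 1 "-1" i] e3 by eventually_elim simp
    have cm[measurable]: "co X' i \<in> borel_measurable borel" if "X' \<in> borel_measurable P" for X' using that by measurable
    have *: "AE t in Mt. t \<in> {0..T}" unfolding AE_lbon[OF atLeastAtMost_borel] by simp
    have U': "AE t in Mt. co U i t = cv ?o (co V i) t"
      using e1 co_pcv[OF one_integrable V(1), of i] by eventually_elim simp
    have L': "AE t in Mt. cv k (co L i) t = cv ?o (co E i) t"
      using e2 co_pcv[OF one_integrable E(1), of i] co_pcv[OF k L(1), of i] by eventually_elim simp
    from U' L' * cv_lincomb_AE[OF one_integrable l2_integrable1[OF co_l2(1)[OF V(1), of i]] l2_integrable1[OF co_l2(1)[OF E(1), of i]], of 1 "-1"]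
    show ?thesis
    proof eventually_elim
      case (elim t)
      have "cv ?o (co F i) t = cv ?o (\<lambda>s. 1 * co V i s + (-1) * co E i s) t"
        by (rule cv_cong_AE[OF _ _ _ cF]) (use elim in auto)
      moreover have "cv k (co L i) t = cv k (\<lambda>s. - lam i * co U i s) t"
        by (rule cv_cong_AE[OF _ _ _ cL]) (use elim in auto)
      moreover have "\<dots> = - lam i * cv k (co U i) t" by (rule cv_cmult_right)
      ultimately show ?case using elim by simp
    qed
  qed
  then show thesis by (rule that[OF U])
qed

text \<open>Each coefficient of the difference solves a homogeneous Volterra equation with kernel
  \<open>lam i * k\<close>. The weight that makes it a contraction may depend on \<open>i\<close>,
  since only vanishing is claimed.\<close>

lemma solution_unique:
  assumes T: "0 < T" and k: "integrable Mt k" and k\<alpha>: "\<And>t. t \<in> {0..T} \<Longrightarrow> k t = vo_kernel \<alpha> t"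
    and f: "L2L2 T S f"
    and sol1: "state_solution S lam phi \<alpha> T f u1 ut1" and sol2: "state_solution S lam phi \<alpha> T f u2 ut2"
  shows "AE z in lebesgue_on ({0..T} \<times> S). u1 (fst z) (snd z) = u2 (fst z) (snd z)"
proof -
  obtain F where F: "l2 P F" "AE z in P. f (fst z) (snd z) = F z" using L2L2_rep[OF f] by blast
  obtain U1 where U1: "l2 P U1" "AE z in P. u1 (fst z) (snd z) = U1 z"
    "\<And>i. AE t in Mt. co U1 i t + lam i * cv k (co U1 i) t = cv (\<lambda>_. 1) (co F i) t"
    using solution_modes[OF T k k\<alpha> F sol1] by blast
  obtain U2 where U2: "l2 P U2" "AE z in P. u2 (fst z) (snd z) = U2 z"
    "\<And>i. AE t in Mt. co U2 i t + lam i * cv k (co U2 i) t = cv (\<lambda>_. 1) (co F i) t"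
    using solution_modes[OF T k k\<alpha> F sol2] by blast
  have "AE z in P. 1 * U1 z + (-1) * U2 z = 0"
  proof (rule co_zero_imp_zero[OF l2_lincomb[OF U1(1) U2(1)]])
    fix i
    let ?v = "\<lambda>t. 1 * co U1 i t + (-1) * co U2 i t"
    have c: "l2 Mt (co U1 i)" "l2 Mt (co U2 i)" by (intro co_l2 U1 U2)+
    have "AE t in Mt. ?v t = 0"
    proof (rule volterra_unique[of T "\<lambda>t. lam i * k t"])
      show "integrable Mt (\<lambda>t. lam i * k t)" using k by simp
      show "l2 Mt ?v" by (rule l2_lincomb[OF c])
      show "AE t in Mt. ?v t + cv (\<lambda>t. lam i * k t) ?v t = 0"
        using U1(3)[of i] U2(3)[of i] cv_lincomb_AE[OF k l2_integrable1[OF c(1)] l2_integrable1[OF c(2)], of 1 "-1"]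
      proof eventually_elim
        case (elim t)
        have "cv (\<lambda>t. lam i * k t) ?v t = lam i * (1 * cv k (co U1 i) t + (-1) * cv k (co U2 i) t)"
          unfolding cv_cmult_left elim(3) ..
        then show ?case using elim(1,2) by (simp add: algebra_simps)
      qed
    qed
    with co_lincomb[OF U1(1) U2(1), of 1 "-1" i]
    show "AE t in Mt. co (\<lambda>z. 1 * U1 z + (-1) * U2 z) i t = 0" by eventually_elim simp
  qed
  with U1(2) U2(2) show ?thesis unfolding AE_P_iff[symmetric] by eventually_elim simp
qed

end

theorem theorem4p2:
  fixes \<Omega> :: "(real^'d) set" and lam :: "nat \<Rightarrow> real" and phi :: "nat \<Rightarrow> real^'d \<Rightarrow> real"
    and \<alpha> \<alpha>' :: "real \<Rightarrow> real" and T Qs :: real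
  assumes "CARD('d) \<le> 3"
    and "open \<Omega>" and "connected \<Omega>" and "\<Omega> \<noteq> {}" and "bounded \<Omega>" and "simply_connected \<Omega>"
    and "T > 0"
    and "dirichlet_eigensystem \<Omega> lam phi"
    and "\<forall>t\<in>{0..T}. 0 < \<alpha> t \<and> \<alpha> t < 1"
    and "\<forall>t\<in>{0..T}. (\<alpha> has_real_derivative \<alpha>' t) (at t within {0..T}) \<and> \<bar>\<alpha>' t\<bar> \<le> Qs"
  shows "\<exists>Q>0. \<forall>q c. L2L2 T \<Omega> q \<and> L2L2 T \<Omega> c \<longrightarrow>
           (\<exists>u ut. state_solution \<Omega> lam phi \<alpha> T (\<lambda>t x. q t x + c t x) u ut
              \<and> H1L2_norm T \<Omega> u ut + L2checkH2_norm T \<Omega> lam phi u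
                  \<le> Q * L2L2_norm T \<Omega> (\<lambda>t x. q t x + c t x))
         \<and> (\<forall>u1 ut1 u2 ut2.
              state_solution \<Omega> lam phi \<alpha> T (\<lambda>t x. q t x + c t x) u1 ut1 \<longrightarrow>
              state_solution \<Omega> lam phi \<alpha> T (\<lambda>t x. q t x + c t x) u2 ut2 \<longrightarrow>
              (AE z in lebesgue_on ({0..T} \<times> \<Omega>). u1 (fst z) (snd z) = u2 (fst z) (snd z)))"
proof -
  have S: "\<Omega> \<in> sets borel" using assms(2) by simp
  obtain \<phi> where "dirichlet_expansion \<Omega> \<phi> phi lam" by (rule dirichlet_expansion_exists[OF S assms(8)])
  then interpret dirichlet_expansion \<Omega> T \<phi> phi lam .
  have "\<exists>k m. integrable Mt k \<and> integrable Mt m \<and> (\<forall>t\<in>{0..T}. k t = vo_kernel \<alpha> t) \<and>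
    (\<forall>z t. integrable Mt z \<longrightarrow> t \<in> {0..T} \<longrightarrow>
      cv k (cv (beta_k (1 - \<alpha> 0)) z) t = cv (\<lambda>_. 1) (\<lambda>s. z s + cv m z s) t)"
    unfolding vo_kernel_def
    by (rule variable_order_kernel_inversion[OF assms(7) bspec[OF assms(9)] bspec[OF assms(10)]]) blast+
  then obtain k m where k: "integrable Mt k" and m: "integrable Mt m"
    and k\<alpha>: "\<And>t. t \<in> {0..T} \<Longrightarrow> k t = vo_kernel \<alpha> t"
    and inv: "\<And>z t. integrable Mt z \<Longrightarrow> t \<in> {0..T} \<Longrightarrow>
      cv k (cv (beta_k (1 - \<alpha> 0)) z) t = cv (\<lambda>_. 1) (\<lambda>s. z s + cv m z s) t"
    by blast
  have a: "0 < \<alpha> 0" "\<alpha> 0 < 1" using assms(7,9) by auto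
  obtain C where C: "C > 0" and mode: "\<And>\<mu> f. 0 \<le> \<mu> \<Longrightarrow> l2 Mt f \<Longrightarrow> \<exists>w. l2 Mt w \<and>
      (AE t in Mt. w t + \<mu> * cv (beta_k (\<alpha> 0)) w t + cv m (\<lambda>t. \<mu> * cv (beta_k (\<alpha> 0)) w t) t = f t) \<and>
      n2 Mt w \<le> C * n2 Mt f \<and> n2 Mt (\<lambda>t. \<mu> * cv (beta_k (\<alpha> 0)) w t) \<le> C * n2 Mt f"
    using mode_solvable[OF a m] by blast
  \<comment> \<open>Built from \<open>T\<close> and quantities determined by the order function,
    before \<open>q\<close> and \<open>c\<close> are introduced; this is the required independence
    of the constant.\<close>
  let ?Q = "((LINT t|Mt. \<bar>1\<bar>) + 1 + (LINT t|Mt. \<bar>beta_k (1 - \<alpha> 0) t\<bar>)) * C"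
  have "0 < ?Q" by (intro mult_pos_pos C add_nonneg_pos add_pos_nonneg) auto
  moreover have sum: "L2L2 T \<Omega> (\<lambda>t x. q t x + c t x)" if "L2L2 T \<Omega> q" "L2L2 T \<Omega> c" for q c
    using that unfolding L2L2_def L2_on_iff_l2 by (rule l2_add)
  ultimately show ?thesis
    using solution_exists[OF assms(7) a k m k\<alpha> inv C mode sum] solution_unique[OF assms(7) k k\<alpha> sum]
    by (intro exI[of _ ?Q]) blast
qed

end
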